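(* Let $\mathbf{X}_1,\mathbf{X}_2,\ldots$ be i.i.d. $k$-variate random vectors with distribution $F$ and let $\boldsymbol{g}=(g_1,\ldots,g_p)^T$ be a vector of $r=p$ functionally independent estimating functions for the parameter $\boldsymbol{\theta}\in\Theta\subset\mathbb{R}^p$, with $E_F[\boldsymbol{g}(\mathbf{X},\boldsymbol{\theta}_0)]=\boldsymbol{0}_p$ at the true value $\boldsymbol{\theta}_0$. Assume: (i) $\boldsymbol{S}_{11}(\boldsymbol{\theta}_0)=E_F[\boldsymbol{g}(\mathbf{X},\boldsymbol{\theta}_0)\boldsymbol{g}(\mathbf{X},\boldsymbol{\theta}_0)^T]$ is positive definite and $\boldsymbol{S}_{12}(\boldsymbol{\theta}_0)=E_F[\boldsymbol{G}_{\mathbf{X}}(\boldsymbol{\theta}_0)]$ has rank $p$, where $\boldsymbol{G}_{\boldsymbol{x}}(\boldsymbol{\theta})=\partial\boldsymbol{g}(\boldsymbol{x},\boldsymbol{\theta})/\partial\boldsymbol{\theta}^T$; (ii) there is a neighbourhood of $\boldsymbol{\theta}_0$ in which $\|\boldsymbol{g}(\boldsymbol{x},\boldsymbol{\theta})\|^3$ is bounded by some integrable function of $\boldsymbol{x}$; (iii) there is a neighbourhood of $\boldsymbol{\theta}_0$ in which $\boldsymbol{G}_{\boldsymbol{x}}(\boldsymbol{\theta})$ is continuous and $\|\boldsymbol{G}_{\boldsymbol{x}}(\boldsymbol{\theta})\|$ is bounded by some integrable function of $\boldsymbol{x}$; (iv) there is a neighbourhood of $\boldsymbol{\theta}_0$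 in which $\partial\boldsymbol{G}_{\boldsymbol{x}}(\boldsymbol{\theta})/\partial\boldsymbol{\theta}$ is continuous and $\|\partial\boldsymbol{G}_{\boldsymbol{x}}(\boldsymbol{\theta})/\partial\boldsymbol{\theta}\|$ is bounded by some integrable function of $\boldsymbol{x}$; (v) $\boldsymbol{c}:\mathbb{R}^p\to\mathbb{R}^q$, $q\le p$, is such that the $q\times p$ matrix $\boldsymbol{C}(\boldsymbol{\theta})=\partial\boldsymbol{c}(\boldsymbol{\theta})/\partial\boldsymbol{\theta}^T$ exists, is continuous and has rank $q$, and there is a neighbourhood of $\boldsymbol{\theta}_0$ in which $\|\partial\boldsymbol{C}(\boldsymbol{\theta})/\partial\boldsymbol{\theta}\|$ is bounded by some constant. If the composite null hypothesis $H_0:\boldsymbol{c}(\boldsymbol{\theta})=\boldsymbol{0}_q$ holds (i.e. $\boldsymbol{c}(\boldsymbol{\theta}_0)=\boldsymbol{0}_q$), then for every $\phi\in\Phi$ $$T_n^{\phi}(\widehat{\boldsymbol{\theta}}_{E,n},\widetilde{\boldsymbol{\theta}}_{E,n})\ \longrightarrow\ \chi^2_q\quad\text{in law as }n\to\infty .$$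
   Context: Empirical likelihood. For $\boldsymbol{\theta}\in\Theta$, let $p_i(\boldsymbol{\theta})=\frac1n\,\frac{1}{1+\boldsymbol{t}(\boldsymbol{\theta})^T\boldsymbol{g}(\mathbf{X}_i,\boldsymbol{\theta})}$, $i=1,\ldots,n$, where $\boldsymbol{t}(\boldsymbol{\theta})\in\mathbb{R}^p$ (depending on the sample) is determined by $$\frac1n\sum_{i=1}^n\frac{\boldsymbol{g}(\mathbf{X}_i,\boldsymbol{\theta})}{1+\boldsymbol{t}(\boldsymbol{\theta})^T\boldsymbol{g}(\mathbf{X}_i,\boldsymbol{\theta})}=\boldsymbol{0}_p,\qquad p_i(\boldsymbol{\theta})\ge 0,\quad \sum_{i=1}^n p_i(\boldsymbol{\theta})=1 .$$ $F_{n,\boldsymbol{\theta}}$ is the discrete distribution putting mass $p_i(\boldsymbol{\theta})$ at $\mathbf{X}_i$, and $F_n$ puts mass $1/n$ at each $\mathbf{X}_i$. Let $\ell_{E,n}(\boldsymbol{\theta})=-\sum_{i=1}^n\log[1+\boldsymbol{t}(\boldsymbol{\theta})^T\boldsymbol{g}(\mathbf{X}_i,\boldsymbol{\theta})]$. The empirical maximum likelihood estimator $\widehat{\boldsymbol{\theta}}_{E,n}$ maximizes $\ell_{E,n}$; since $r=p$ it solves $\frac1n\sum_i\boldsymbol{g}(\mathbf{X}_i,\boldsymbol{\theta})=\boldsymbol{0}_p$, with $\boldsymbol{t}(\widehat{\boldsymbol{\theta}}_{E,n})=\boldsymbol{0}_p$ and $F_{n,\widehat{\boldsymbol{\theta}}_{E,n}}=F_n$.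 The empirical restricted maximum likelihood estimator $\widetilde{\boldsymbol{\theta}}_{E,n}$ maximizes $\ell_{E,n}$ subject to $\boldsymbol{c}(\boldsymbol{\theta})=\boldsymbol{0}_q$. Class $\Phi$. $\Phi$ is the set of convex functions $\phi:\mathbb{R}^+\to\mathbb{R}$ with $\phi(1)=0$, $\phi'(1)=0$, $\phi''(1)>0$, with the conventions $0\,\phi(0/0)=0$ and $0\,\phi(p/0)=p\lim_{u\to\infty}\phi(u)/u$. Test statistic. With $D_\phi(F_n,F_{n,\boldsymbol{\theta}})=\sum_{i=1}^n p_i(\boldsymbol{\theta})\,\phi\big(\tfrac{1}{n\,p_i(\boldsymbol{\theta})}\big)$, $$T_n^{\phi}(\widehat{\boldsymbol{\theta}}_{E,n},\widetilde{\boldsymbol{\theta}}_{E,n})=\frac{2n}{\phi''(1)}\Big(D_\phi(F_n,F_{n,\widetilde{\boldsymbol{\theta}}_{E,n}})-D_\phi(F_n,F_{n,\widehat{\boldsymbol{\theta}}_{E,n}})\Big)=\frac{2}{\phi''(1)}\sum_{i=1}^n\frac{\phi\big(1+\boldsymbol{t}(\widetilde{\boldsymbol{\theta}}_{E,n})^T\boldsymbol{g}(\mathbf{X}_i,\widetilde{\boldsymbol{\theta}}_{E,n})\big)}{1+\boldsymbol{t}(\widetilde{\boldsymbol{\theta}}_{E,n})^T\boldsymbol{g}(\mathbf{X}_i,\widetilde{\boldsymbol{\theta}}_{E,n})} .$$ Standing asymptotics of the estimators (quoted from Qin and Lawless, 1994, 1995). With $\boldsymbol{V}=(\boldsymbol{S}_{12}^T\boldsymbol{S}_{11}^{-1}\boldsymbol{S}_{12})^{-1}$,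 $\boldsymbol{Q}=(\boldsymbol{C}\boldsymbol{V}\boldsymbol{C}^T)^{-1}$ and $\boldsymbol{P}=\boldsymbol{V}-\boldsymbol{V}\boldsymbol{C}^T\boldsymbol{Q}\boldsymbol{C}\boldsymbol{V}$ (all at $\boldsymbol{\theta}_0$), it is assumed that under $H_0$, $\sqrt n(\widehat{\boldsymbol{\theta}}_{E,n}-\boldsymbol{\theta}_0)\to\mathcal{N}(\boldsymbol{0}_p,\boldsymbol{V})$ and $\sqrt n(\widetilde{\boldsymbol{\theta}}_{E,n}-\boldsymbol{\theta}_0)\to\mathcal{N}(\boldsymbol{0}_p,\boldsymbol{P})$ in law. *)

theory Defs
  imports "HOL-Probability.Probability"
begin

section \<open>Empirical likelihood\<close>

text \<open>
  A sample of size \<open>n\<close> is given by the values \<open>x 0, \<dots>, x (n - 1)\<close> of a sequence \<open>x\<close>.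
  For \<open>n > 0\<close> the sum constraint is redundant, and the sign constraint makes every \<open>1 + t \<bullet> g (x i) \<theta>\<close>
  strictly positive, because the denominators are required not to vanish.
\<close>

definition el_weight ::
  "('x \<Rightarrow> real ^ 'p \<Rightarrow> real ^ 'p) \<Rightarrow> nat \<Rightarrow> (nat \<Rightarrow> 'x) \<Rightarrow> real ^ 'p \<Rightarrow> real ^ 'p \<Rightarrow> nat \<Rightarrow> real" where
  "el_weight g n x \<theta> t i = (1 / real n) * (1 / (1 + t \<bullet> g (x i) \<theta>))"

definition el_multiplier ::
  "('x \<Rightarrow> real ^ 'p \<Rightarrow> real ^ 'p) \<Rightarrow> nat \<Rightarrow> (nat \<Rightarrow> 'x) \<Rightarrow> real ^ 'p \<Rightarrow> real ^ 'p \<Rightarrow> bool" where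
  "el_multiplier g n x \<theta> t \<longleftrightarrow>
     (\<forall>i<n. 1 + t \<bullet> g (x i) \<theta> \<noteq> 0) \<and>
     (1 / real n) *\<^sub>R (\<Sum>i<n. (1 / (1 + t \<bullet> g (x i) \<theta>)) *\<^sub>R g (x i) \<theta>) = 0 \<and>
     (\<forall>i<n. el_weight g n x \<theta> t i \<ge> 0) \<and>
     (\<Sum>i<n. el_weight g n x \<theta> t i) = 1"

definition el_feasible ::
  "('x \<Rightarrow> real ^ 'p \<Rightarrow> real ^ 'p) \<Rightarrow> nat \<Rightarrow> (nat \<Rightarrow> 'x) \<Rightarrow> real ^ 'p \<Rightarrow> bool" where
  "el_feasible g n x \<theta> \<longleftrightarrow> (\<exists>t. el_multiplier g n x \<theta> t)"

text \<open>
  The multiplier is unique only if the vectors \<open>g (x i) \<theta>\<close> span the space. In any case all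
  multipliers give the same values \<open>1 + t \<bullet> g (x i) \<theta>\<close>, hence the same weights and the same
  likelihood, so the choice made here is immaterial.
\<close>

definition el_t ::
  "('x \<Rightarrow> real ^ 'p \<Rightarrow> real ^ 'p) \<Rightarrow> nat \<Rightarrow> (nat \<Rightarrow> 'x) \<Rightarrow> real ^ 'p \<Rightarrow> real ^ 'p" where
  "el_t g n x \<theta> = (SOME t. el_multiplier g n x \<theta> t)"

definition el_prob ::
  "('x \<Rightarrow> real ^ 'p \<Rightarrow> real ^ 'p) \<Rightarrow> nat \<Rightarrow> (nat \<Rightarrow> 'x) \<Rightarrow> real ^ 'p \<Rightarrow> nat \<Rightarrow> real" where
  "el_prob g n x \<theta> i = el_weight g n x \<theta> (el_t g n x \<theta>) i"

definition el_loglik ::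
  "('x \<Rightarrow> real ^ 'p \<Rightarrow> real ^ 'p) \<Rightarrow> nat \<Rightarrow> (nat \<Rightarrow> 'x) \<Rightarrow> real ^ 'p \<Rightarrow> real" where
  "el_loglik g n x \<theta> = - (\<Sum>i<n. ln (1 + el_t g n x \<theta> \<bullet> g (x i) \<theta>))"

text \<open>
  The likelihood is only defined at the feasible parameters, so these are the competitors in the
  maximization over a parameter set \<open>S\<close>.
\<close>

definition el_maximizer ::
  "('x \<Rightarrow> real ^ 'p \<Rightarrow> real ^ 'p) \<Rightarrow> nat \<Rightarrow> (nat \<Rightarrow> 'x) \<Rightarrow> (real ^ 'p) set \<Rightarrow> real ^ 'p \<Rightarrow> bool" where
  "el_maximizer g n x S \<theta> \<longleftrightarrow>
     is_arg_max (el_loglik g n x) (\<lambda>\<theta>'. \<theta>' \<in> S \<and> el_feasible g n x \<theta>') \<theta>"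


section \<open>Phi-divergence test statistic\<close>

text \<open>
  Second differentiability at \<open>1\<close> is spelled out, since \<^const>\<open>deriv\<close> is total. Only the values
  on the open half line matter below: the weights of a feasible parameter are strictly positive,
  so the conventions for \<open>0 \<phi>(0/0)\<close> and \<open>0 \<phi>(p/0)\<close> never come into play.
\<close>

definition phi_class :: "(real \<Rightarrow> real) set" where
  "phi_class = {\<phi>. convex_on {0<..} \<phi> \<and>
     (\<forall>\<^sub>F u in nhds 1. \<phi> field_differentiable (at u)) \<and>
     deriv \<phi> field_differentiable (at 1) \<and>
     \<phi> 1 = 0 \<and> deriv \<phi> 1 = 0 \<and> deriv (deriv \<phi>) 1 > 0}"

text \<open>Divergence between the uniform weights \<open>1 / n\<close> and the weights \<open>w i\<close> at \<open>n\<close> points.\<close>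

definition phi_divergence :: "(real \<Rightarrow> real) \<Rightarrow> nat \<Rightarrow> (nat \<Rightarrow> real) \<Rightarrow> real" where
  "phi_divergence \<phi> n w = (\<Sum>i<n. w i * \<phi> (1 / (real n * w i)))"

definition phi_statistic ::
  "(real \<Rightarrow> real) \<Rightarrow> ('x \<Rightarrow> real ^ 'p \<Rightarrow> real ^ 'p) \<Rightarrow> nat \<Rightarrow> (nat \<Rightarrow> 'x) \<Rightarrow>
     real ^ 'p \<Rightarrow> real ^ 'p \<Rightarrow> real" where
  "phi_statistic \<phi> g n x \<theta>\<^sub>1 \<theta>\<^sub>2 =
     2 * real n / deriv (deriv \<phi>) 1 *
       (phi_divergence \<phi> n (el_prob g n x \<theta>\<^sub>2) - phi_divergence \<phi> n (el_prob g n x \<theta>\<^sub>1))"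


section \<open>Laws and convergence\<close>

text \<open>
  Empirical likelihood estimators exist only with probability tending to one. The inner events
  \<open>A n\<close> avoid a measurability requirement on the property itself.
\<close>

definition with_prob_tending_to_one :: "'w measure \<Rightarrow> (nat \<Rightarrow> 'w \<Rightarrow> bool) \<Rightarrow> bool" where
  "with_prob_tending_to_one M R \<longleftrightarrow>
     (\<exists>A. (\<forall>n. A n \<in> sets M \<and> (\<forall>\<omega>\<in>A n. R n \<omega>)) \<and> (\<lambda>n. measure M (A n)) \<longlonglongrightarrow> 1)"

text \<open>Weak convergence beyond the real line, where \<^const>\<open>weak_conv_m\<close> is not available.\<close>

definition weak_conv_top ::
  "(nat \<Rightarrow> 'a::topological_space measure) \<Rightarrow> 'a measure \<Rightarrow> bool" where
  "weak_conv_top N_seq N \<longleftrightarrow>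
     (\<forall>f::'a \<Rightarrow> real. continuous_on UNIV f \<longrightarrow> bounded (range f) \<longrightarrow>
        (\<lambda>n. \<integral>x. f x \<partial>(N_seq n)) \<longlonglongrightarrow> (\<integral>x. f x \<partial>N))"

definition std_normal_vec :: "(real ^ 'n) measure" where
  "std_normal_vec = density lborel (\<lambda>z. ennreal (\<Prod>i\<in>UNIV. std_normal_density (z $ i)))"

text \<open>
  The law of \<open>m + A Z\<close> depends on \<open>A\<close> only through \<open>A A\<^sup>T\<close>, and every symmetric positive
  semidefinite \<open>\<Sigma>\<close>, possibly singular, is of the form \<open>A A\<^sup>T\<close> with a square matrix \<open>A\<close>.
\<close>

definition normal_vec :: "real ^ 'n \<Rightarrow> real ^ 'n ^ 'n \<Rightarrow> (real ^ 'n) measure" where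
  "normal_vec m \<Sigma> =
     distr std_normal_vec borel
       (\<lambda>z. m + (SOME A :: real ^ 'n ^ 'n. A ** transpose A = \<Sigma>) *v z)"

definition chi_square :: "nat \<Rightarrow> real measure" where
  "chi_square q =
     distr (\<Pi>\<^sub>M i\<in>{..<q}. std_normal_distribution) borel (\<lambda>z. \<Sum>i<q. (z i)\<^sup>2)"


section \<open>Matrices\<close>

definition pos_def :: "real ^ 'n ^ 'n \<Rightarrow> bool" where
  "pos_def A \<longleftrightarrow> transpose A = A \<and> (\<forall>v. v \<noteq> 0 \<longrightarrow> v \<bullet> (A *v v) > 0)"

definition outer :: "real ^ 'm \<Rightarrow> real ^ 'n \<Rightarrow> real ^ 'n ^ 'm" where
  "outer u v = (\<chi> i j. u $ i * v $ j)"

end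

(* The r = p estimating equations have an exact root near the true parameter, so the unrestricted
   maximizer carries the uniform weights and contributes no divergence. For a parameter at distance
   h / sqrt n from the true one, the multiplier solves S\<^sub>1\<^sub>1 t = z up to a negligible error, where
   z = Z + S\<^sub>1\<^sub>2 h and Z is the normalized sum of the estimating functions at the true parameter.
   Hence both the statistic and -2 times the log-likelihood are z \<bullet> S\<^sub>1\<^sub>1\<^sup>-\<^sup>1 z + o(1).
   The restricted maximizer is only used through its tightness and its optimality: comparing it with
   a feasible point of the constraint surface next to the constrained minimizer of the quadratic form
   shows that the statistic is the minimum of that form over the tangent space, up to o(1). This
   minimum is the sum of the squares of q orthonormal linear forms in Z, whose Laplace transform is
   computed from the one-dimensional central limit theorem by writing exp (- s |y|\<^sup>2) as a Gaussian
   average of exp (i w \<bullet> y). *)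

theory Submission
  imports Defs "HOL-Real_Asymp.Real_Asymp"
begin

text \<open>Neither the multipliers nor the sets on which the maximizers exist are known to be
  measurable. The expansions are therefore carried out pathwise, as limits along a filter on pairs
  of sample size and outcome; measurability is asked only of the estimators, the statistic and
  explicit averages. The scaling keeps everything bounded: the summands are
  \<open>g / sqrt n\<close> and the multiplier is \<open>sqrt n\<close> times the original one. The
  summands are uniformly small, because a bound on the average of an envelope of
  \<open>norm g ^ 3\<close> gives \<open>norm g = O(n^(1/3))\<close> at all sample points at once.
  Log-likelihood and divergence share one expansion, since both are sums of functions that behave
  like \<open>u^2 / 2\<close> at the origin; optimality for the former thus becomes an inequality
  for the latter. The opposite inequality comes from the constraint alone: the rescaled deviation of
  a point with \<open>c = 0\<close> is nearly tangent. For the limit law, the approximating variable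
  is nonnegative, and on the half line step functions are uniform limits of combinations of
  \<open>exp (- k t)\<close> with integer \<open>k\<close>; hence Laplace transforms suffice and no
  vector-valued limit theorem enters.\<close>

lemma norm_matrix_vector_mult_le:
  fixes A :: "real ^ 'n ^ 'm" and x :: "real ^ 'n"
  shows "norm (A *v x) \<le> norm A * norm x"
proof -
  have "norm (A *v x) \<le> L2_set (\<lambda>i. norm (A $ i) * norm x) UNIV"
    unfolding norm_vec_def [of "A *v x"]
    by (rule L2_set_mono) (auto simp: matrix_vector_mul_component Cauchy_Schwarz_ineq2)
  also have "\<dots> = norm A * norm x"
    by (simp add: norm_vec_def [of A] L2_set_left_distrib)
  finally show ?thesis .
qed

lemma bounded_bilinear_matrix_vector_mult:
  "bounded_bilinear ((*v) :: real ^ 'n ^ 'm \<Rightarrow> real ^ 'n \<Rightarrow> real ^ 'm)"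
  by (rule bounded_bilinear.intro)
    (auto simp: matrix_vector_mult_add_rdistrib matrix_vector_right_distrib scaleR_matrix_vector_assoc
      matrix_vector_mult_scaleR intro!: exI [of _ 1] norm_matrix_vector_mult_le)

text \<open>Brouwer: a fixed point of \<open>x - f x\<close> is a zero of \<open>f\<close>. All
  roots of the development come from here, namely multipliers, solutions of the estimating equations
  and points of the constraint surface. An invariant ball and continuity are enough, so no
  contraction estimate arises.\<close>

lemma exists_zero_cball:
  fixes f :: "'a::euclidean_space \<Rightarrow> 'a"
  assumes "continuous_on (cball 0 r) f" "0 < r" "\<And>x. norm x \<le> r \<Longrightarrow> norm (x - f x) \<le> r"
  shows "\<exists>x. norm x \<le> r \<and> f x = 0"
  using brouwer_surjective_cball [OF assms(1,2), of 0 "{0}"] assms(3)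
  by (auto simp: dist_norm norm_minus_commute)

lemma outer_mult_vec: "outer u v *v x = (v \<bullet> x) *\<^sub>R u"
  by (simp add: vec_eq_iff outer_def matrix_vector_mult_def inner_vec_def sum_distrib_left mult_ac)

lemma sum_matrix_vector_mult: "(\<Sum>i\<in>I. A i) *v x = (\<Sum>i\<in>I. A i *v x)"
  by (induction I rule: infinite_finite_induct) (auto simp: matrix_vector_mult_add_rdistrib)

lemma pos_def_invertible:
  fixes S :: "real ^ 'n ^ 'n"
  assumes "pos_def S"
  shows "S ** matrix_inv S = mat 1" "matrix_inv S ** S = mat 1"
proof -
  have "\<And>x. S *v x = 0 \<Longrightarrow> x = 0"
    using assms unfolding pos_def_def by (metis inner_zero_right less_irrefl)
  then have "invertible S"
    by (metis invertible_left_inverse matrix_left_invertible_ker)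
  then have "\<exists>A'. S ** A' = mat 1 \<and> A' ** S = mat 1"
    by (simp add: invertible_def)
  from someI_ex [OF this] show "S ** matrix_inv S = mat 1" "matrix_inv S ** S = mat 1"
    by (simp_all add: matrix_inv_def)
qed

section \<open>Lagrange multipliers\<close>

text \<open>The multiplier system with strict positivity built in and without the normalization of
  the weights, which follows from the equation. The vectors are arbitrary, so that they can absorb
  the factor \<open>1 / sqrt n\<close>.\<close>

definition lagrange :: "nat \<Rightarrow> (nat \<Rightarrow> 'v::real_inner) \<Rightarrow> 'v \<Rightarrow> bool" where
  "lagrange n \<gamma> \<tau> \<longleftrightarrow>
     (\<forall>i<n. 1 + \<tau> \<bullet> \<gamma> i > 0) \<and> (\<Sum>i<n. (1 / (1 + \<tau> \<bullet> \<gamma> i)) *\<^sub>R \<gamma> i) = 0"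

text \<open>The map \<open>u \<mapsto> 1 / (1 + u)\<close> is strictly decreasing, so testing the
  difference of the two equations against \<open>s - t\<close> gives a vanishing sum of nonnegative
  terms. Only the inner products are determined, because the vectors need not span the
  space.\<close>

lemma lagrange_unique:
  assumes t: "lagrange n \<gamma> t" and s: "lagrange n \<gamma> s" and i: "i < n"
  shows "t \<bullet> \<gamma> i = s \<bullet> \<gamma> i"
proof -
  have pos: "1 + t \<bullet> \<gamma> j > 0" "1 + s \<bullet> \<gamma> j > 0" if "j < n" for j
    using t s that by (auto simp: lagrange_def)
  have "0 = (s - t) \<bullet> ((\<Sum>i<n. (1 / (1 + t \<bullet> \<gamma> i)) *\<^sub>R \<gamma> i) - (\<Sum>i<n. (1 / (1 + s \<bullet> \<gamma> i)) *\<^sub>R \<gamma> i))"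
    using t s by (simp add: lagrange_def)
  also have "\<dots> = (\<Sum>i<n. (s \<bullet> \<gamma> i - t \<bullet> \<gamma> i) * (1 / (1 + t \<bullet> \<gamma> i) - 1 / (1 + s \<bullet> \<gamma> i)))"
    by (simp add: sum_subtractf [symmetric] inner_sum_right algebra_simps inner_diff_left inner_diff_right)
  also have "\<dots> = (\<Sum>i<n. (s \<bullet> \<gamma> i - t \<bullet> \<gamma> i)\<^sup>2 / ((1 + t \<bullet> \<gamma> i) * (1 + s \<bullet> \<gamma> i)))"
  proof (intro sum.cong refl)
    fix j assume "j \<in> {..<n}"
    then have "1 + t \<bullet> \<gamma> j \<noteq> 0" "1 + s \<bullet> \<gamma> j \<noteq> 0" using pos [of j] by auto
    then show "(s \<bullet> \<gamma> j - t \<bullet> \<gamma> j) * (1 / (1 + t \<bullet> \<gamma> j) - 1 / (1 + s \<bullet> \<gamma> j))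
        = (s \<bullet> \<gamma> j - t \<bullet> \<gamma> j)\<^sup>2 / ((1 + t \<bullet> \<gamma> j) * (1 + s \<bullet> \<gamma> j))"
      by (simp add: diff_frac_eq power2_eq_square)
  qed
  finally have "(\<Sum>i<n. (s \<bullet> \<gamma> i - t \<bullet> \<gamma> i)\<^sup>2 / ((1 + t \<bullet> \<gamma> i) * (1 + s \<bullet> \<gamma> i))) = 0" by simp
  then have "(s \<bullet> \<gamma> i - t \<bullet> \<gamma> i)\<^sup>2 / ((1 + t \<bullet> \<gamma> i) * (1 + s \<bullet> \<gamma> i)) = 0"
    using i pos by (subst (asm) sum_nonneg_eq_0_iff) (auto simp: less_imp_le)
  then show ?thesis using pos [OF i] by auto
qed

lemma inner_sum_outer:
  "\<tau> \<bullet> ((\<Sum>i\<in>I. outer (\<gamma> i) (\<gamma> i)) *v \<tau>) = (\<Sum>i\<in>I. (\<tau> \<bullet> \<gamma> i)\<^sup>2)"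
  by (simp add: sum_matrix_vector_mult outer_mult_vec inner_sum_right power2_eq_square inner_commute)

lemma abs_inner_le_mult: "norm v \<le> m \<Longrightarrow> \<bar>u \<bullet> v\<bar> \<le> norm u * m"
  by (meson Cauchy_Schwarz_ineq2 mult_left_mono norm_ge_zero order.trans)

text \<open>The scalar remainder \<open>1 / (1 + u) - 1 + u = u^2 / (1 + u)\<close> is at most
  \<open>2 u^2\<close> for \<open>\<bar>u\<bar> \<le> 1 / 2\<close>. One factor
  \<open>norm (\<gamma> i)\<close> is estimated by \<open>m\<close> and the squares add up to the
  quadratic form of \<open>S\<close>, so the error is \<open>m\<close> times a second-order
  quantity.\<close>

lemma lagrange_expansion:
  fixes \<gamma> :: "nat \<Rightarrow> real ^ 'p"
  assumes m: "\<And>i. i < n \<Longrightarrow> norm (\<gamma> i) \<le> m" and \<tau>: "norm \<tau> * m \<le> 1 / 2"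
  defines "S \<equiv> (\<Sum>i<n. outer (\<gamma> i) (\<gamma> i))"
  shows "norm ((\<Sum>i<n. (1 / (1 + \<tau> \<bullet> \<gamma> i)) *\<^sub>R \<gamma> i) - ((\<Sum>i<n. \<gamma> i) - S *v \<tau>))
     \<le> 2 * m * (\<tau> \<bullet> (S *v \<tau>))"
proof -
  have u: "\<bar>\<tau> \<bullet> \<gamma> i\<bar> \<le> 1 / 2" if "i < n" for i
    using abs_inner_le_mult [OF m [OF that], of \<tau>] \<tau> by simp
  have "(\<Sum>i<n. (1 / (1 + \<tau> \<bullet> \<gamma> i)) *\<^sub>R \<gamma> i) - ((\<Sum>i<n. \<gamma> i) - S *v \<tau>)
      = (\<Sum>i<n. (1 / (1 + \<tau> \<bullet> \<gamma> i) - 1 + \<tau> \<bullet> \<gamma> i) *\<^sub>R \<gamma> i)"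
    by (simp add: S_def sum_matrix_vector_mult outer_mult_vec sum_subtractf sum.distrib
        algebra_simps inner_commute)
  also have "norm \<dots> \<le> (\<Sum>i<n. 2 * m * (\<tau> \<bullet> \<gamma> i)\<^sup>2)"
  proof (intro order.trans [OF norm_sum] sum_mono)
    fix i assume "i \<in> {..<n}"
    then have i: "i < n" by simp
    define u where "u = \<tau> \<bullet> \<gamma> i"
    have u2: "1 + u \<ge> 1 / 2" using u [OF i] by (auto simp: u_def abs_le_iff)
    have eq: "1 / (1 + u) - 1 + u = u\<^sup>2 / (1 + u)"
      using u2 by (simp add: field_simps power2_eq_square)
    have "u\<^sup>2 / (1 + u) \<le> u\<^sup>2 / (1 / 2)" using u2 by (intro divide_left_mono) auto
    then have "\<bar>1 / (1 + u) - 1 + u\<bar> \<le> 2 * u\<^sup>2" using u2 unfolding eq by simp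
    then have "\<bar>1 / (1 + u) - 1 + u\<bar> * norm (\<gamma> i) \<le> 2 * u\<^sup>2 * m"
      using m [OF i] by (intro mult_mono) auto
    then show "norm ((1 / (1 + \<tau> \<bullet> \<gamma> i) - 1 + \<tau> \<bullet> \<gamma> i) *\<^sub>R \<gamma> i) \<le> 2 * m * (\<tau> \<bullet> \<gamma> i)\<^sup>2"
      by (simp add: u_def mult_ac)
  qed
  finally show "norm ((\<Sum>i<n. (1 / (1 + \<tau> \<bullet> \<gamma> i)) *\<^sub>R \<gamma> i) - ((\<Sum>i<n. \<gamma> i) - S *v \<tau>))
     \<le> 2 * m * (\<tau> \<bullet> (S *v \<tau>))"
    by (simp add: S_def inner_sum_outer sum_distrib_left)
qed

text \<open>The residual is close to \<open>z - S \<tau>\<close>, hence multiplying it by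
  \<open>- R\<close> gives a map close to \<open>\<tau> - R z\<close>, to which Brouwer applies. The
  three summands of \<open>le\<close> bound the leading term, the replacement of \<open>Sn\<close>
  by \<open>S\<close>, and the remainder of the expansion.\<close>

lemma lagrange_exists:
  fixes \<gamma> :: "nat \<Rightarrow> real ^ 'p"
  assumes m: "\<And>i. i < n \<Longrightarrow> norm (\<gamma> i) \<le> m" and r: "0 < r" "r * m \<le> 1 / 2"
  defines "Sn \<equiv> (\<Sum>i<n. outer (\<gamma> i) (\<gamma> i))"
  assumes R: "R ** S = mat 1" "S ** R = mat 1"
    and le: "norm R * norm (\<Sum>i<n. \<gamma> i) + norm R * (norm (S - Sn) * r) + norm R * (2 * m * (r * (norm Sn * r))) \<le> r"
  shows "\<exists>\<tau>. norm \<tau> \<le> r \<and> lagrange n \<gamma> \<tau>"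
proof -
  \<comment> \<open>For \<open>n = 0\<close> the bound \<open>m\<close> is unconstrained and may be
    negative.\<close>
  have mr: "norm \<tau> * m \<le> 1 / 2" if "norm \<tau> \<le> r" for \<tau> :: "real ^ 'p"
  proof (cases "m \<ge> 0")
    case True
    then show ?thesis using that r by (meson mult_right_mono order.trans)
  next
    case False
    then have "norm \<tau> * m \<le> 0" by (simp add: mult_nonneg_nonpos)
    then show ?thesis by simp
  qed
  define f where "f \<tau> = (\<Sum>i<n. (1 / (1 + \<tau> \<bullet> \<gamma> i)) *\<^sub>R \<gamma> i)" for \<tau>
  define z where "z = (\<Sum>i<n. \<gamma> i)"
  have u: "1 + \<tau> \<bullet> \<gamma> i > 0" if "norm \<tau> \<le> r" "i < n" for \<tau> i
    using abs_inner_le_mult [OF m [OF that(2)], of \<tau>] mr [OF that(1)] by (auto simp: abs_le_iff)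
  have cont: "continuous_on (cball 0 r) (\<lambda>\<tau>. - (R *v f \<tau>))"
    unfolding f_def using u
    by (intro continuous_intros linear_continuous_on_compose [OF _ matrix_vector_mul_linear]) fastforce+
  have "norm (\<tau> - - (R *v f \<tau>)) \<le> r" if \<tau>: "norm \<tau> \<le> r" for \<tau>
  proof -
    define e where "e = f \<tau> - (z - Sn *v \<tau>)"
    have q: "\<bar>\<tau> \<bullet> (Sn *v \<tau>)\<bar> \<le> r * (norm Sn * r)"
      by (rule order.trans [OF Cauchy_Schwarz_ineq2])
        (use \<tau> r in \<open>intro mult_mono order.trans [OF norm_matrix_vector_mult_le]; auto\<close>)
    have e: "norm e \<le> 2 * m * (r * (norm Sn * r))"
    proof (cases "n = 0")
      case True
      then show ?thesis by (simp add: e_def f_def z_def Sn_def)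
    next
      case False
      then have m0: "m \<ge> 0" using m [of 0] norm_ge_zero order.trans by blast
      have "norm e \<le> 2 * m * (\<tau> \<bullet> (Sn *v \<tau>))"
        unfolding e_def f_def z_def Sn_def by (rule lagrange_expansion [OF m mr [OF \<tau>]])
      also have "\<dots> \<le> 2 * m * (r * (norm Sn * r))" using q m0 by (intro mult_left_mono) auto
      finally show ?thesis .
    qed
    have "R *v (S *v \<tau>) = \<tau>" using R by (simp add: matrix_vector_mul_assoc)
    then have "\<tau> - - (R *v f \<tau>) = R *v z + R *v ((S - Sn) *v \<tau>) + R *v e"
      by (simp add: e_def matrix_vector_right_distrib matrix_vector_mult_diff_distrib matrix_vector_mult_diff_rdistrib
        algebra_simps)
    also have "norm \<dots> \<le> norm R * norm z + norm R * (norm (S - Sn) * r) + norm R * (2 * m * (r * (norm Sn * r)))"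
      by (intro order.trans [OF norm_triangle_ineq] add_mono order.trans [OF norm_matrix_vector_mult_le]
          mult_left_mono e \<tau>) auto
    finally show ?thesis using le by (simp add: z_def)
  qed
  from exists_zero_cball [OF cont r(1) this] obtain \<tau> where \<tau>: "norm \<tau> \<le> r" "R *v f \<tau> = 0" by auto
  then have "f \<tau> = 0" using R by (metis matrix_vector_mul_assoc matrix_vector_mul_lid matrix_vector_mult_0_right)
  then show ?thesis using \<tau> u by (auto simp: lagrange_def f_def)
qed

section \<open>Asymptotics of multipliers along a filter\<close>

lemma eventually_bdd_of_tendsto:
  fixes f :: "'a \<Rightarrow> 'b::real_normed_vector"
  assumes "(f \<longlongrightarrow> l) F"
  shows "\<forall>\<^sub>F x in F. norm (f x) \<le> norm l + 1"
  using order_tendstoD(2) [OF tendsto_norm [OF assms], of "norm l + 1"]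
  by (auto elim: eventually_mono)

lemma tendsto_zero_bound_mult:
  fixes f :: "'a \<Rightarrow> 'b::real_normed_vector" and g :: "'a \<Rightarrow> real"
  assumes "(g \<longlongrightarrow> 0) F" "\<forall>\<^sub>F x in F. norm (f x) \<le> g x * K"
  shows "(f \<longlongrightarrow> 0) F"
  by (rule tendsto_norm_zero_cancel, rule tendsto_sandwich [OF _ assms(2) tendsto_const])
    (auto intro: tendsto_mult_left_zero [OF assms(1)])

lemma tendsto_inner_zero_Bfun:
  fixes f h :: "'a \<Rightarrow> 'b::real_inner"
  assumes "Bfun f F" "(h \<longlongrightarrow> 0) F"
  shows "((\<lambda>\<xi>. f \<xi> \<bullet> h \<xi>) \<longlongrightarrow> 0) F"
  using bounded_bilinear.Bfun_prod_Zfun [OF bounded_bilinear_inner assms(1)] assms(2)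
  by (simp add: tendsto_Zfun_iff)

lemma quadratic_form_diff_lim:
  fixes R :: "real ^ 'p ^ 'p"
  assumes y: "Bfun y F" and w: "((\<lambda>\<xi>. z \<xi> - y \<xi>) \<longlongrightarrow> 0) F"
  shows "((\<lambda>\<xi>. z \<xi> \<bullet> (R *v z \<xi>) - y \<xi> \<bullet> (R *v y \<xi>)) \<longlongrightarrow> 0) F"
proof -
  obtain L where L: "\<forall>\<^sub>F \<xi> in F. norm (y \<xi>) \<le> L" using y by (auto elim: BfunE)
  have Ry: "Bfun (\<lambda>\<xi>. R *v y \<xi>) F"
  proof (rule BfunI [where K = "norm R * L"])
    show "\<forall>\<^sub>F \<xi> in F. norm (R *v y \<xi>) \<le> norm R * L"
      using L by eventually_elim (intro order.trans [OF norm_matrix_vector_mult_le] mult_left_mono, auto)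
  qed
  have Rw: "((\<lambda>\<xi>. R *v (z \<xi> - y \<xi>)) \<longlongrightarrow> 0) F"
    using bounded_linear.tendsto_zero [OF matrix_vector_mul_bounded_linear w] .
  have "((\<lambda>\<xi>. (R *v y \<xi>) \<bullet> (z \<xi> - y \<xi>) + y \<xi> \<bullet> (R *v (z \<xi> - y \<xi>)) + (z \<xi> - y \<xi>) \<bullet> (R *v (z \<xi> - y \<xi>))) \<longlongrightarrow> 0) F"
    using tendsto_inner [OF w Rw]
    by (intro tendsto_add_zero [OF tendsto_add_zero] tendsto_inner_zero_Bfun [OF Ry w]
        tendsto_inner_zero_Bfun [OF y Rw]) simp
  then show ?thesis
    by (simp add: inner_diff_left inner_diff_right inner_commute matrix_vector_mult_diff_distrib algebra_simps)
qed

text \<open>Provides one particular choice of multiplier that is bounded and solves the linearized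
  equation up to a null term. Boundedness is built into the choice; \<open>lagrange_unique\<close>
  later carries the conclusions over to any other multiplier through the inner products.\<close>

lemma lagrange_limit:
  fixes \<gamma> :: "'a \<Rightarrow> nat \<Rightarrow> real ^ 'p" and n :: "'a \<Rightarrow> nat"
  defines "z \<xi> \<equiv> (\<Sum>i<n \<xi>. \<gamma> \<xi> i)"
  assumes Sn: "((\<lambda>\<xi>. \<Sum>i<n \<xi>. outer (\<gamma> \<xi> i) (\<gamma> \<xi> i)) \<longlongrightarrow> S) F" and S: "pos_def S"
    and m: "(m \<longlongrightarrow> 0) F" "\<forall>\<^sub>F \<xi> in F. \<forall>i<n \<xi>. norm (\<gamma> \<xi> i) \<le> m \<xi>"
    and z: "\<forall>\<^sub>F \<xi> in F. norm (z \<xi>) \<le> K"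
  shows "\<exists>r. \<exists>\<tau>. (\<forall>\<^sub>F \<xi> in F. norm (\<tau> \<xi>) \<le> r \<and> lagrange (n \<xi>) (\<gamma> \<xi>) (\<tau> \<xi>)) \<and>
     ((\<lambda>\<xi>. S *v \<tau> \<xi> - z \<xi>) \<longlongrightarrow> 0) F"
proof -
  define R where "R = matrix_inv S"
  note R = pos_def_invertible [OF S, folded R_def]
  define S' where "S' \<xi> = (\<Sum>i<n \<xi>. outer (\<gamma> \<xi> i) (\<gamma> \<xi> i))" for \<xi>
  have S': "(S' \<longlongrightarrow> S) F" using Sn by (simp add: S'_def [abs_def])
  have S'0: "((\<lambda>\<xi>. norm (S - S' \<xi>)) \<longlongrightarrow> 0) F"
    using tendsto_norm_zero [OF Lim_null [THEN iffD1, OF S']] by (simp add: norm_minus_commute)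
  \<comment> \<open>The leading term \<open>R z\<close> has norm at most
    \<open>norm R * \<bar>K\<bar>\<close>; the additional one absorbs the two error terms, which
    tend to zero.\<close>
  define r where "r = norm R * \<bar>K\<bar> + 1"
  have r: "r > 0" unfolding r_def by (smt (verit) mult_nonneg_nonneg norm_ge_zero)
  have "((\<lambda>\<xi>. norm R * (norm (S - S' \<xi>) * r) + norm R * (2 * m \<xi> * (r * (norm (S' \<xi>) * r))))
      \<longlongrightarrow> norm R * (0 * r) + norm R * (2 * 0 * (r * (norm S * r)))) F"
    by (intro tendsto_intros S'0 S' m)
  then have 1: "\<forall>\<^sub>F \<xi> in F. norm R * (norm (S - S' \<xi>) * r) + norm R * (2 * m \<xi> * (r * (norm (S' \<xi>) * r))) < 1"
    by (simp add: order_tendstoD)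
  have "((\<lambda>\<xi>. r * m \<xi>) \<longlongrightarrow> r * 0) F" by (intro tendsto_intros m)
  from order_tendstoD(2) [OF this, of "1 / 2"] have 2: "\<forall>\<^sub>F \<xi> in F. r * m \<xi> < 1 / 2" by simp
  have ex: "\<forall>\<^sub>F \<xi> in F. \<exists>\<tau>. norm \<tau> \<le> r \<and> lagrange (n \<xi>) (\<gamma> \<xi>) \<tau>"
    using 1 2 m(2) z
  proof eventually_elim
    case (elim \<xi>)
    show ?case
    proof (rule lagrange_exists [where m = "m \<xi>" and R = R and S = S])
      have "norm R * norm (z \<xi>) \<le> norm R * \<bar>K\<bar>" using elim by (intro mult_left_mono) auto
      then show "norm R * norm (\<Sum>i<n \<xi>. \<gamma> \<xi> i) + norm R * (norm (S - (\<Sum>i<n \<xi>. outer (\<gamma> \<xi> i) (\<gamma> \<xi> i))) * r) +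
        norm R * (2 * m \<xi> * (r * (norm (\<Sum>i<n \<xi>. outer (\<gamma> \<xi> i) (\<gamma> \<xi> i)) * r))) \<le> r"
        using elim unfolding r_def z_def S'_def by linarith
    qed (use elim r R in auto)
  qed
  define \<tau> where "\<tau> \<xi> = (SOME \<tau>. norm \<tau> \<le> r \<and> lagrange (n \<xi>) (\<gamma> \<xi>) \<tau>)" for \<xi>
  have \<tau>: "\<forall>\<^sub>F \<xi> in F. norm (\<tau> \<xi>) \<le> r \<and> lagrange (n \<xi>) (\<gamma> \<xi>) (\<tau> \<xi>)"
    using ex by eventually_elim (unfold \<tau>_def, rule someI_ex)
  \<comment> \<open>The case distinction on the sample size is forced by \<open>m\<close>, which may
    be negative when there are no summands.\<close>
  have bd: "\<forall>\<^sub>F \<xi> in F. norm (S *v \<tau> \<xi> - z \<xi>) \<le>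
      (norm (S - S' \<xi>) * r + (if n \<xi> = 0 then 0 else 2 * m \<xi> * (r * (norm (S' \<xi>) * r)))) * 1"
    using 2 m(2) \<tau>
  proof eventually_elim
    case (elim \<xi>)
    define e where "e = (\<Sum>i<n \<xi>. (1 / (1 + \<tau> \<xi> \<bullet> \<gamma> \<xi> i)) *\<^sub>R \<gamma> \<xi> i) - (z \<xi> - S' \<xi> *v \<tau> \<xi>)"
    have e: "norm e \<le> (if n \<xi> = 0 then 0 else 2 * m \<xi> * (r * (norm (S' \<xi>) * r)))"
    proof (cases "n \<xi> = 0")
      case True
      then show ?thesis by (simp add: e_def z_def S'_def)
    next
      case False
      then have m0: "0 \<le> m \<xi>" using elim by (metis norm_ge_zero order.trans neq0_conv)
      have "norm (\<tau> \<xi>) * m \<xi> \<le> r * m \<xi>" using elim m0 by (intro mult_right_mono) auto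
      then have "norm e \<le> 2 * m \<xi> * (\<tau> \<xi> \<bullet> (S' \<xi> *v \<tau> \<xi>))"
        unfolding e_def z_def S'_def using elim by (intro lagrange_expansion) auto
      also have "\<tau> \<xi> \<bullet> (S' \<xi> *v \<tau> \<xi>) \<le> r * (norm (S' \<xi>) * r)"
        using elim r
        by (intro order.trans [OF norm_cauchy_schwarz] mult_mono order.trans [OF norm_matrix_vector_mult_le]) auto
      finally show ?thesis using m0 False by (simp add: mult_left_mono)
    qed
    have "S *v \<tau> \<xi> - z \<xi> = (S - S' \<xi>) *v \<tau> \<xi> + e"
      using elim by (simp add: e_def lagrange_def matrix_vector_mult_diff_rdistrib)
    also have "norm \<dots> \<le> norm (S - S' \<xi>) * r + norm e"
      using elim by (intro order.trans [OF norm_triangle_ineq] add_mono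
          order.trans [OF norm_matrix_vector_mult_le] mult_left_mono) auto
    finally show ?case using e by simp
  qed
  have "((\<lambda>\<xi>. norm (S - S' \<xi>) * r + (if n \<xi> = 0 then 0 else 2 * m \<xi> * (r * (norm (S' \<xi>) * r)))) \<longlongrightarrow> 0) F"
  proof -
    have "((\<lambda>\<xi>. 2 * m \<xi> * (r * (norm (S' \<xi>) * r))) \<longlongrightarrow> 2 * 0 * (r * (norm S * r))) F"
      by (intro tendsto_intros S' m)
    then have "((\<lambda>\<xi>. 2 * m \<xi> * (r * (norm (S' \<xi>) * r))) \<longlongrightarrow> 0) F" by simp
    from tendsto_norm_zero [OF this]
    have "((\<lambda>\<xi>. if n \<xi> = 0 then 0 else 2 * m \<xi> * (r * (norm (S' \<xi>) * r))) \<longlongrightarrow> 0) F"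
      by (rule tendsto_zero_bound_mult [where K = 1]) (simp add: eventually_mono)
    from tendsto_add_zero [OF tendsto_mult_left_zero [OF S'0] this] show ?thesis .
  qed
  from tendsto_zero_bound_mult [OF this bd] have "((\<lambda>\<xi>. S *v \<tau> \<xi> - z \<xi>) \<longlongrightarrow> 0) F" .
  with \<tau> show ?thesis by blast
qed

lemma lagrange_limit_ex:
  fixes \<gamma> :: "'a \<Rightarrow> nat \<Rightarrow> real ^ 'p" and n :: "'a \<Rightarrow> nat"
  assumes Sn: "((\<lambda>\<xi>. \<Sum>i<n \<xi>. outer (\<gamma> \<xi> i) (\<gamma> \<xi> i)) \<longlongrightarrow> S) F" and S: "pos_def S"
    and m: "(m \<longlongrightarrow> 0) F" "\<forall>\<^sub>F \<xi> in F. \<forall>i<n \<xi>. norm (\<gamma> \<xi> i) \<le> m \<xi>"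
    and z: "\<forall>\<^sub>F \<xi> in F. norm (\<Sum>i<n \<xi>. \<gamma> \<xi> i) \<le> K"
  shows "\<forall>\<^sub>F \<xi> in F. \<exists>\<tau>. lagrange (n \<xi>) (\<gamma> \<xi>) \<tau>"
proof -
  obtain r \<tau> where "\<forall>\<^sub>F \<xi> in F. norm (\<tau> \<xi>) \<le> r \<and> lagrange (n \<xi>) (\<gamma> \<xi>) (\<tau> \<xi>)"
    using lagrange_limit [OF Sn S m z] by blast
  then show ?thesis by (auto elim!: eventually_mono)
qed

text \<open>Since the inner products are uniformly small, each \<open>\<psi>\<close> may be replaced
  by half a square, and the squares add up to the quadratic form of \<open>S\<close> at the
  multiplier, which is that of the inverse at \<open>z\<close>. The function \<open>\<psi>\<close>
  is left general so that the log-likelihood and the divergence are covered together.\<close>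

lemma lagrange_limit_sum:
  fixes \<gamma> :: "'a \<Rightarrow> nat \<Rightarrow> real ^ 'p" and n :: "'a \<Rightarrow> nat"
  defines "z \<xi> \<equiv> (\<Sum>i<n \<xi>. \<gamma> \<xi> i)"
  assumes Sn: "((\<lambda>\<xi>. \<Sum>i<n \<xi>. outer (\<gamma> \<xi> i) (\<gamma> \<xi> i)) \<longlongrightarrow> S) F" and S: "pos_def S"
    and m: "(m \<longlongrightarrow> 0) F" "\<forall>\<^sub>F \<xi> in F. \<forall>i<n \<xi>. norm (\<gamma> \<xi> i) \<le> m \<xi>"
    and z: "\<forall>\<^sub>F \<xi> in F. norm (z \<xi>) \<le> K"
    and t: "\<forall>\<^sub>F \<xi> in F. lagrange (n \<xi>) (\<gamma> \<xi>) (t \<xi>)"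
    and \<psi>: "((\<lambda>u. \<psi> u / u\<^sup>2) \<longlongrightarrow> 1 / 2) (at 0)" "\<psi> 0 = 0"
  shows "((\<lambda>\<xi>. 2 * (\<Sum>i<n \<xi>. \<psi> (t \<xi> \<bullet> \<gamma> \<xi> i)) - z \<xi> \<bullet> (matrix_inv S *v z \<xi>)) \<longlongrightarrow> 0) F"
proof -
  define R where "R = matrix_inv S"
  note R = pos_def_invertible [OF S, folded R_def]
  define S' where "S' \<xi> = (\<Sum>i<n \<xi>. outer (\<gamma> \<xi> i) (\<gamma> \<xi> i))" for \<xi>
  have S': "(S' \<longlongrightarrow> S) F" using Sn by (simp add: S'_def [abs_def])
  obtain r \<tau> where \<tau>: "\<forall>\<^sub>F \<xi> in F. norm (\<tau> \<xi>) \<le> r \<and> lagrange (n \<xi>) (\<gamma> \<xi>) (\<tau> \<xi>)"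
     and lim: "((\<lambda>\<xi>. S *v \<tau> \<xi> - z \<xi>) \<longlongrightarrow> 0) F"
    using lagrange_limit [OF Sn S m z [unfolded z_def]] unfolding z_def by blast
  define w where "w \<xi> = S *v \<tau> \<xi> - z \<xi>" for \<xi>
  have w: "(w \<longlongrightarrow> 0) F" using lim by (simp add: w_def [abs_def])
  have B\<tau>: "Bfun \<tau> F" using \<tau> by (intro BfunI [where K = r]) (auto elim: eventually_mono)
  have Bz: "Bfun z F" using z by (intro BfunI [where K = K]) auto
  note MV = bounded_bilinear_matrix_vector_mult
  have Rw: "((\<lambda>\<xi>. R *v w \<xi>) \<longlongrightarrow> 0) F"
    using bounded_linear.tendsto_zero [OF matrix_vector_mul_bounded_linear w] .
  have A: "((\<lambda>\<xi>. \<tau> \<xi> \<bullet> (S *v \<tau> \<xi>) - z \<xi> \<bullet> (R *v z \<xi>)) \<longlongrightarrow> 0) F"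
  proof -
    have "\<tau> \<xi> \<bullet> (S *v \<tau> \<xi>) - z \<xi> \<bullet> (R *v z \<xi>) = z \<xi> \<bullet> (R *v w \<xi>) + \<tau> \<xi> \<bullet> w \<xi>" for \<xi>
    proof -
      have "R *v (z \<xi> + w \<xi>) = \<tau> \<xi>" using R by (simp add: w_def matrix_vector_mul_assoc)
      then show ?thesis by (simp add: w_def inner_diff_right inner_commute matrix_vector_right_distrib
            inner_add_right algebra_simps matrix_vector_mult_diff_distrib)
    qed
    then show ?thesis using tendsto_add_zero [OF tendsto_inner_zero_Bfun [OF Bz Rw] tendsto_inner_zero_Bfun [OF B\<tau> w]] by simp
  qed
  have B: "((\<lambda>\<xi>. \<tau> \<xi> \<bullet> (S' \<xi> *v \<tau> \<xi>) - \<tau> \<xi> \<bullet> (S *v \<tau> \<xi>)) \<longlongrightarrow> 0) F"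
  proof -
    have "Zfun (\<lambda>\<xi>. (S' \<xi> - S) *v \<tau> \<xi>) F"
      using bounded_bilinear.Zfun_prod_Bfun [OF MV _ B\<tau>] S' by (simp add: tendsto_Zfun_iff)
    then have "((\<lambda>\<xi>. (S' \<xi> - S) *v \<tau> \<xi>) \<longlongrightarrow> 0) F" by (simp add: tendsto_Zfun_iff)
    from tendsto_inner_zero_Bfun [OF B\<tau> this] show ?thesis
      by (simp add: inner_diff_right matrix_vector_mult_diff_rdistrib)
  qed
  have AB: "((\<lambda>\<xi>. \<tau> \<xi> \<bullet> (S' \<xi> *v \<tau> \<xi>) - z \<xi> \<bullet> (R *v z \<xi>)) \<longlongrightarrow> 0) F"
    using tendsto_add [OF A B] by simp
  define L where L0: "L = r * ((norm S + 1) * r)"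
  have "\<forall>\<^sub>F \<xi> in F. norm (\<tau> \<xi> \<bullet> (S' \<xi> *v \<tau> \<xi>)) \<le> L" unfolding L0
    using \<tau> eventually_bdd_of_tendsto [OF S']
  proof eventually_elim
    case (elim \<xi>)
    then have "0 \<le> r" using norm_ge_zero order.trans by blast
    then show ?case using elim unfolding real_norm_def
      by (intro order.trans [OF Cauchy_Schwarz_ineq2] mult_mono order.trans [OF norm_matrix_vector_mult_le]) auto
  qed
  then have L: "\<forall>\<^sub>F \<xi> in F. \<tau> \<xi> \<bullet> (S' \<xi> *v \<tau> \<xi>) \<le> L"
    by (rule eventually_mono) (simp add: abs_le_iff)
  have C: "((\<lambda>\<xi>. 2 * (\<Sum>i<n \<xi>. \<psi> (t \<xi> \<bullet> \<gamma> \<xi> i)) - \<tau> \<xi> \<bullet> (S' \<xi> *v \<tau> \<xi>)) \<longlongrightarrow> 0) F"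
  proof (rule tendstoI)
    fix e :: real assume e: "0 < e"
    \<comment> \<open>Here \<open>L\<close> bounds the quadratic form, and the accumulated error is
      at most \<open>2 * d * \<bar>L\<bar>\<close>, which is below \<open>e\<close> for this
      \<open>d\<close>.\<close>
    define d where "d = e / (2 * (\<bar>L\<bar> + 1))"
    have d: "d > 0" using e by (simp add: d_def)
    have "\<forall>\<^sub>F u in at 0. dist (\<psi> u / u\<^sup>2) (1 / 2) < d" using tendstoD [OF \<psi>(1) d] .
    then obtain \<rho> where \<rho>: "\<rho> > 0" "\<And>u. u \<noteq> 0 \<Longrightarrow> \<bar>u\<bar> < \<rho> \<Longrightarrow> \<bar>\<psi> u / u\<^sup>2 - 1 / 2\<bar> < d"
      by (auto simp: eventually_at dist_real_def)
    have u: "\<bar>2 * \<psi> u - u\<^sup>2\<bar> \<le> 2 * d * u\<^sup>2" if "\<bar>u\<bar> < \<rho>" for u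
    proof (cases "u = 0")
      case False
      have "2 * \<psi> u - u\<^sup>2 = 2 * (\<psi> u / u\<^sup>2 - 1 / 2) * u\<^sup>2" using False by (simp add: field_simps)
      then have "\<bar>2 * \<psi> u - u\<^sup>2\<bar> = 2 * \<bar>\<psi> u / u\<^sup>2 - 1 / 2\<bar> * u\<^sup>2" by (simp only: abs_mult) simp
      also have "\<dots> \<le> 2 * d * u\<^sup>2" using \<rho>(2) [OF False that] by (intro mult_right_mono) auto
      finally show ?thesis .
    qed (use \<psi> in simp)
    have "((\<lambda>\<xi>. r * m \<xi>) \<longlongrightarrow> r * 0) F" by (intro tendsto_intros m)
    then have "\<forall>\<^sub>F \<xi> in F. r * m \<xi> < \<rho>" using \<rho> by (simp add: order_tendstoD)
    then show "\<forall>\<^sub>F \<xi> in F. dist (2 * (\<Sum>i<n \<xi>. \<psi> (t \<xi> \<bullet> \<gamma> \<xi> i)) - \<tau> \<xi> \<bullet> (S' \<xi> *v \<tau> \<xi>)) 0 < e"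
      using m(2) \<tau> t L
    proof eventually_elim
      case (elim \<xi>)
      have q: "\<tau> \<xi> \<bullet> (S' \<xi> *v \<tau> \<xi>) = (\<Sum>i<n \<xi>. (\<tau> \<xi> \<bullet> \<gamma> \<xi> i)\<^sup>2)" by (simp add: S'_def inner_sum_outer)
      have "\<bar>2 * (\<Sum>i<n \<xi>. \<psi> (t \<xi> \<bullet> \<gamma> \<xi> i)) - \<tau> \<xi> \<bullet> (S' \<xi> *v \<tau> \<xi>)\<bar>
          = \<bar>\<Sum>i<n \<xi>. 2 * \<psi> (\<tau> \<xi> \<bullet> \<gamma> \<xi> i) - (\<tau> \<xi> \<bullet> \<gamma> \<xi> i)\<^sup>2\<bar>"
        using elim lagrange_unique [of "n \<xi>" "\<gamma> \<xi>" "t \<xi>" "\<tau> \<xi>"]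
        by (simp add: q sum_subtractf sum_distrib_left)
      also have "\<dots> \<le> (\<Sum>i<n \<xi>. 2 * d * (\<tau> \<xi> \<bullet> \<gamma> \<xi> i)\<^sup>2)"
      proof (intro order.trans [OF sum_abs] sum_mono u)
        fix i assume "i \<in> {..<n \<xi>}"
        then have i: "norm (\<gamma> \<xi> i) \<le> m \<xi>" using elim by auto
        have "0 \<le> m \<xi>" using i norm_ge_zero order.trans by blast
        then have "norm (\<tau> \<xi>) * m \<xi> \<le> r * m \<xi>" using elim by (intro mult_right_mono) auto
        then show "\<bar>\<tau> \<xi> \<bullet> \<gamma> \<xi> i\<bar> < \<rho>" using abs_inner_le_mult [OF i, of "\<tau> \<xi>"] elim by linarith
      qed
      also have "\<dots> = 2 * d * (\<tau> \<xi> \<bullet> (S' \<xi> *v \<tau> \<xi>))" by (simp add: q sum_distrib_left)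
      also have "\<dots> \<le> 2 * d * \<bar>L\<bar>" using elim d by (intro mult_left_mono) auto
      also have "\<dots> < 2 * d * (\<bar>L\<bar> + 1)" using d by simp
      also have "\<dots> = d * (2 * (\<bar>L\<bar> + 1))" by simp
      also have "\<dots> = e" unfolding d_def by (rule nonzero_eq_divide_eq [THEN iffD1]) auto
      finally show ?case by (simp add: dist_real_def)
    qed
  qed
  show ?thesis using tendsto_add [OF C AB] by (simp add: R_def)
qed

section \<open>Outer products and the pathwise model of the estimating equations\<close>

lemma norm_outer: "norm (outer u v) = norm u * norm v"
proof -
  have "norm (outer u v) = L2_set (\<lambda>i. \<bar>u $ i\<bar> * norm v) UNIV"
    unfolding norm_vec_def [of "outer u v"]
  proof (rule L2_set_cong [OF refl])
    fix i
    have "outer u v $ i = u $ i *\<^sub>R v" by (simp add: outer_def vec_eq_iff)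
    then show "norm (outer u v $ i) = \<bar>u $ i\<bar> * norm v" by simp
  qed
  also have "\<dots> = norm u * norm v" by (simp add: L2_set_left_distrib norm_vec_def [of u])
  finally show ?thesis .
qed

lemma outer_scaleR_left: "outer (r *\<^sub>R u) w = r *\<^sub>R outer u w"
  and outer_scaleR_right: "outer w (r *\<^sub>R u) = r *\<^sub>R outer w u"
  by (simp_all add: outer_def vec_eq_iff algebra_simps)

lemma norm_outer_diff_le: "norm (outer u u - outer w w) \<le> norm (u - w) * (norm u + norm w)"
proof -
  have "outer u u - outer w w = outer (u - w) u + outer w (u - w)"
    by (simp add: outer_def vec_eq_iff algebra_simps)
  also have "norm \<dots> \<le> norm (u - w) * norm u + norm w * norm (u - w)"
    by (metis norm_outer norm_triangle_ineq)
  finally show ?thesis by (simp add: algebra_simps)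
qed

lemma onorm_matrix_le: "onorm ((*v) (A :: real ^ 'n ^ 'm)) \<le> norm A"
  by (rule onorm_le) (rule norm_matrix_vector_mult_le)

text \<open>A pathwise setting: sample size and sample are functions of an index \<open>\<xi>\<close>, and the filter \<open>F\<close>
  carries all the randomness.\<close>

locale estimating_data =
  fixes F :: "'a filter" and n :: "'a \<Rightarrow> nat" and x :: "'a \<Rightarrow> nat \<Rightarrow> 'x"
    and g :: "'x \<Rightarrow> real ^ 'p \<Rightarrow> real ^ 'p" and G :: "'x \<Rightarrow> real ^ 'p \<Rightarrow> real ^ 'p ^ 'p"
    and H :: "'x \<Rightarrow> real ^ 'p \<Rightarrow> (real ^ 'p) \<Rightarrow>\<^sub>L (real ^ 'p ^ 'p)"
    and \<theta>\<^sub>0 :: "real ^ 'p" and \<rho> :: real and b :: "'x \<Rightarrow> real" and B K :: real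
    and \<Sigma> \<Gamma> :: "real ^ 'p ^ 'p"
  assumes n: "filterlim n at_top F" and \<rho>: "\<rho> > 0"
    and g_bound: "\<And>x \<theta>. \<theta> \<in> ball \<theta>\<^sub>0 \<rho> \<Longrightarrow> norm (g x \<theta>) ^ 3 \<le> b x"
    and g_deriv: "\<And>x \<theta>. \<theta> \<in> ball \<theta>\<^sub>0 \<rho> \<Longrightarrow> (g x has_derivative (\<lambda>h. G x \<theta> *v h)) (at \<theta>)"
    and G_bound: "\<And>x \<theta>. \<theta> \<in> ball \<theta>\<^sub>0 \<rho> \<Longrightarrow> norm (G x \<theta>) \<le> b x"
    and G_deriv: "\<And>x \<theta>. \<theta> \<in> ball \<theta>\<^sub>0 \<rho> \<Longrightarrow> (G x has_derivative blinfun_apply (H x \<theta>)) (at \<theta>)"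
    and H_bound: "\<And>x \<theta>. \<theta> \<in> ball \<theta>\<^sub>0 \<rho> \<Longrightarrow> norm (H x \<theta>) \<le> b x"
    and B: "B > 0" and b_avg: "\<forall>\<^sub>F \<xi> in F. (\<Sum>i<n \<xi>. b (x \<xi> i)) \<le> B * n \<xi>"
    and Z_bdd: "\<forall>\<^sub>F \<xi> in F. norm ((1 / sqrt (n \<xi>)) *\<^sub>R (\<Sum>i<n \<xi>. g (x \<xi> i) \<theta>\<^sub>0)) \<le> K"
    and S_lim: "((\<lambda>\<xi>. (1 / n \<xi>) *\<^sub>R (\<Sum>i<n \<xi>. outer (g (x \<xi> i) \<theta>\<^sub>0) (g (x \<xi> i) \<theta>\<^sub>0))) \<longlongrightarrow> \<Sigma>) F"
    and G_lim: "((\<lambda>\<xi>. (1 / n \<xi>) *\<^sub>R (\<Sum>i<n \<xi>. G (x \<xi> i) \<theta>\<^sub>0)) \<longlongrightarrow> \<Gamma>) F"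
    and \<Sigma>: "pos_def \<Sigma>" and \<Gamma>: "rank \<Gamma> = CARD('p)"
begin

text \<open>With this scaling the sum of the vectors is the normalized sum, the sum of their outer
  products is the empirical second moment matrix, and a multiplier for them is \<open>sqrt n\<close>
  times a multiplier for the original vectors.\<close>

definition \<gamma> :: "real ^ 'p \<Rightarrow> 'a \<Rightarrow> nat \<Rightarrow> real ^ 'p" where
  "\<gamma> \<theta> \<xi> i = (1 / sqrt (n \<xi>)) *\<^sub>R g (x \<xi> i) \<theta>"

definition zn :: "real ^ 'p \<Rightarrow> 'a \<Rightarrow> real ^ 'p" where
  "zn \<theta> \<xi> = (\<Sum>i<n \<xi>. \<gamma> \<theta> \<xi> i)"

definition Sn :: "real ^ 'p \<Rightarrow> 'a \<Rightarrow> real ^ 'p ^ 'p" where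
  "Sn \<theta> \<xi> = (\<Sum>i<n \<xi>. outer (\<gamma> \<theta> \<xi> i) (\<gamma> \<theta> \<xi> i))"

definition Gn :: "'a \<Rightarrow> real ^ 'p ^ 'p" where
  "Gn \<xi> = (1 / n \<xi>) *\<^sub>R (\<Sum>i<n \<xi>. G (x \<xi> i) \<theta>\<^sub>0)"

lemma \<theta>\<^sub>0_ball: "\<theta>\<^sub>0 \<in> ball \<theta>\<^sub>0 \<rho>" using \<rho> by simp

lemma b_nonneg: "b y \<ge> 0"
  using G_bound [OF \<theta>\<^sub>0_ball, of y] norm_ge_zero order.trans by blast

lemma g_lipschitz:
  assumes "\<theta> \<in> ball \<theta>\<^sub>0 \<rho>"
  shows "norm (g y \<theta> - g y \<theta>\<^sub>0) \<le> b y * norm (\<theta> - \<theta>\<^sub>0)"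
  by (rule differentiable_bound [OF convex_ball _ _ assms \<theta>\<^sub>0_ball, where f' = "\<lambda>\<theta> h. G y \<theta> *v h"])
    (auto intro!: has_derivative_at_withinI [OF g_deriv] order.trans [OF onorm_matrix_le G_bound] simp: mem_ball)

text \<open>Mean value inequality for \<open>g\<close> minus its linearization: the derivative
  \<open>G\<close> moves by at most \<open>b\<close> times the distance, because its own derivative
  \<open>H\<close> is bounded by \<open>b\<close>.\<close>

lemma g_taylor:
  assumes \<theta>: "\<theta> \<in> ball \<theta>\<^sub>0 \<rho>"
  shows "norm (g y \<theta> - g y \<theta>\<^sub>0 - G y \<theta>\<^sub>0 *v (\<theta> - \<theta>\<^sub>0)) \<le> b y * (norm (\<theta> - \<theta>\<^sub>0))\<^sup>2"
proof -
  \<comment> \<open>The intersection is convex and contains the segment, and all its points are at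
    most as far from \<open>\<theta>\<^sub>0\<close> as \<open>\<theta>\<close> is, so the variation
    of \<open>G\<close> is bounded uniformly on it.\<close>
  define S where "S = ball \<theta>\<^sub>0 \<rho> \<inter> cball \<theta>\<^sub>0 (norm (\<theta> - \<theta>\<^sub>0))"
  have S: "\<theta> \<in> S" "\<theta>\<^sub>0 \<in> S" "convex S"
    using \<theta> \<rho> by (auto simp: S_def dist_norm norm_minus_commute intro: convex_Int)
  have "norm (g y \<theta> - g y \<theta>\<^sub>0 - G y \<theta>\<^sub>0 *v (\<theta> - \<theta>\<^sub>0)) \<le> norm (\<theta> - \<theta>\<^sub>0) * (b y * norm (\<theta> - \<theta>\<^sub>0))"
  proof (rule differentiable_bound_linearization [where S = S and f' = "\<lambda>\<theta> h. G y \<theta> *v h"])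
    show "\<theta>\<^sub>0 + t *\<^sub>R (\<theta> - \<theta>\<^sub>0) \<in> S" if "t \<in> {0..1}" for t
      using convexD_alt [OF S(3) S(2,1), of t] that by (simp add: algebra_simps)
    show "(g y has_derivative (\<lambda>h. G y \<theta>' *v h)) (at \<theta>' within S)" if "\<theta>' \<in> S" for \<theta>'
      by (rule has_derivative_at_withinI [OF g_deriv]) (use that in \<open>simp add: S_def\<close>)
    show "onorm ((\<lambda>h. G y \<theta>' *v h) - (\<lambda>h. G y \<theta>\<^sub>0 *v h)) \<le> b y * norm (\<theta> - \<theta>\<^sub>0)" if \<theta>': "\<theta>' \<in> S" for \<theta>'
    proof -
      have "(\<lambda>h. G y \<theta>' *v h) - (\<lambda>h. G y \<theta>\<^sub>0 *v h) = (*v) (G y \<theta>' - G y \<theta>\<^sub>0)"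
        by (auto simp: matrix_vector_mult_diff_rdistrib)
      then have "onorm ((\<lambda>h. G y \<theta>' *v h) - (\<lambda>h. G y \<theta>\<^sub>0 *v h)) \<le> norm (G y \<theta>' - G y \<theta>\<^sub>0)"
        using onorm_matrix_le by metis
      also have "\<dots> \<le> b y * norm (\<theta>' - \<theta>\<^sub>0)"
        using \<theta>' unfolding S_def
        by (intro differentiable_bound [OF convex_ball _ _ _ \<theta>\<^sub>0_ball, where f' = "\<lambda>\<theta>. blinfun_apply (H y \<theta>)"])
          (auto intro!: has_derivative_at_withinI [OF G_deriv] H_bound simp flip: norm_blinfun.rep_eq)
      also have "\<dots> \<le> b y * norm (\<theta> - \<theta>\<^sub>0)"
        using \<theta>' by (intro mult_left_mono b_nonneg) (auto simp: S_def dist_norm norm_minus_commute)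
      finally show ?thesis .
    qed
  qed (use S in auto)
  then show ?thesis by (simp add: power2_eq_square mult_ac)
qed

text \<open>A single nonnegative term is at most the whole sum, which is at most \<open>B n\<close>;
  then take cube roots. This is where the third power enters: the exponent \<open>1 / 3\<close> is
  below \<open>1 / 2\<close>, so the bound is negligible after division by
  \<open>sqrt n\<close>.\<close>

lemma g_norm_le:
  assumes \<theta>: "\<theta> \<in> ball \<theta>\<^sub>0 \<rho>" and b: "(\<Sum>i<n \<xi>. b (x \<xi> i)) \<le> B * n \<xi>" and i: "i < n \<xi>"
  shows "norm (g (x \<xi> i) \<theta>) \<le> (B * n \<xi>) powr (1 / 3)"
proof -
  have "norm (g (x \<xi> i) \<theta>) ^ 3 \<le> b (x \<xi> i)" by (rule g_bound [OF \<theta>])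
  also have "b (x \<xi> i) \<le> (\<Sum>i<n \<xi>. b (x \<xi> i))" using i by (intro member_le_sum b_nonneg) auto
  finally have le: "norm (g (x \<xi> i) \<theta>) ^ 3 \<le> B * n \<xi>" using b by simp
  have "norm (g (x \<xi> i) \<theta>) = root 3 (norm (g (x \<xi> i) \<theta>) ^ 3)" by (simp add: real_root_power_cancel)
  also have "\<dots> \<le> root 3 (B * n \<xi>)" using le by simp
  also have "\<dots> = (B * n \<xi>) powr (1 / 3)" using i B by (simp add: root_powr_inverse)
  finally show ?thesis .
qed

text \<open>Each Taylor error is at most \<open>b\<close> times \<open>(norm h)\<^sup>2 / n\<close>.
  Their sum is at most \<open>B * (norm h)\<^sup>2\<close>, and the normalization contributes the
  remaining \<open>1 / sqrt n\<close>.\<close>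

lemma zn_expansion:
  assumes \<theta>: "\<theta> \<in> ball \<theta>\<^sub>0 \<rho>" and b: "(\<Sum>i<n \<xi>. b (x \<xi> i)) \<le> B * n \<xi>" and n0: "n \<xi> > 0"
  defines "h \<equiv> sqrt (n \<xi>) *\<^sub>R (\<theta> - \<theta>\<^sub>0)"
  shows "norm (zn \<theta> \<xi> - (zn \<theta>\<^sub>0 \<xi> + Gn \<xi> *v h)) \<le> B * (norm h)\<^sup>2 / sqrt (n \<xi>)"
proof -
  define s where "s = sqrt (n \<xi>)"
  have s: "s > 0" "s * s = n \<xi>" using n0 by (auto simp: s_def)
  have "Gn \<xi> *v h = (1 / s) *\<^sub>R ((\<Sum>i<n \<xi>. G (x \<xi> i) \<theta>\<^sub>0) *v (\<theta> - \<theta>\<^sub>0))"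
    using s by (simp add: Gn_def h_def s_def [symmetric] s(2) [symmetric] matrix_vector_mult_scaleR
        scaleR_matrix_vector_assoc [symmetric])
  also have "\<dots> = (1 / s) *\<^sub>R (\<Sum>i<n \<xi>. G (x \<xi> i) \<theta>\<^sub>0 *v (\<theta> - \<theta>\<^sub>0))"
    by (simp add: sum_matrix_vector_mult)
  finally have "zn \<theta> \<xi> - (zn \<theta>\<^sub>0 \<xi> + Gn \<xi> *v h)
      = (1 / s) *\<^sub>R (\<Sum>i<n \<xi>. g (x \<xi> i) \<theta> - g (x \<xi> i) \<theta>\<^sub>0 - G (x \<xi> i) \<theta>\<^sub>0 *v (\<theta> - \<theta>\<^sub>0))"
    by (simp add: zn_def \<gamma>_def s_def scaleR_sum_right [symmetric] sum_subtractf scaleR_diff_right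
        scaleR_add_right)
  also have "norm \<dots> \<le> (1 / s) * (\<Sum>i<n \<xi>. b (x \<xi> i) * (norm (\<theta> - \<theta>\<^sub>0))\<^sup>2)"
    using s by (auto intro!: divide_right_mono sum_norm_le g_taylor \<theta>)
  also have "\<dots> = (1 / s) * ((\<Sum>i<n \<xi>. b (x \<xi> i)) * (norm (\<theta> - \<theta>\<^sub>0))\<^sup>2)"
    by (simp add: sum_distrib_right)
  also have "\<dots> \<le> (1 / s) * ((B * n \<xi>) * (norm (\<theta> - \<theta>\<^sub>0))\<^sup>2)"
    using s by (intro mult_left_mono mult_right_mono b) auto
  also have "\<dots> = B * (norm h)\<^sup>2 / s"
  proof -
    have "norm h = s * norm (\<theta> - \<theta>\<^sub>0)" unfolding h_def norm_scaleR by (simp add: s_def)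
    then show ?thesis using s by (simp add: s(2) [symmetric] power2_eq_square field_simps)
  qed
  finally show ?thesis by (simp add: s_def)
qed

text \<open>The envelope \<open>b\<close> is controlled only in the mean, so it may be used for just
  one factor of the difference of outer products, through the Lipschitz bound. The other factor
  costs \<open>n^(1/3)\<close>, which the \<open>1 / sqrt n\<close> in
  \<open>\<theta> - \<theta>\<^sub>0\<close> more than pays for.\<close>

lemma Sn_expansion:
  assumes \<theta>: "\<theta> \<in> ball \<theta>\<^sub>0 \<rho>" and b: "(\<Sum>i<n \<xi>. b (x \<xi> i)) \<le> B * n \<xi>" and n0: "n \<xi> > 0"
  defines "h \<equiv> sqrt (n \<xi>) *\<^sub>R (\<theta> - \<theta>\<^sub>0)"
  shows "norm (Sn \<theta> \<xi> - Sn \<theta>\<^sub>0 \<xi>) \<le> 2 * B * norm h * (B * n \<xi>) powr (1 / 3) / sqrt (n \<xi>)"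
proof -
  define s where "s = sqrt (n \<xi>)"
  have s: "s > 0" "s * s = n \<xi>" using n0 by (auto simp: s_def)
  define m where "m = (B * n \<xi>) powr (1 / 3)"
  have m: "norm (g (x \<xi> i) \<theta>) \<le> m" "norm (g (x \<xi> i) \<theta>\<^sub>0) \<le> m" if "i < n \<xi>" for i
    using g_norm_le [OF \<theta> b that] g_norm_le [OF \<theta>\<^sub>0_ball b that] by (auto simp: m_def)
  have m0: "m \<ge> 0" by (simp add: m_def)
  have Sn: "Sn \<theta> \<xi> = (1 / n \<xi>) *\<^sub>R (\<Sum>i<n \<xi>. outer (g (x \<xi> i) \<theta>) (g (x \<xi> i) \<theta>))" for \<theta>
    using s by (simp add: Sn_def \<gamma>_def outer_scaleR_left outer_scaleR_right scaleR_sum_right)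
  have "Sn \<theta> \<xi> - Sn \<theta>\<^sub>0 \<xi> = (1 / n \<xi>) *\<^sub>R (\<Sum>i<n \<xi>. outer (g (x \<xi> i) \<theta>) (g (x \<xi> i) \<theta>) - outer (g (x \<xi> i) \<theta>\<^sub>0) (g (x \<xi> i) \<theta>\<^sub>0))"
    by (simp add: Sn sum_subtractf scaleR_diff_right)
  also have "norm \<dots> \<le> (1 / n \<xi>) * (\<Sum>i<n \<xi>. b (x \<xi> i) * norm (\<theta> - \<theta>\<^sub>0) * (2 * m))"
  proof -
    have "norm (outer (g (x \<xi> i) \<theta>) (g (x \<xi> i) \<theta>) - outer (g (x \<xi> i) \<theta>\<^sub>0) (g (x \<xi> i) \<theta>\<^sub>0))
        \<le> b (x \<xi> i) * norm (\<theta> - \<theta>\<^sub>0) * (2 * m)" if "i < n \<xi>" for i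
      using m [OF that] b_nonneg
      by (intro order.trans [OF norm_outer_diff_le] mult_mono g_lipschitz \<theta>) auto
    then show ?thesis by (auto intro!: divide_right_mono sum_norm_le)
  qed
  also have "\<dots> = (1 / n \<xi>) * ((\<Sum>i<n \<xi>. b (x \<xi> i)) * (norm (\<theta> - \<theta>\<^sub>0) * (2 * m)))"
    by (simp only: sum_distrib_right mult.assoc)
  also have "\<dots> \<le> (1 / n \<xi>) * ((B * n \<xi>) * (norm (\<theta> - \<theta>\<^sub>0) * (2 * m)))"
    using m0 by (intro mult_left_mono mult_right_mono b) auto
  also have "\<dots> = 2 * B * norm h * m / s"
  proof -
    have "norm h = s * norm (\<theta> - \<theta>\<^sub>0)" unfolding h_def norm_scaleR by (simp add: s_def)
    then show ?thesis using s n0 by (simp add: field_simps)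
  qed
  finally show ?thesis by (simp add: s_def m_def)
qed

lemma sqrt_n: "filterlim (\<lambda>\<xi>. sqrt (n \<xi>)) at_top F"
  by (rule filterlim_compose [OF _ n]) real_asymp

lemma n_pos: "\<forall>\<^sub>F \<xi> in F. n \<xi> > 0"
  using filterlim_at_top [THEN iffD1, OF n, rule_format, of 1] by (simp add: Suc_le_eq)

lemma m_lim: "((\<lambda>\<xi>. (B * n \<xi>) powr (1 / 3) / sqrt (n \<xi>)) \<longlongrightarrow> 0) F"
proof (rule filterlim_compose [OF _ n])
  show "(\<lambda>k. (B * real k) powr (1 / 3) / sqrt (real k)) \<longlonglongrightarrow> 0"
    using B by real_asymp
qed

section \<open>Parameters within order \<open>1 / sqrt n\<close> of the true one\<close>

context
  fixes \<theta> :: "'a \<Rightarrow> real ^ 'p" and r :: real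
  assumes r: "\<forall>\<^sub>F \<xi> in F. norm (sqrt (n \<xi>) *\<^sub>R (\<theta> \<xi> - \<theta>\<^sub>0)) \<le> r"
begin

lemma eventually_ball: "\<forall>\<^sub>F \<xi> in F. \<theta> \<xi> \<in> ball \<theta>\<^sub>0 \<rho>"
  using r n_pos filterlim_at_top_dense [THEN iffD1, OF sqrt_n, rule_format, of "r / \<rho>"]
proof eventually_elim
  case (elim \<xi>)
  have "sqrt (n \<xi>) * norm (\<theta> \<xi> - \<theta>\<^sub>0) \<le> r" using elim(1) unfolding norm_scaleR by simp
  also have "r < sqrt (n \<xi>) * \<rho>" using elim \<rho> by (simp add: pos_divide_less_eq)
  finally show ?case using elim by (simp add: dist_norm norm_minus_commute)
qed

lemma zn_lim: "((\<lambda>\<xi>. zn (\<theta> \<xi>) \<xi> - (zn \<theta>\<^sub>0 \<xi> + \<Gamma> *v (sqrt (n \<xi>) *\<^sub>R (\<theta> \<xi> - \<theta>\<^sub>0)))) \<longlongrightarrow> 0) F"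
proof -
  define h where "h \<xi> = sqrt (n \<xi>) *\<^sub>R (\<theta> \<xi> - \<theta>\<^sub>0)" for \<xi>
  have "((\<lambda>\<xi>. 1 / sqrt (n \<xi>)) \<longlongrightarrow> 0) F"
    using tendsto_inverse_0_at_top [OF sqrt_n] by (simp add: inverse_eq_divide)
  moreover have "\<forall>\<^sub>F \<xi> in F. norm (zn (\<theta> \<xi>) \<xi> - (zn \<theta>\<^sub>0 \<xi> + Gn \<xi> *v h \<xi>)) \<le> (1 / sqrt (n \<xi>)) * (B * r\<^sup>2)"
    using eventually_ball b_avg n_pos r
  proof eventually_elim
    case (elim \<xi>)
    have "B * (norm (h \<xi>))\<^sup>2 \<le> B * r\<^sup>2"
      using elim B by (intro mult_left_mono power_mono) (auto simp: h_def)
    then have "B * (norm (h \<xi>))\<^sup>2 / sqrt (n \<xi>) \<le> B * r\<^sup>2 / sqrt (n \<xi>)" by (intro divide_right_mono) auto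
    then show ?case using zn_expansion [OF elim(1-3)] by (simp add: h_def)
  qed
  ultimately have 1: "((\<lambda>\<xi>. zn (\<theta> \<xi>) \<xi> - (zn \<theta>\<^sub>0 \<xi> + Gn \<xi> *v h \<xi>)) \<longlongrightarrow> 0) F"
    by (rule tendsto_zero_bound_mult)
  have "Bfun h F" using r by (intro BfunI [where K = r]) (simp add: h_def)
  then have "Zfun (\<lambda>\<xi>. (Gn \<xi> - \<Gamma>) *v h \<xi>) F"
    using bounded_bilinear.Zfun_prod_Bfun [OF bounded_bilinear_matrix_vector_mult] G_lim
    by (simp add: tendsto_Zfun_iff Gn_def)
  then have 2: "((\<lambda>\<xi>. (Gn \<xi> - \<Gamma>) *v h \<xi>) \<longlongrightarrow> 0) F" by (simp add: tendsto_Zfun_iff)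
  show ?thesis using tendsto_add_zero [OF 1 2]
    by (simp add: matrix_vector_mult_diff_rdistrib h_def algebra_simps)
qed

lemma Sn_lim: "((\<lambda>\<xi>. Sn (\<theta> \<xi>) \<xi>) \<longlongrightarrow> \<Sigma>) F"
proof -
  have "((\<lambda>\<xi>. Sn (\<theta> \<xi>) \<xi> - Sn \<theta>\<^sub>0 \<xi>) \<longlongrightarrow> 0) F"
  proof (rule tendsto_zero_bound_mult [OF m_lim])
    show "\<forall>\<^sub>F \<xi> in F. norm (Sn (\<theta> \<xi>) \<xi> - Sn \<theta>\<^sub>0 \<xi>) \<le> (B * n \<xi>) powr (1 / 3) / sqrt (n \<xi>) * (2 * B * r)"
      using eventually_ball b_avg n_pos r
    proof eventually_elim
      case (elim \<xi>)
      have "(B * n \<xi>) powr (1 / 3) / sqrt (n \<xi>) * (2 * B * norm (sqrt (n \<xi>) *\<^sub>R (\<theta> \<xi> - \<theta>\<^sub>0)))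
        \<le> (B * n \<xi>) powr (1 / 3) / sqrt (n \<xi>) * (2 * B * r)"
        using elim(4) B by (intro mult_left_mono) auto
      then show ?case using Sn_expansion [OF elim(1-3)] by (simp add: mult_ac)
    qed
  qed
  moreover have "((\<lambda>\<xi>. Sn \<theta>\<^sub>0 \<xi>) \<longlongrightarrow> \<Sigma>) F"
    using S_lim by (simp add: Sn_def \<gamma>_def outer_scaleR_left outer_scaleR_right scaleR_sum_right)
  ultimately show ?thesis using tendsto_add by fastforce
qed

lemma \<gamma>_le: "\<forall>\<^sub>F \<xi> in F. \<forall>i<n \<xi>. norm (\<gamma> (\<theta> \<xi>) \<xi> i) \<le> (B * n \<xi>) powr (1 / 3) / sqrt (n \<xi>)"
  using eventually_ball b_avg
  by eventually_elim (auto simp: \<gamma>_def intro!: divide_right_mono g_norm_le)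

lemma zn_bdd: "\<exists>L. \<forall>\<^sub>F \<xi> in F. norm (zn (\<theta> \<xi>) \<xi>) \<le> L"
proof -
  have "\<forall>\<^sub>F \<xi> in F. norm (zn (\<theta> \<xi>) \<xi>) \<le> 1 + K + norm \<Gamma> * r"
    using eventually_bdd_of_tendsto [OF zn_lim] Z_bdd r
  proof eventually_elim
    case (elim \<xi>)
    define h where "h = sqrt (n \<xi>) *\<^sub>R (\<theta> \<xi> - \<theta>\<^sub>0)"
    have "zn (\<theta> \<xi>) \<xi> = (zn (\<theta> \<xi>) \<xi> - (zn \<theta>\<^sub>0 \<xi> + \<Gamma> *v h)) + zn \<theta>\<^sub>0 \<xi> + \<Gamma> *v h"
      by simp
    also have "norm \<dots> \<le> 1 + K + norm \<Gamma> * r"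
    proof (intro norm_triangle_le add_mono)
      show "norm (zn \<theta>\<^sub>0 \<xi>) \<le> K" using elim by (simp add: zn_def \<gamma>_def scaleR_sum_right)
      show "norm (\<Gamma> *v h) \<le> norm \<Gamma> * r"
        using elim by (intro order.trans [OF norm_matrix_vector_mult_le] mult_left_mono) (auto simp: h_def)
    qed (use elim in \<open>auto simp: h_def\<close>)
    finally show ?case .
  qed
  then show ?thesis by blast
qed

lemma eventually_lagrange: "\<forall>\<^sub>F \<xi> in F. \<exists>\<tau>. lagrange (n \<xi>) (\<gamma> (\<theta> \<xi>) \<xi>) \<tau>"
proof -
  obtain L where L: "\<forall>\<^sub>F \<xi> in F. norm (zn (\<theta> \<xi>) \<xi>) \<le> L" using zn_bdd by blast
  show ?thesis
    by (rule lagrange_limit_ex [OF Sn_lim [unfolded Sn_def] \<Sigma> m_lim \<gamma>_le L [unfolded zn_def]])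
qed

lemma lagrange_sum_lim:
  assumes t: "\<forall>\<^sub>F \<xi> in F. lagrange (n \<xi>) (\<gamma> (\<theta> \<xi>) \<xi>) (t \<xi>)"
    and \<psi>: "((\<lambda>u. \<psi> u / u\<^sup>2) \<longlongrightarrow> 1 / 2) (at 0)" "\<psi> 0 = 0"
  defines "y \<xi> \<equiv> zn \<theta>\<^sub>0 \<xi> + \<Gamma> *v (sqrt (n \<xi>) *\<^sub>R (\<theta> \<xi> - \<theta>\<^sub>0))"
  shows "((\<lambda>\<xi>. 2 * (\<Sum>i<n \<xi>. \<psi> (t \<xi> \<bullet> \<gamma> (\<theta> \<xi>) \<xi> i)) - y \<xi> \<bullet> (matrix_inv \<Sigma> *v y \<xi>)) \<longlongrightarrow> 0) F"
proof -
  obtain L where L: "\<forall>\<^sub>F \<xi> in F. norm (zn (\<theta> \<xi>) \<xi>) \<le> L" using zn_bdd by blast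
  define z where "z \<xi> = zn (\<theta> \<xi>) \<xi>" for \<xi>
  define R where "R = matrix_inv \<Sigma>"
  have 1: "((\<lambda>\<xi>. 2 * (\<Sum>i<n \<xi>. \<psi> (t \<xi> \<bullet> \<gamma> (\<theta> \<xi>) \<xi> i)) - z \<xi> \<bullet> (R *v z \<xi>)) \<longlongrightarrow> 0) F"
    using lagrange_limit_sum [OF Sn_lim [unfolded Sn_def] \<Sigma> m_lim \<gamma>_le L [unfolded zn_def] t \<psi>]
    by (simp add: z_def zn_def R_def)
  have "((\<lambda>\<xi>. y \<xi> - z \<xi>) \<longlongrightarrow> 0) F"
    using tendsto_minus [OF zn_lim] by (simp add: y_def z_def)
  moreover have "Bfun z F" using L by (intro BfunI [where K = L]) (simp add: z_def)
  ultimately have "((\<lambda>\<xi>. y \<xi> \<bullet> (R *v y \<xi>) - z \<xi> \<bullet> (R *v z \<xi>)) \<longlongrightarrow> 0) F"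
    by (rule quadratic_form_diff_lim [rotated])
  from tendsto_diff [OF 1 this] show ?thesis by (simp add: R_def)
qed

end

end

section \<open>Empirical likelihood and Lagrange multipliers\<close>

lemma el_multiplier_iff_lagrange:
  assumes "n > 0"
  shows "el_multiplier g n x \<theta> t \<longleftrightarrow> lagrange n (\<lambda>i. (1 / sqrt n) *\<^sub>R g (x i) \<theta>) (sqrt n *\<^sub>R t)"
proof -
  define s where "s = sqrt n"
  have s: "s > 0" "n > 0" using assms by (auto simp: s_def)
  have u: "(sqrt n *\<^sub>R t) \<bullet> ((1 / sqrt n) *\<^sub>R g (x i) \<theta>) = t \<bullet> g (x i) \<theta>" for i
    using s by (simp add: s_def [symmetric])
  have sum0: "(\<Sum>i<n. (1 / (1 + t \<bullet> g (x i) \<theta>)) *\<^sub>R ((1 / sqrt n) *\<^sub>R g (x i) \<theta>)) = 0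
      \<longleftrightarrow> (1 / real n) *\<^sub>R (\<Sum>i<n. (1 / (1 + t \<bullet> g (x i) \<theta>)) *\<^sub>R g (x i) \<theta>) = 0"
  proof -
    have "(\<Sum>i<n. (1 / (1 + t \<bullet> g (x i) \<theta>)) *\<^sub>R ((1 / sqrt n) *\<^sub>R g (x i) \<theta>))
       = (1 / sqrt n) *\<^sub>R (\<Sum>i<n. (1 / (1 + t \<bullet> g (x i) \<theta>)) *\<^sub>R g (x i) \<theta>)"
      by (simp add: scaleR_sum_right mult.commute)
    then show ?thesis using s by simp
  qed
  show ?thesis
  proof
    assume *: "el_multiplier g n x \<theta> t"
    have "1 + t \<bullet> g (x i) \<theta> > 0" if "i < n" for i
    proof -
      have "1 / (1 + t \<bullet> g (x i) \<theta>) \<ge> 0" "1 + t \<bullet> g (x i) \<theta> \<noteq> 0"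
        using * that s by (auto simp: el_multiplier_def el_weight_def zero_le_mult_iff zero_le_divide_iff)
      then show ?thesis by (simp add: zero_le_divide_iff)
    qed
    then show "lagrange n (\<lambda>i. (1 / sqrt n) *\<^sub>R g (x i) \<theta>) (sqrt n *\<^sub>R t)"
      using * unfolding lagrange_def u sum0 el_multiplier_def by simp
  next
    assume *: "lagrange n (\<lambda>i. (1 / sqrt n) *\<^sub>R g (x i) \<theta>) (sqrt n *\<^sub>R t)"
    then have pos: "1 + t \<bullet> g (x i) \<theta> > 0" if "i < n" for i
      using that unfolding lagrange_def u by auto
    have 0: "(1 / real n) *\<^sub>R (\<Sum>i<n. (1 / (1 + t \<bullet> g (x i) \<theta>)) *\<^sub>R g (x i) \<theta>) = 0"
      using * unfolding lagrange_def u sum0 by simp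
    \<comment> \<open>By \<open>1 / (1 + u) = 1 - u / (1 + u)\<close>, the sum differs from
      \<open>n\<close> by the inner product of \<open>t\<close> with the left side of the multiplier
      equation, which is zero.\<close>
    have "(\<Sum>i<n. 1 / (1 + t \<bullet> g (x i) \<theta>))
        = (\<Sum>i<n. 1 - t \<bullet> ((1 / (1 + t \<bullet> g (x i) \<theta>)) *\<^sub>R g (x i) \<theta>))"
      using pos by (intro sum.cong refl) (fastforce simp: field_simps)
    also have "\<dots> = n - t \<bullet> (\<Sum>i<n. (1 / (1 + t \<bullet> g (x i) \<theta>)) *\<^sub>R g (x i) \<theta>)"
      by (simp only: sum_subtractf inner_sum_right) simp
    also have "\<dots> = n" using 0 s by simp
    finally have "(\<Sum>i<n. el_weight g n x \<theta> t i) = 1"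
      using s unfolding el_weight_def sum_distrib_left [symmetric] by simp
    then show "el_multiplier g n x \<theta> t"
      using 0 pos s unfolding el_multiplier_def el_weight_def
      by (auto simp: less_imp_le) (metis less_irrefl)
  qed
qed

lemma el_feasible_iff_lagrange:
  assumes "n > 0"
  shows "el_feasible g n x \<theta> \<longleftrightarrow> (\<exists>\<tau>. lagrange n (\<lambda>i. (1 / sqrt n) *\<^sub>R g (x i) \<theta>) \<tau>)"
proof
  assume "\<exists>\<tau>. lagrange n (\<lambda>i. (1 / sqrt n) *\<^sub>R g (x i) \<theta>) \<tau>"
  then obtain \<tau> where "lagrange n (\<lambda>i. (1 / sqrt n) *\<^sub>R g (x i) \<theta>) \<tau>" ..
  then have "el_multiplier g n x \<theta> ((1 / sqrt n) *\<^sub>R \<tau>)"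
    using assms by (simp add: el_multiplier_iff_lagrange)
  then show "el_feasible g n x \<theta>" by (auto simp: el_feasible_def)
qed (use assms in \<open>auto simp: el_feasible_def el_multiplier_iff_lagrange\<close>)

lemma el_t_multiplier: "el_feasible g n x \<theta> \<Longrightarrow> el_multiplier g n x \<theta> (el_t g n x \<theta>)"
  unfolding el_feasible_def el_t_def by (rule someI_ex)

lemma el_multiplier_sum:
  assumes "el_multiplier g n x \<theta> t" "n > 0"
  shows "(\<Sum>i<n. 1 / (1 + t \<bullet> g (x i) \<theta>)) = n"
proof -
  have "(1 / n) * (\<Sum>i<n. 1 / (1 + t \<bullet> g (x i) \<theta>)) = 1"
    using assms by (simp only: el_multiplier_def el_weight_def sum_distrib_left)
  then show ?thesis using assms(2) by (simp add: field_simps)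
qed

lemma el_multiplier_pos: "el_multiplier g n x \<theta> t \<Longrightarrow> i < n \<Longrightarrow> 1 + t \<bullet> g (x i) \<theta> > 0"
  by (auto simp: el_multiplier_def el_weight_def zero_le_mult_iff zero_le_divide_iff less_le)

lemma el_multiplier_unique:
  assumes "el_multiplier g n x \<theta> t" "el_multiplier g n x \<theta> s" "i < n"
  shows "t \<bullet> g (x i) \<theta> = s \<bullet> g (x i) \<theta>"
proof -
  have "n > 0" using assms by simp
  then show ?thesis
    using lagrange_unique [of n "\<lambda>i. (1 / sqrt n) *\<^sub>R g (x i) \<theta>" "sqrt n *\<^sub>R t" "sqrt n *\<^sub>R s" i] assms
    by (simp add: el_multiplier_iff_lagrange)
qed

definition \<psi>_log :: "real \<Rightarrow> real" where "\<psi>_log u = ln (1 + u) + 1 / (1 + u) - 1"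

lemma \<psi>_log_lim: "((\<lambda>u. \<psi>_log u / u\<^sup>2) \<longlongrightarrow> 1 / 2) (at 0)"
  unfolding \<psi>_log_def by (rule filterlim_split_at) real_asymp+

lemma \<psi>_log_nonneg: "1 + u > 0 \<Longrightarrow> \<psi>_log u \<ge> 0"
  using ln_le_minus_one [of "1 / (1 + u)"] by (simp add: \<psi>_log_def ln_div)

lemma \<psi>_log_eq_0: "1 + u > 0 \<Longrightarrow> \<psi>_log u = 0 \<Longrightarrow> u = 0"
  using ln_eq_minus_one [of "1 / (1 + u)"] by (simp add: \<psi>_log_def ln_div)

text \<open>Adding \<open>0 = \<Sum>i<n. 1 / (1 + u i) - 1\<close> turns the log-likelihood into a sum of
  nonnegative terms that are quadratic at the origin.\<close>

lemma el_loglik_eq: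
  assumes "el_feasible g n x \<theta>" "n > 0"
  shows "el_loglik g n x \<theta> = - (\<Sum>i<n. \<psi>_log (el_t g n x \<theta> \<bullet> g (x i) \<theta>))"
  using el_multiplier_sum [OF el_t_multiplier [OF assms(1)] assms(2)]
  by (simp add: el_loglik_def \<psi>_log_def sum.distrib sum_subtractf)

text \<open>A root of the estimating equations has multiplier zero and log-likelihood zero, and zero
  is an upper bound because every term \<open>\<psi>_log\<close> is nonnegative. A maximizer
  therefore attains zero, so all its terms vanish and its weights are uniform. The maximizer itself
  need not be identified with the root.\<close>

lemma el_maximizer_weights:
  assumes max: "el_maximizer g n x \<Theta> \<theta>" and n: "n > 0"
    and \<theta>': "\<theta>' \<in> \<Theta>" "(\<Sum>i<n. g (x i) \<theta>') = 0"
    and i: "i < n"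
  shows "el_prob g n x \<theta> i = 1 / n"
proof -
  have t0: "el_multiplier g n x \<theta>' 0" using \<theta>' n by (simp add: el_multiplier_def el_weight_def)
  then have feas': "el_feasible g n x \<theta>'" by (auto simp: el_feasible_def)
  have "el_t g n x \<theta>' \<bullet> g (x j) \<theta>' = 0" if "j < n" for j
    using el_multiplier_unique [OF el_t_multiplier [OF feas'] t0 that] by simp
  then have "el_loglik g n x \<theta>' = 0" by (simp add: el_loglik_def)
  then have ge: "el_loglik g n x \<theta> \<ge> 0" and feas: "el_feasible g n x \<theta>"
    using max \<theta>'(1) feas' by (auto simp: el_maximizer_def is_arg_max_def not_less)
  define u where "u j = el_t g n x \<theta> \<bullet> g (x j) \<theta>" for j
  have pos: "1 + u j > 0" if "j < n" for j
    using el_multiplier_pos [OF el_t_multiplier [OF feas] that] by (simp add: u_def)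
  have "(\<Sum>j<n. \<psi>_log (u j)) \<le> 0" using ge el_loglik_eq [OF feas n] by (simp add: u_def)
  then have "(\<Sum>j<n. \<psi>_log (u j)) = 0"
    using pos by (intro antisym sum_nonneg \<psi>_log_nonneg) auto
  then have "\<psi>_log (u i) = 0"
    using pos i by (subst (asm) sum_nonneg_eq_0_iff) (auto simp: \<psi>_log_nonneg)
  then have "u i = 0" using \<psi>_log_eq_0 pos i by blast
  then show ?thesis by (simp add: el_prob_def el_weight_def u_def)
qed

section \<open>The divergence statistic\<close>

text \<open>For the weight \<open>p = 1 / (n (1 + u))\<close>, the term
  \<open>n p \<phi>(1 / (n p))\<close> of the divergence is \<open>\<phi>(1 + u) / (1 + u)\<close>.
  Division by the second derivative normalizes its behaviour at the origin to
  \<open>u^2 / 2\<close>.\<close>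

definition \<psi>_phi :: "(real \<Rightarrow> real) \<Rightarrow> real \<Rightarrow> real" where
  "\<psi>_phi \<phi> u = \<phi> (1 + u) / ((1 + u) * deriv (deriv \<phi>) 1)"

lemma phi_statistic_eq:
  assumes \<theta>\<^sub>1: "\<And>i. i < n \<Longrightarrow> el_prob g n x \<theta>\<^sub>1 i = 1 / n" and n: "n > 0" and \<phi>: "\<phi> 1 = 0"
  shows "phi_statistic \<phi> g n x \<theta>\<^sub>1 \<theta>\<^sub>2 = 2 * (\<Sum>i<n. \<psi>_phi \<phi> (el_t g n x \<theta>\<^sub>2 \<bullet> g (x i) \<theta>\<^sub>2))"
proof -
  have "phi_divergence \<phi> n (el_prob g n x \<theta>\<^sub>1) = 0"
    unfolding phi_divergence_def by (rule sum.neutral) (use \<theta>\<^sub>1 n \<phi> in auto)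
  moreover have "n * phi_divergence \<phi> n (el_prob g n x \<theta>\<^sub>2)
      = (\<Sum>i<n. \<phi> (1 + el_t g n x \<theta>\<^sub>2 \<bullet> g (x i) \<theta>\<^sub>2) / (1 + el_t g n x \<theta>\<^sub>2 \<bullet> g (x i) \<theta>\<^sub>2))"
    unfolding phi_divergence_def sum_distrib_left
    using n by (intro sum.cong refl) (simp add: el_prob_def el_weight_def)
  moreover have "phi_statistic \<phi> g n x \<theta>\<^sub>1 \<theta>\<^sub>2 = 2 / deriv (deriv \<phi>) 1 *
     (n * phi_divergence \<phi> n (el_prob g n x \<theta>\<^sub>2) - n * phi_divergence \<phi> n (el_prob g n x \<theta>\<^sub>1))"
    by (simp add: phi_statistic_def algebra_simps)
  ultimately show ?thesis
    by (simp only: \<psi>_phi_def divide_divide_eq_left [symmetric] sum_divide_distrib [symmetric]) simp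
qed

text \<open>One application of l'Hospital reduces \<open>\<phi>(1 + u) / u^2\<close> to the
  difference quotient of \<open>\<phi>'\<close> at \<open>1\<close>. The second derivative is given
  at the point \<open>1\<close> only, so the last limit is its definition, not a second
  application.\<close>

lemma \<psi>_phi_lim:
  assumes \<phi>: "\<phi> \<in> phi_class"
  shows "((\<lambda>u. \<psi>_phi \<phi> u / u\<^sup>2) \<longlongrightarrow> 1 / 2) (at 0)"
proof -
  define d where "d = deriv (deriv \<phi>) 1"
  have d: "d > 0" and \<phi>1: "\<phi> 1 = 0" "deriv \<phi> 1 = 0"
    and diff: "\<forall>\<^sub>F u in nhds 1. \<phi> field_differentiable (at u)"
    and diff2: "deriv \<phi> field_differentiable (at 1)"
    using \<phi> by (auto simp: phi_class_def d_def)
  define f where "f u = \<phi> (1 + u)" for u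
  define f' where "f' u = deriv \<phi> (1 + u)" for u
  have "(deriv \<phi> has_field_derivative d) (at 1)"
    using diff2 by (simp add: d_def DERIV_deriv_iff_field_differentiable)
  then have "((\<lambda>u. (deriv \<phi> (1 + u) - deriv \<phi> 1) / u) \<longlongrightarrow> d) (at 0)"
    by (simp add: DERIV_def)
  then have f'_lim: "((\<lambda>u. f' u / u) \<longlongrightarrow> d) (at 0)" by (simp add: f'_def \<phi>1)
  obtain e where e: "e > 0" "\<And>u. dist u 1 < e \<Longrightarrow> \<phi> field_differentiable (at u)"
    using diff by (auto simp: eventually_nhds_metric)
  have f: "(f has_field_derivative f' u) (at u)" if "\<bar>u\<bar> < e" for u
  proof -
    have "(\<phi> has_field_derivative deriv \<phi> (1 + u)) (at (1 + u))"
      using e(2) [of "1 + u"] that by (simp add: DERIV_deriv_iff_field_differentiable dist_real_def)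
    moreover have "((\<lambda>u. 1 + u) has_field_derivative 1) (at u)"
      by (auto intro!: derivative_eq_intros)
    ultimately show ?thesis unfolding f_def f'_def
      using DERIV_chain2 [of \<phi> "deriv \<phi> (1 + u)" "\<lambda>u. 1 + u" u 1 UNIV] by simp
  qed
  have ev: "\<forall>\<^sub>F u in at 0. \<bar>u\<bar> < e"
    using e(1) by (auto simp: eventually_at dist_real_def)
  have f0: "(f \<longlongrightarrow> 0) (at 0)"
    using DERIV_isCont [OF f, of 0] e(1) by (simp add: isCont_def f_def \<phi>1)
  have "((\<lambda>u. f u / u\<^sup>2) \<longlongrightarrow> d / 2) (at 0)"
  proof (rule lhopital [where f' = f' and g' = "\<lambda>u. 2 * u"])
    show "\<forall>\<^sub>F u in at 0. (f has_real_derivative f' u) (at u)" using ev by eventually_elim (rule f)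
    show "\<forall>\<^sub>F u in at 0. ((\<lambda>u. u\<^sup>2) has_real_derivative 2 * u) (at u)"
      by (auto intro!: always_eventually derivative_eq_intros)
    have "((\<lambda>u. f' u / u / 2) \<longlongrightarrow> d / 2) (at 0)" by (intro tendsto_intros f'_lim) auto
    then show "((\<lambda>u. f' u / (2 * u)) \<longlongrightarrow> d / 2) (at 0)" by (simp add: mult.commute)
    show "((\<lambda>u::real. u\<^sup>2) \<longlongrightarrow> 0) (at 0)" by (auto intro!: tendsto_eq_intros)
  qed (use f0 in \<open>auto simp: eventually_at intro!: exI [of _ 1]\<close>)
  moreover have "((\<lambda>u. (1 + u) * d) \<longlongrightarrow> (1 + 0) * d) (at 0)" by (intro tendsto_intros)
  ultimately have "((\<lambda>u. f u / u\<^sup>2 / ((1 + u) * d)) \<longlongrightarrow> d / 2 / ((1 + 0) * d)) (at 0)"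
    by (rule tendsto_divide) (use d in simp)
  then show ?thesis using d by (simp add: \<psi>_phi_def f_def d_def mult_ac)
qed

text \<open>In the local parameter \<open>h\<close>, the normalized sum is
  \<open>Z + \<Gamma> h\<close> up to a small error. Multiplied by the inverse of
  \<open>\<Gamma>\<close> it becomes a perturbation of a translate of the identity, so Brouwer gives
  a root of bounded size in \<open>h\<close>, hence close to
  \<open>\<theta>\<^sub>0\<close>.\<close>

lemma (in estimating_data) eventually_zero_estimating:
  "\<forall>\<^sub>F \<xi> in F. \<exists>\<theta>\<in>ball \<theta>\<^sub>0 \<rho>. (\<Sum>i<n \<xi>. g (x \<xi> i) \<theta>) = 0"
proof -
  have "invertible \<Gamma>"
    using \<Gamma> by (metis full_rank_injective invertible_left_inverse matrix_left_invertible_injective)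
  then obtain R where R: "\<Gamma> ** R = mat 1" "R ** \<Gamma> = mat 1" by (auto simp: invertible_def)
  define r where "r = norm R * \<bar>K\<bar> + 1"
  have r: "r > 0" unfolding r_def by (smt (verit) mult_nonneg_nonneg norm_ge_zero)
  have inv0: "((\<lambda>\<xi>. 1 / sqrt (n \<xi>)) \<longlongrightarrow> 0) F"
    using tendsto_inverse_0_at_top [OF sqrt_n] by (simp add: inverse_eq_divide)
  have "((\<lambda>\<xi>. \<Gamma> - Gn \<xi>) \<longlongrightarrow> \<Gamma> - \<Gamma>) F"
    using G_lim by (intro tendsto_intros) (simp add: Gn_def)
  then have "((\<lambda>\<xi>. norm (\<Gamma> - Gn \<xi>)) \<longlongrightarrow> 0) F" by (simp add: tendsto_norm_zero)
  then have "((\<lambda>\<xi>. norm R * (norm (\<Gamma> - Gn \<xi>) * r) + norm R * (B * r\<^sup>2 * (1 / sqrt (n \<xi>)))) \<longlongrightarrow> norm R * (0 * r) + norm R * (B * r\<^sup>2 * 0)) F"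
    by (intro tendsto_intros inv0)
  then have "\<forall>\<^sub>F \<xi> in F. norm R * (norm (\<Gamma> - Gn \<xi>) * r) + norm R * (B * r\<^sup>2 * (1 / sqrt (n \<xi>))) < 1"
    by (intro order_tendstoD(2)) auto
  then show ?thesis
    using n_pos b_avg Z_bdd filterlim_at_top_dense [THEN iffD1, OF sqrt_n, rule_format, of "r / \<rho>"]
  proof eventually_elim
    case (elim \<xi>)
    define s where "s = sqrt (n \<xi>)"
    have s: "s > 0" using elim by (simp add: s_def)
    define \<theta> where "\<theta> h = \<theta>\<^sub>0 + (1 / s) *\<^sub>R h" for h
    have h: "s *\<^sub>R (\<theta> h - \<theta>\<^sub>0) = h" for h using s by (simp add: \<theta>_def)
    have ball: "\<theta> h \<in> ball \<theta>\<^sub>0 \<rho>" if "norm h \<le> r" for h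
    proof -
      have "norm h < \<rho> * s" using that elim \<rho> by (simp add: s_def field_simps)
      then show ?thesis using s by (simp add: \<theta>_def dist_norm field_simps)
    qed
    have "\<exists>h. norm h \<le> r \<and> R *v zn (\<theta> h) \<xi> = 0"
    proof (rule exists_zero_cball [OF _ r])
      have g_cont: "continuous_on (ball \<theta>\<^sub>0 \<rho>) (g y)" for y
        using g_deriv by (auto intro!: continuous_at_imp_continuous_on has_derivative_continuous)
      have "continuous_on (cball 0 r) \<theta>" unfolding \<theta>_def by (intro continuous_intros)
      then have "continuous_on (cball 0 r) (\<lambda>h. g y (\<theta> h))" for y
        by (rule continuous_on_compose2 [OF g_cont]) (use ball in auto)
      then show "continuous_on (cball 0 r) (\<lambda>h. R *v zn (\<theta> h) \<xi>)"
        unfolding zn_def \<gamma>_def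
        by (intro linear_continuous_on_compose [OF _ matrix_vector_mul_linear] continuous_intros)
    next
      fix h :: "real ^ 'p" assume hr: "norm h \<le> r"
      define e where "e = zn (\<theta> h) \<xi> - (zn \<theta>\<^sub>0 \<xi> + Gn \<xi> *v h)"
      have "norm e \<le> B * (norm h)\<^sup>2 / s"
        using zn_expansion [OF ball [OF hr] elim(3,2)] by (simp add: e_def s_def [symmetric] h)
      also have "\<dots> \<le> B * r\<^sup>2 / s"
        using hr B s by (intro divide_right_mono mult_left_mono power_mono) auto
      finally have e: "norm e \<le> B * r\<^sup>2 * (1 / s)" by simp
      have z: "norm (zn \<theta>\<^sub>0 \<xi>) \<le> \<bar>K\<bar>" using elim by (simp add: zn_def \<gamma>_def scaleR_sum_right)
      have "R *v (\<Gamma> *v h) = h" using R by (simp add: matrix_vector_mul_assoc)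
      then have "h - R *v zn (\<theta> h) \<xi> = R *v ((\<Gamma> - Gn \<xi>) *v h) - R *v zn \<theta>\<^sub>0 \<xi> - R *v e"
        by (simp add: e_def matrix_vector_right_distrib matrix_vector_mult_diff_distrib
            matrix_vector_mult_diff_rdistrib algebra_simps)
      also have "norm \<dots> \<le> norm R * (norm (\<Gamma> - Gn \<xi>) * r) + norm R * \<bar>K\<bar> + norm R * (B * r\<^sup>2 * (1 / s))"
        by (intro order.trans [OF norm_triangle_ineq4] add_mono
            order.trans [OF norm_matrix_vector_mult_le] mult_left_mono e z hr) auto
      finally show "norm (h - R *v zn (\<theta> h) \<xi>) \<le> r"
        using elim(1) unfolding r_def s_def by linarith
    qed
    then obtain h where hr: "norm h \<le> r" "R *v zn (\<theta> h) \<xi> = 0" by blast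
    then have "zn (\<theta> h) \<xi> = 0"
      using R by (metis matrix_vector_mul_assoc matrix_vector_mul_lid matrix_vector_mult_0_right)
    then have "(\<Sum>i<n \<xi>. g (x \<xi> i) (\<theta> h)) = 0"
      using s by (simp add: zn_def \<gamma>_def s_def scaleR_sum_right [symmetric])
    then show ?case using ball [OF hr(1)] by blast
  qed
qed

section \<open>The constrained quadratic minimum\<close>

text \<open>Gram-Schmidt for the inner product \<open>x \<bullet> (S *v y)\<close>: normalize a
  nonzero vector of \<open>W\<close> and continue in its complement inside \<open>W\<close>, whose
  dimension is smaller by one.\<close>

lemma exists_orthonormal_basis_form:
  fixes S :: "real ^ 'n ^ 'n"
  assumes S: "pos_def S" and W: "subspace W"
  shows "\<exists>v. (\<forall>i<dim W. v i \<in> W) \<and> W \<subseteq> span (v ` {..<dim W}) \<and>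
     (\<forall>i<dim W. \<forall>j<dim W. v i \<bullet> (S *v v j) = (if i = j then 1 else 0))"
  using W
proof (induction "dim W" arbitrary: W)
  case 0
  then have "W \<subseteq> {0}" by (simp add: dim_eq_0)
  then show ?case unfolding 0(1) [symmetric] by (auto simp: span_zero)
next
  case (Suc d)
  have sym: "x \<bullet> (S *v y) = y \<bullet> (S *v x)" for x y
    using S by (metis dot_lmul_matrix inner_commute pos_def_def transpose_matrix_vector)
  obtain w0 where w0: "w0 \<in> W" "w0 \<noteq> 0"
    using Suc.hyps(2) by (metis dim_eq_0 nat.distinct(1) singleton_iff subsetI)
  define w where "w = (1 / sqrt (w0 \<bullet> (S *v w0))) *\<^sub>R w0"
  have "w0 \<bullet> (S *v w0) > 0" using S w0 by (simp add: pos_def_def)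
  then have w: "w \<bullet> (S *v w) = 1" "w \<in> W"
    using w0 Suc.prems by (auto simp: w_def matrix_vector_mult_scaleR subspace_scale)
  define W' where "W' = W \<inter> {y. (S *v w) \<bullet> y = 0}"
  have W': "subspace W'" unfolding W'_def
    by (intro subspace_inter Suc.prems subspace_hyperplane)
  have dec: "y - (w \<bullet> (S *v y)) *\<^sub>R w \<in> W'" if "y \<in> W" for y
    using that w Suc.prems sym [of w y]
    by (auto simp: W'_def inner_diff_right subspace_diff subspace_scale inner_commute)
  have span: "W = span (insert w W')"
  proof
    show "W \<subseteq> span (insert w W')"
    proof
      fix y assume "y \<in> W"
      from dec [OF this] have "y - (w \<bullet> (S *v y)) *\<^sub>R w \<in> span (insert w W')"
        by (simp add: span_base)
      moreover have "(w \<bullet> (S *v y)) *\<^sub>R w \<in> span (insert w W')"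
        by (simp add: span_base span_scale)
      ultimately have "y - (w \<bullet> (S *v y)) *\<^sub>R w + (w \<bullet> (S *v y)) *\<^sub>R w \<in> span (insert w W')"
        by (rule span_add)
      then show "y \<in> span (insert w W')" by simp
    qed
    show "span (insert w W') \<subseteq> W"
      using w Suc.prems by (intro span_minimal) (auto simp: W'_def)
  qed
  have "w \<notin> W'" using w by (auto simp: W'_def inner_commute)
  then have "w \<notin> span W'" using W' by (simp add: span_eq_iff [THEN iffD2])
  then have "dim (insert w W') = Suc (dim W')" by (simp add: dim_insert)
  then have d: "d = dim W'" using span Suc.hyps(2) by (metis dim_span old.nat.inject)
  obtain v where v: "\<forall>i<d. v i \<in> W'" "W' \<subseteq> span (v ` {..<d})"
      "\<forall>i<d. \<forall>j<d. v i \<bullet> (S *v v j) = (if i = j then 1 else 0)"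
    using Suc.hyps(1) [OF d W'] d by auto
  define u where "u = v(d := w)"
  have u: "i < d \<Longrightarrow> u i = v i" "u d = w" for i by (auto simp: u_def)
  have orth: "v i \<bullet> (S *v w) = 0" "w \<bullet> (S *v v i) = 0" if "i < d" for i
    using v(1) that sym [of "v i" w] by (auto simp: W'_def inner_commute)
  have im: "u ` {..<Suc d} = insert w (v ` {..<d})"
    by (auto simp: u_def lessThan_Suc image_iff)
  have "W \<subseteq> span (u ` {..<Suc d})"
    unfolding im span
    by (intro span_minimal subspace_span) (use v(2) span_mono [of "v ` {..<d}" "insert w (v ` {..<d})"] in \<open>auto simp: span_base\<close>)
  then show ?case
    unfolding Suc.hyps(2) [symmetric]
    using v w orth u by (intro exI [of _ u]) (auto simp: less_Suc_eq W'_def)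
qed

text \<open>Through \<open>k = A h\<close> the constraint becomes \<open>D k = 0\<close>, whose
  orthogonal complement \<open>W\<close> has dimension \<open>q\<close>. The minimum is found by
  projection, and Pythagoras for the form of the inverse of \<open>S\<close> shows that it is
  minimal. The bound on \<open>norm h\<close>, linear in \<open>norm z\<close>, later keeps the
  comparison point within order \<open>1 / sqrt n\<close>.\<close>

lemma constrained_minimum:
  fixes S A :: "real ^ 'p ^ 'p" and C :: "real ^ 'p ^ 'q"
  assumes S: "pos_def S" and A: "rank A = CARD('p)" and C: "rank C = CARD('q)"
  defines "Q z \<equiv> z \<bullet> (matrix_inv S *v z)"
  shows "\<exists>v L. (\<forall>i<CARD('q). \<forall>j<CARD('q). v i \<bullet> (S *v v j) = (if i = j then 1 else 0)) \<and>
     (\<forall>z h. C *v h = 0 \<longrightarrow> (\<Sum>i<CARD('q). (v i \<bullet> z)\<^sup>2) \<le> Q (z + A *v h)) \<and>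
     (\<forall>z. \<exists>h. C *v h = 0 \<and> norm h \<le> L * norm z \<and> Q (z + A *v h) = (\<Sum>i<CARD('q). (v i \<bullet> z)\<^sup>2))"
proof -
  let ?q = "CARD('q)"
  define R where "R = matrix_inv S"
  note R = pos_def_invertible [OF S, folded R_def]
  have sym: "x \<bullet> (S *v y) = y \<bullet> (S *v x)" for x y
    using S by (metis dot_lmul_matrix inner_commute pos_def_def transpose_matrix_vector)
  have "invertible A"
    using A by (metis full_rank_injective invertible_left_inverse matrix_left_invertible_injective)
  then obtain Ai where Ai: "A ** Ai = mat 1" "Ai ** A = mat 1" by (auto simp: invertible_def)
  have "\<exists>E. C ** E = mat 1"
    using C by (simp add: matrix_right_invertible_surjective full_rank_surjective)
  then obtain E where E: "C ** E = mat 1" ..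
  define D where "D = C ** Ai"
  have DE: "D ** (A ** E) = mat 1"
    unfolding D_def using Ai E by (metis matrix_mul_assoc matrix_mul_rid)
  define W where "W = range (\<lambda>\<mu>. transpose D *v \<mu>)"
  have W: "subspace W" unfolding W_def
    by (intro linear_subspace_image matrix_vector_mul_linear subspace_UNIV)
  have "transpose (A ** E) ** transpose D = mat 1"
    using DE by (metis matrix_transpose_mul transpose_mat)
  then have "rank (transpose D) = ?q"
    by (metis full_rank_injective matrix_left_invertible_injective)
  then have dimW: "dim W = ?q" unfolding W_def by (simp add: rank_dim_range)
  obtain v where v: "\<forall>i<?q. v i \<in> W" "W \<subseteq> span (v ` {..<?q})"
    "\<forall>i<?q. \<forall>j<?q. v i \<bullet> (S *v v j) = (if i = j then 1 else 0)"
    using exists_orthonormal_basis_form [OF S W] unfolding dimW by blast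
  have W_D: "w \<bullet> k = 0" if "w \<in> W" "D *v k = 0" for w k
    using that by (auto simp: W_def dot_lmul_matrix)
  have D_W: "D *v k = 0" if "\<And>w. w \<in> W \<Longrightarrow> w \<bullet> k = 0" for k
  proof -
    have "(transpose D *v (D *v k)) \<bullet> k = 0" using that by (simp add: W_def)
    then have "(D *v k) \<bullet> (D *v k) = 0" by (simp add: dot_lmul_matrix)
    then show ?thesis by simp
  qed
  \<comment> \<open>The \<open>S\<close>-orthogonal projection of \<open>R z\<close> onto
    \<open>W\<close>: the coefficients are \<open>v i \<bullet> z\<close> because \<open>S R\<close>
    is the identity. Thus \<open>S (a z) - z\<close> is orthogonal to \<open>W\<close>, which makes
    it an admissible displacement \<open>A h\<close>.\<close>
  define a where "a z = (\<Sum>i<?q. (v i \<bullet> z) *\<^sub>R v i)" for z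
  have a_W: "a z \<in> W" for z unfolding a_def using v(1) W by (intro subspace_sum subspace_scale) auto
  have va: "v i \<bullet> (S *v a z) = v i \<bullet> z" if i: "i < ?q" for i z
  proof -
    have "S *v a z = (\<Sum>j<?q. (v j \<bullet> z) *\<^sub>R (S *v v j))"
      unfolding a_def by (simp add: linear_sum [OF matrix_vector_mul_linear] matrix_vector_mult_scaleR)
    then have "v i \<bullet> (S *v a z) = (\<Sum>j<?q. (v j \<bullet> z) * (v i \<bullet> (S *v v j)))"
      by (simp only: inner_sum_right inner_scaleR_right)
    also have "\<dots> = (\<Sum>j<?q. if i = j then v j \<bullet> z else 0)"
      using v(3) i by (intro sum.cong) auto
    finally show ?thesis using i by simp
  qed
  have wa: "w \<bullet> (S *v a z - z) = 0" if "w \<in> W" for w z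
  proof -
    have "w \<in> span (v ` {..<?q})" using v(2) that by blast
    then show ?thesis
      by (induction rule: span_induct_alt) (auto simp: inner_add_left va inner_diff_right)
  qed
  have aSa: "a z \<bullet> (S *v a z) = (\<Sum>i<?q. (v i \<bullet> z)\<^sup>2)" for z
  proof -
    have "a z \<bullet> (S *v a z) = a z \<bullet> z" using wa [OF a_W, of z z] by (simp add: inner_diff_right)
    then show ?thesis by (simp add: a_def inner_sum_left power2_eq_square)
  qed
  have Q_Sa: "Q (S *v a z) = (\<Sum>i<?q. (v i \<bullet> z)\<^sup>2)" for z
    unfolding Q_def R_def [symmetric] using R
    by (simp add: matrix_vector_mul_assoc inner_commute [of "S *v a z" "a z"] aSa)
  have Q_pos: "Q r \<ge> 0" for r
  proof -
    have "(R *v r) \<bullet> (S *v (R *v r)) \<ge> 0"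
      using S by (cases "R *v r = 0") (auto simp: pos_def_def less_imp_le)
    then show ?thesis using R by (simp add: Q_def R_def [symmetric] matrix_vector_mul_assoc inner_commute)
  qed
  have low: "(\<Sum>i<?q. (v i \<bullet> z)\<^sup>2) \<le> Q (z + A *v h)" if h: "C *v h = 0" for z h
  proof -
    \<comment> \<open>The deviation from the minimizing value \<open>S (a z)\<close>. It is
      orthogonal to \<open>a z\<close>, so the cross terms in the expansion of \<open>Q\<close>
      vanish.\<close>
    define r where "r = z + A *v h - S *v a z"
    have "D *v (A *v h) = C *v ((Ai ** A) *v h)"
      by (simp add: D_def matrix_vector_mul_assoc matrix_mul_assoc)
    then have "D *v (A *v h) = 0" using Ai h by simp
    then have "a z \<bullet> (A *v h) = 0" using W_D a_W by blast
    then have ar: "a z \<bullet> r = 0"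
      using wa [OF a_W, of z z] by (simp add: r_def inner_diff_right inner_add_right)
    have Sar: "(S *v a z) \<bullet> (R *v r) = 0"
      using sym [of "R *v r" "a z"] R ar by (simp add: matrix_vector_mul_assoc inner_commute)
    have "Q (z + A *v h) = (S *v a z + r) \<bullet> (R *v (S *v a z + r))"
      by (simp add: Q_def R_def r_def)
    also have "\<dots> = Q (S *v a z) + Q r + (S *v a z) \<bullet> (R *v r) + r \<bullet> (R *v (S *v a z))"
      by (simp add: Q_def R_def matrix_vector_right_distrib inner_add_left inner_add_right)
    also have "R *v (S *v a z) = a z" using R by (simp add: matrix_vector_mul_assoc)
    finally show ?thesis using Q_pos [of r] Q_Sa [of z] Sar ar by (simp add: inner_commute)
  qed
  define L where "L = norm Ai * (norm S * (\<Sum>i<?q. norm (v i) * norm (v i)) + 1)"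
  have ex: "\<exists>h. C *v h = 0 \<and> norm h \<le> L * norm z \<and> Q (z + A *v h) = (\<Sum>i<?q. (v i \<bullet> z)\<^sup>2)" for z
  proof (intro exI conjI)
    let ?h = "Ai *v (S *v a z - z)"
    have "D *v (S *v a z - z) = 0" using D_W wa by blast
    then show "C *v ?h = 0" by (simp add: D_def matrix_vector_mul_assoc)
    have "norm (a z) \<le> (\<Sum>i<?q. norm (v i) * norm (v i)) * norm z"
      unfolding a_def sum_distrib_right
    proof (intro sum_norm_le)
      fix i
      show "norm ((v i \<bullet> z) *\<^sub>R v i) \<le> norm (v i) * norm (v i) * norm z"
        using mult_right_mono [OF Cauchy_Schwarz_ineq2 [of "v i" z], of "norm (v i)"]
        by (simp add: mult_ac)
    qed
    then have "norm (S *v a z - z) \<le> norm S * ((\<Sum>i<?q. norm (v i) * norm (v i)) * norm z) + norm z"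
      by (intro order.trans [OF norm_triangle_ineq4] add_mono order.trans [OF norm_matrix_vector_mult_le]
          mult_left_mono) auto
    then have "norm ?h \<le> norm Ai * (norm S * ((\<Sum>i<?q. norm (v i) * norm (v i)) * norm z) + norm z)"
      by (intro order.trans [OF norm_matrix_vector_mult_le] mult_left_mono) auto
    then show "norm ?h \<le> L * norm z" by (simp add: L_def algebra_simps)
    have "A *v ?h = S *v a z - z" using Ai by (simp add: matrix_vector_mul_assoc)
    then show "Q (z + A *v ?h) = (\<Sum>i<?q. (v i \<bullet> z)\<^sup>2)" using Q_Sa by simp
  qed
  show ?thesis using v(3) low ex by blast
qed

text \<open>Stands in for a minimizer: the zero set to which it is applied need not be closed, since
  continuity of the constraint is known on a ball only.\<close>

lemma exists_near_minimizer:
  fixes f :: "'a \<Rightarrow> real"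
  assumes "S \<noteq> {}" "\<And>v. v \<in> S \<Longrightarrow> 0 \<le> f v" "e > 0"
  shows "\<exists>v\<in>S. \<forall>v'\<in>S. f v \<le> f v' + e"
proof -
  have bdd: "bdd_below (f ` S)" using assms by (auto intro!: bdd_belowI [of _ 0])
  obtain y where "y \<in> f ` S" "y < Inf (f ` S) + e"
    using cInf_lessD [of "f ` S" "Inf (f ` S) + e"] assms by auto
  then obtain v where v: "v \<in> S" "f v < Inf (f ` S) + e" by blast
  have "f v \<le> f v' + e" if "v' \<in> S" for v'
    using cInf_lower [OF imageI [OF that] bdd] v by linarith
  with v(1) show ?thesis by blast
qed

text \<open>One correction \<open>\<sigma>\<close> serves all \<open>e\<close>, because it is chosen of nearly minimal norm.\<close>

lemma constraint_correction:
  fixes c :: "real ^ 'p \<Rightarrow> real ^ 'q" and C :: "real ^ 'p ^ 'q"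
  assumes c: "(c has_derivative (\<lambda>h. C *v h)) (at \<theta>\<^sub>0)" "c \<theta>\<^sub>0 = 0"
    and cont: "continuous_on (ball \<theta>\<^sub>0 \<rho>) c" "\<rho> > 0" and C: "rank C = CARD('q)"
  shows "\<exists>\<sigma>. \<forall>e>0. \<exists>d>0. \<forall>\<eta>. norm \<eta> < d \<longrightarrow> C *v \<eta> = 0 \<longrightarrow>
     c (\<theta>\<^sub>0 + \<eta> + \<sigma> \<eta>) = 0 \<and> norm (\<sigma> \<eta>) \<le> e * norm \<eta>"
proof -
  have "\<exists>E. C ** E = mat 1"
    using C by (simp add: matrix_right_invertible_surjective full_rank_surjective)
  then obtain E where E: "C ** E = mat 1" ..
  have ex: "\<exists>d>0. \<forall>\<eta>. norm \<eta> < d \<longrightarrow> C *v \<eta> = 0 \<longrightarrow> (\<exists>v. c (\<theta>\<^sub>0 + \<eta> + v) = 0 \<and> norm v \<le> e * norm \<eta>)"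
    if e: "e > 0" for e
  proof -
    define k where "k = norm E + 1"
    have k: "k > 0" "norm E \<le> k" by (auto simp: k_def add_nonneg_pos)
    \<comment> \<open>Chosen so that the linearization error at distance
      \<open>(1 + e) * norm \<eta>\<close> is exactly \<open>e * norm \<eta> / k\<close>, the radius
      of the ball used for Brouwer below.\<close>
    define \<epsilon> where "\<epsilon> = e / k / (1 + e)"
    have \<epsilon>: "\<epsilon> > 0" using e k by (simp add: \<epsilon>_def)
    obtain d0 where d0: "d0 > 0" "\<And>y. norm y < d0 \<Longrightarrow> norm (c (\<theta>\<^sub>0 + y) - C *v y) \<le> \<epsilon> * norm y"
    proof -
      obtain d where "d > 0" "\<And>y. norm (y - \<theta>\<^sub>0) < d \<Longrightarrow> norm (c y - c \<theta>\<^sub>0 - C *v (y - \<theta>\<^sub>0)) \<le> \<epsilon> * norm (y - \<theta>\<^sub>0)"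
        using c(1) \<epsilon> unfolding has_derivative_at_alt by blast
      then show ?thesis using that [of d] c(2) by (metis add_diff_cancel_left' diff_zero)
    qed
    define d where "d = min d0 \<rho> / (1 + e)"
    have d: "d > 0" using d0 cont e by (simp add: d_def)
    have "\<exists>v. c (\<theta>\<^sub>0 + \<eta> + v) = 0 \<and> norm v \<le> e * norm \<eta>" if \<eta>: "norm \<eta> < d" "C *v \<eta> = 0" for \<eta>
    proof (cases "\<eta> = 0")
      case True
      then show ?thesis using c by (intro exI [of _ 0]) auto
    next
      case False
      define r where "r = e * norm \<eta> / k"
      have r: "r > 0" using False e k by (simp add: r_def)
      have E_le: "norm (E *v \<mu>) \<le> e * norm \<eta>" if "norm \<mu> \<le> r" for \<mu>
      proof -
        have "norm (E *v \<mu>) \<le> k * r"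
          using that k by (intro order.trans [OF norm_matrix_vector_mult_le] mult_mono) auto
        then show ?thesis using k by (simp add: r_def)
      qed
      have le: "norm (\<eta> + E *v \<mu>) \<le> (1 + e) * norm \<eta>" if "norm \<mu> \<le> r" for \<mu>
        using norm_triangle_ineq [of \<eta> "E *v \<mu>"] E_le [OF that] by (simp add: algebra_simps)
      have small: "(1 + e) * norm \<eta> < min d0 \<rho>"
        using \<eta> e by (simp add: d_def field_simps)
      \<comment> \<open>The correction is sought in the range of the right inverse \<open>E\<close>.
        Since \<open>C\<close> vanishes on \<open>\<eta>\<close>, the linearized constraint at
        \<open>\<eta> + E \<mu>\<close> is just \<open>\<mu>\<close>, and the map is a perturbation
        of the identity in as many dimensions as there are constraints.\<close>
      have "\<exists>\<mu>. norm \<mu> \<le> r \<and> c (\<theta>\<^sub>0 + \<eta> + E *v \<mu>) = 0"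
      proof (rule exists_zero_cball [OF _ r])
        show "continuous_on (cball 0 r) (\<lambda>\<mu>. c (\<theta>\<^sub>0 + \<eta> + E *v \<mu>))"
        proof (rule continuous_on_compose2 [OF cont(1)])
          show "continuous_on (cball 0 r) (\<lambda>\<mu>. \<theta>\<^sub>0 + \<eta> + E *v \<mu>)"
            by (intro continuous_intros linear_continuous_on_compose [OF _ matrix_vector_mul_linear])
          show "(\<lambda>\<mu>. \<theta>\<^sub>0 + \<eta> + E *v \<mu>) ` cball 0 r \<subseteq> ball \<theta>\<^sub>0 \<rho>"
          proof clarify
            fix \<mu> :: "real ^ 'q" assume "\<mu> \<in> cball 0 r"
            then have "norm (\<eta> + E *v \<mu>) < \<rho>" using le [of \<mu>] small by simp
            then show "\<theta>\<^sub>0 + \<eta> + E *v \<mu> \<in> ball \<theta>\<^sub>0 \<rho>"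
              by (metis add.assoc add_diff_cancel_left' dist_norm mem_ball dist_commute)
          qed
        qed
      next
        fix \<mu> :: "real ^ 'q" assume \<mu>: "norm \<mu> \<le> r"
        have "C *v (\<eta> + E *v \<mu>) = \<mu>"
          using E \<eta> by (simp add: matrix_vector_right_distrib matrix_vector_mul_assoc)
        then have "norm (\<mu> - c (\<theta>\<^sub>0 + \<eta> + E *v \<mu>)) \<le> \<epsilon> * norm (\<eta> + E *v \<mu>)"
          using d0(2) [of "\<eta> + E *v \<mu>"] le [OF \<mu>] small by (simp add: norm_minus_commute add.assoc)
        also have "\<dots> \<le> \<epsilon> * ((1 + e) * norm \<eta>)" using le [OF \<mu>] \<epsilon> by (intro mult_left_mono) auto
        also have "\<dots> = r" using e k by (simp add: \<epsilon>_def r_def)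
        finally show "norm (\<mu> - c (\<theta>\<^sub>0 + \<eta> + E *v \<mu>)) \<le> r" .
      qed
      then show ?thesis using E_le by blast
    qed
    with d show ?thesis by blast
  qed
  define V where "V \<eta> = {v. c (\<theta>\<^sub>0 + \<eta> + v) = 0}" for \<eta>
  \<comment> \<open>The slack \<open>(norm \<eta>)\<^sup>2\<close> is positive for nonzero
    \<open>\<eta>\<close> and at most \<open>e / 2 * norm \<eta>\<close> once
    \<open>norm \<eta> \<le> e / 2\<close>, so it is absorbed for every \<open>e\<close>. At zero
    the correction has to vanish exactly.\<close>
  define \<sigma> where "\<sigma> \<eta> = (if \<eta> = 0 then 0 else SOME v. v \<in> V \<eta> \<and> (\<forall>v'\<in>V \<eta>. norm v \<le> norm v' + (norm \<eta>)\<^sup>2))" for \<eta>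
  have "\<exists>d>0. \<forall>\<eta>. norm \<eta> < d \<longrightarrow> C *v \<eta> = 0 \<longrightarrow> c (\<theta>\<^sub>0 + \<eta> + \<sigma> \<eta>) = 0 \<and> norm (\<sigma> \<eta>) \<le> e * norm \<eta>"
    if e: "e > 0" for e
  proof -
    obtain d where d: "d > 0" "\<And>\<eta>. norm \<eta> < d \<Longrightarrow> C *v \<eta> = 0 \<Longrightarrow> \<exists>v. c (\<theta>\<^sub>0 + \<eta> + v) = 0 \<and> norm v \<le> e / 2 * norm \<eta>"
      using ex [of "e / 2"] e by auto
    have "c (\<theta>\<^sub>0 + \<eta> + \<sigma> \<eta>) = 0 \<and> norm (\<sigma> \<eta>) \<le> e * norm \<eta>"
      if \<eta>: "norm \<eta> < min d (e / 2)" "C *v \<eta> = 0" for \<eta>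
    proof (cases "\<eta> = 0")
      case True
      then show ?thesis using c by (simp add: \<sigma>_def)
    next
      case False
      obtain v where v: "v \<in> V \<eta>" "norm v \<le> e / 2 * norm \<eta>" using d(2) [of \<eta>] \<eta> by (auto simp: V_def)
      have "\<exists>v. v \<in> V \<eta> \<and> (\<forall>v'\<in>V \<eta>. norm v \<le> norm v' + (norm \<eta>)\<^sup>2)"
        using exists_near_minimizer [of "V \<eta>" norm "(norm \<eta>)\<^sup>2"] v False by auto
      from someI_ex [OF this] have \<sigma>: "\<sigma> \<eta> \<in> V \<eta>" "norm (\<sigma> \<eta>) \<le> norm v + (norm \<eta>)\<^sup>2"
        using v False by (auto simp: \<sigma>_def)
      have "norm \<eta> * norm \<eta> \<le> e / 2 * norm \<eta>" using \<eta> by (intro mult_right_mono) auto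
      then have "norm (\<sigma> \<eta>) \<le> e * norm \<eta>" using \<sigma>(2) v(2) by (simp add: power2_eq_square)
      then show ?thesis using \<sigma>(1) by (simp add: V_def)
    qed
    then show ?thesis using d(1) e by (intro exI [of _ "min d (e / 2)"]) auto
  qed
  then show ?thesis by blast
qed

section \<open>Asymptotic value of the statistic along the filter\<close>

context estimating_data
begin

context
  fixes \<theta> :: "'a \<Rightarrow> real ^ 'p" and r :: real
  assumes r: "\<forall>\<^sub>F \<xi> in F. norm (sqrt (n \<xi>) *\<^sub>R (\<theta> \<xi> - \<theta>\<^sub>0)) \<le> r"
begin

lemma eventually_feasible: "\<forall>\<^sub>F \<xi> in F. el_feasible g (n \<xi>) (x \<xi>) (\<theta> \<xi>)"
  using eventually_lagrange [OF r] n_pos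
  by eventually_elim (simp add: el_feasible_iff_lagrange \<gamma>_def [abs_def])

lemma el_sum_lim:
  assumes \<psi>: "((\<lambda>u. \<psi> u / u\<^sup>2) \<longlongrightarrow> 1 / 2) (at 0)" "\<psi> 0 = 0"
  defines "y \<xi> \<equiv> zn \<theta>\<^sub>0 \<xi> + \<Gamma> *v (sqrt (n \<xi>) *\<^sub>R (\<theta> \<xi> - \<theta>\<^sub>0))"
  shows "((\<lambda>\<xi>. 2 * (\<Sum>i<n \<xi>. \<psi> (el_t g (n \<xi>) (x \<xi>) (\<theta> \<xi>) \<bullet> g (x \<xi> i) (\<theta> \<xi>)))
      - y \<xi> \<bullet> (matrix_inv \<Sigma> *v y \<xi>)) \<longlongrightarrow> 0) F"
proof -
  define t where "t \<xi> = sqrt (n \<xi>) *\<^sub>R el_t g (n \<xi>) (x \<xi>) (\<theta> \<xi>)" for \<xi>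
  have "\<forall>\<^sub>F \<xi> in F. lagrange (n \<xi>) (\<gamma> (\<theta> \<xi>) \<xi>) (t \<xi>)"
    using eventually_feasible n_pos
  proof eventually_elim
    case (elim \<xi>)
    from el_t_multiplier [OF elim(1)] show ?case
      unfolding el_multiplier_iff_lagrange [OF elim(2)] t_def \<gamma>_def [abs_def] .
  qed
  from lagrange_sum_lim [OF r this \<psi>]
  have "((\<lambda>\<xi>. 2 * (\<Sum>i<n \<xi>. \<psi> (t \<xi> \<bullet> \<gamma> (\<theta> \<xi>) \<xi> i)) - y \<xi> \<bullet> (matrix_inv \<Sigma> *v y \<xi>)) \<longlongrightarrow> 0) F"
    by (simp add: y_def)
  then show ?thesis
  proof (rule Lim_transform_eventually)
    show "\<forall>\<^sub>F \<xi> in F. 2 * (\<Sum>i<n \<xi>. \<psi> (t \<xi> \<bullet> \<gamma> (\<theta> \<xi>) \<xi> i)) - y \<xi> \<bullet> (matrix_inv \<Sigma> *v y \<xi>)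
      = 2 * (\<Sum>i<n \<xi>. \<psi> (el_t g (n \<xi>) (x \<xi>) (\<theta> \<xi>) \<bullet> g (x \<xi> i) (\<theta> \<xi>))) - y \<xi> \<bullet> (matrix_inv \<Sigma> *v y \<xi>)"
      using n_pos by eventually_elim (simp add: t_def \<gamma>_def)
  qed
qed

lemma el_loglik_lim:
  defines "y \<xi> \<equiv> zn \<theta>\<^sub>0 \<xi> + \<Gamma> *v (sqrt (n \<xi>) *\<^sub>R (\<theta> \<xi> - \<theta>\<^sub>0))"
  shows "((\<lambda>\<xi>. - 2 * el_loglik g (n \<xi>) (x \<xi>) (\<theta> \<xi>) - y \<xi> \<bullet> (matrix_inv \<Sigma> *v y \<xi>)) \<longlongrightarrow> 0) F"
  unfolding y_def
proof (rule Lim_transform_eventually [OF el_sum_lim [OF \<psi>_log_lim]])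
  show "\<forall>\<^sub>F \<xi> in F. 2 * (\<Sum>i<n \<xi>. \<psi>_log (el_t g (n \<xi>) (x \<xi>) (\<theta> \<xi>) \<bullet> g (x \<xi> i) (\<theta> \<xi>))) -
      (zn \<theta>\<^sub>0 \<xi> + \<Gamma> *v (sqrt (n \<xi>) *\<^sub>R (\<theta> \<xi> - \<theta>\<^sub>0))) \<bullet> (matrix_inv \<Sigma> *v (zn \<theta>\<^sub>0 \<xi> + \<Gamma> *v (sqrt (n \<xi>) *\<^sub>R (\<theta> \<xi> - \<theta>\<^sub>0))))
    = - 2 * el_loglik g (n \<xi>) (x \<xi>) (\<theta> \<xi>) -
      (zn \<theta>\<^sub>0 \<xi> + \<Gamma> *v (sqrt (n \<xi>) *\<^sub>R (\<theta> \<xi> - \<theta>\<^sub>0))) \<bullet> (matrix_inv \<Sigma> *v (zn \<theta>\<^sub>0 \<xi> + \<Gamma> *v (sqrt (n \<xi>) *\<^sub>R (\<theta> \<xi> - \<theta>\<^sub>0))))"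
    using eventually_feasible n_pos by eventually_elim (simp add: el_loglik_eq)
qed (simp add: \<psi>_log_def)

end

text \<open>A sandwich. From below, the rescaled deviation \<open>ht\<close> of the restricted
  maximizer is a tangent vector up to a null term, and on tangent vectors the form is at least
  \<open>m\<close>. From above, the likelihood at the restricted maximizer is at least that at
  \<open>\<theta>s\<close>, where the form is \<open>m\<close> up to a null term.\<close>

lemma phi_statistic_lim:
  fixes c :: "real ^ 'p \<Rightarrow> real ^ 'q" and C :: "real ^ 'p ^ 'q"
  assumes \<Theta>: "ball \<theta>\<^sub>0 \<rho> \<subseteq> \<Theta>"
    and c: "(c has_derivative (\<lambda>h. C *v h)) (at \<theta>\<^sub>0)" "c \<theta>\<^sub>0 = 0" "continuous_on (ball \<theta>\<^sub>0 \<rho>) c"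
      "rank C = CARD('q)"
    and \<theta>h: "\<forall>\<^sub>F \<xi> in F. el_maximizer g (n \<xi>) (x \<xi>) \<Theta> (\<theta>h \<xi>)"
    and \<theta>t: "\<forall>\<^sub>F \<xi> in F. el_maximizer g (n \<xi>) (x \<xi>) {\<theta> \<in> \<Theta>. c \<theta> = 0} (\<theta>t \<xi>)"
    and r: "\<forall>\<^sub>F \<xi> in F. norm (sqrt (n \<xi>) *\<^sub>R (\<theta>t \<xi> - \<theta>\<^sub>0)) \<le> r"
    and \<phi>: "\<phi> \<in> phi_class"
    and low: "\<And>z h. C *v h = 0 \<Longrightarrow> m z \<le> (z + \<Gamma> *v h) \<bullet> (matrix_inv \<Sigma> *v (z + \<Gamma> *v h))"
    and attained: "\<And>z. \<exists>h. C *v h = 0 \<and> norm h \<le> L * norm z \<and>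
       (z + \<Gamma> *v h) \<bullet> (matrix_inv \<Sigma> *v (z + \<Gamma> *v h)) = m z"
  shows "((\<lambda>\<xi>. phi_statistic \<phi> g (n \<xi>) (x \<xi>) (\<theta>h \<xi>) (\<theta>t \<xi>) - m (zn \<theta>\<^sub>0 \<xi>)) \<longlongrightarrow> 0) F"
proof -
  define R where "R = matrix_inv \<Sigma>"
  define Q where "Q y = y \<bullet> (R *v y)" for y
  define z where "z = zn \<theta>\<^sub>0"
  define s where "s \<xi> = sqrt (n \<xi>)" for \<xi>
  define l where "l \<xi> \<theta> = el_loglik g (n \<xi>) (x \<xi>) \<theta>" for \<xi> \<theta>
  have s_pos: "\<forall>\<^sub>F \<xi> in F. s \<xi> > 0" using n_pos by eventually_elim (simp add: s_def)
  have inv0: "((\<lambda>\<xi>. 1 / s \<xi>) \<longlongrightarrow> 0) F"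
    using tendsto_inverse_0_at_top [OF sqrt_n] by (simp add: inverse_eq_divide s_def)
  have zK: "\<forall>\<^sub>F \<xi> in F. norm (z \<xi>) \<le> \<bar>K\<bar>"
    using Z_bdd by eventually_elim (simp add: z_def zn_def \<gamma>_def scaleR_sum_right)
  have bdd_y: "Bfun (\<lambda>\<xi>. z \<xi> + \<Gamma> *v h \<xi>) F" if h: "\<forall>\<^sub>F \<xi> in F. norm (h \<xi>) \<le> b" for h b
  proof (rule BfunI)
    show "\<forall>\<^sub>F \<xi> in F. norm (z \<xi> + \<Gamma> *v h \<xi>) \<le> \<bar>K\<bar> + norm \<Gamma> * b"
      using zK h by eventually_elim (intro order.trans [OF norm_triangle_ineq] add_mono
        order.trans [OF norm_matrix_vector_mult_le] mult_left_mono, auto)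
  qed
  have Q_diff: "((\<lambda>\<xi>. Q (z \<xi> + \<Gamma> *v k \<xi>) - Q (z \<xi> + \<Gamma> *v h \<xi>)) \<longlongrightarrow> 0) F"
    if h: "\<forall>\<^sub>F \<xi> in F. norm (h \<xi>) \<le> b" and hk: "((\<lambda>\<xi>. k \<xi> - h \<xi>) \<longlongrightarrow> 0) F" for h k b
    unfolding Q_def
  proof (rule quadratic_form_diff_lim [OF bdd_y [OF h]])
    show "((\<lambda>\<xi>. z \<xi> + \<Gamma> *v k \<xi> - (z \<xi> + \<Gamma> *v h \<xi>)) \<longlongrightarrow> 0) F"
      using bounded_linear.tendsto_zero [OF matrix_vector_mul_bounded_linear hk, of \<Gamma>]
      by (simp add: matrix_vector_mult_diff_distrib)
  qed

  define ht where "ht \<xi> = s \<xi> *\<^sub>R (\<theta>t \<xi> - \<theta>\<^sub>0)" for \<xi>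
  have ht_r: "\<forall>\<^sub>F \<xi> in F. norm (ht \<xi>) \<le> r" using r by (simp add: ht_def s_def)
  have T_lim: "((\<lambda>\<xi>. phi_statistic \<phi> g (n \<xi>) (x \<xi>) (\<theta>h \<xi>) (\<theta>t \<xi>) - Q (z \<xi> + \<Gamma> *v ht \<xi>)) \<longlongrightarrow> 0) F"
  proof -
    have \<phi>1: "\<phi> 1 = 0" using \<phi> by (simp add: phi_class_def)
    have "((\<lambda>\<xi>. 2 * (\<Sum>i<n \<xi>. \<psi>_phi \<phi> (el_t g (n \<xi>) (x \<xi>) (\<theta>t \<xi>) \<bullet> g (x \<xi> i) (\<theta>t \<xi>)))
        - Q (z \<xi> + \<Gamma> *v ht \<xi>)) \<longlongrightarrow> 0) F"
      using el_sum_lim [OF r \<psi>_phi_lim [OF \<phi>]] \<phi>1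
      by (simp add: \<psi>_phi_def Q_def R_def z_def ht_def s_def)
    then show ?thesis
    proof (rule Lim_transform_eventually)
      show "\<forall>\<^sub>F \<xi> in F. 2 * (\<Sum>i<n \<xi>. \<psi>_phi \<phi> (el_t g (n \<xi>) (x \<xi>) (\<theta>t \<xi>) \<bullet> g (x \<xi> i) (\<theta>t \<xi>)))
          - Q (z \<xi> + \<Gamma> *v ht \<xi>) =
        phi_statistic \<phi> g (n \<xi>) (x \<xi>) (\<theta>h \<xi>) (\<theta>t \<xi>) - Q (z \<xi> + \<Gamma> *v ht \<xi>)"
        using \<theta>h n_pos eventually_zero_estimating
      proof eventually_elim
        case (elim \<xi>)
        then obtain \<theta> where "\<theta> \<in> \<Theta>" "(\<Sum>i<n \<xi>. g (x \<xi> i) \<theta>) = 0" using \<Theta> by blast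
        from el_maximizer_weights [OF elim(1,2) this]
        have "phi_statistic \<phi> g (n \<xi>) (x \<xi>) (\<theta>h \<xi>) (\<theta>t \<xi>)
            = 2 * (\<Sum>i<n \<xi>. \<psi>_phi \<phi> (el_t g (n \<xi>) (x \<xi>) (\<theta>t \<xi>) \<bullet> g (x \<xi> i) (\<theta>t \<xi>)))"
          by (rule phi_statistic_eq) (use elim \<phi>1 in auto)
        then show ?case by simp
      qed
    qed
  qed
  have lt_lim: "((\<lambda>\<xi>. - 2 * l \<xi> (\<theta>t \<xi>) - Q (z \<xi> + \<Gamma> *v ht \<xi>)) \<longlongrightarrow> 0) F"
    using el_loglik_lim [OF r] by (simp add: Q_def R_def z_def ht_def s_def l_def)

  have "\<exists>E. C ** E = mat 1"
    using c(4) by (simp add: matrix_right_invertible_surjective full_rank_surjective)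
  then obtain E where E: "C ** E = mat 1" ..
  \<comment> \<open>The constraint vanishes at both \<open>\<theta>\<^sub>0\<close> and the
    restricted maximizer, so \<open>C ht\<close> is only the rescaled linearization error, which is
    small because \<open>ht\<close> stays bounded.\<close>
  have Cht: "((\<lambda>\<xi>. C *v ht \<xi>) \<longlongrightarrow> 0) F"
  proof (rule tendstoI)
    fix e :: real assume e: "e > 0"
    define e' where "e' = e / (\<bar>r\<bar> + 1)"
    have e': "e' > 0" using e by (simp add: e'_def add_nonneg_pos)
    obtain d where d: "d > 0"
      "\<And>y. norm (y - \<theta>\<^sub>0) < d \<Longrightarrow> norm (c y - c \<theta>\<^sub>0 - C *v (y - \<theta>\<^sub>0)) \<le> e' * norm (y - \<theta>\<^sub>0)"
      using c(1) e' unfolding has_derivative_at_alt by blast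
    show "\<forall>\<^sub>F \<xi> in F. dist (C *v ht \<xi>) 0 < e"
      using \<theta>t ht_r s_pos filterlim_at_top_dense [THEN iffD1, OF sqrt_n, rule_format, of "r / d"]
    proof eventually_elim
      case (elim \<xi>)
      have "s \<xi> * norm (\<theta>t \<xi> - \<theta>\<^sub>0) \<le> r" using elim(2,3) by (simp add: ht_def)
      also have "r < s \<xi> * d" using elim d by (simp add: pos_divide_less_eq s_def)
      finally have "norm (\<theta>t \<xi> - \<theta>\<^sub>0) < d" using elim by simp
      from d(2) [OF this] have "norm (C *v (\<theta>t \<xi> - \<theta>\<^sub>0)) \<le> e' * norm (\<theta>t \<xi> - \<theta>\<^sub>0)"
        using elim(1) c(2) by (simp add: el_maximizer_def is_arg_max_def)
      then have "s \<xi> * norm (C *v (\<theta>t \<xi> - \<theta>\<^sub>0)) \<le> e' * norm (ht \<xi>)"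
        using elim(3) unfolding ht_def norm_scaleR by (simp add: mult.left_commute)
      also have "\<dots> \<le> e' * \<bar>r\<bar>" using elim e' by (intro mult_left_mono) auto
      also have "\<dots> < e" using e by (simp add: e'_def field_simps add_nonneg_pos)
      finally show ?case using elim(3) by (simp add: ht_def matrix_vector_mult_scaleR)
    qed
  qed
  \<comment> \<open>Subtracting \<open>E C ht\<close> projects onto the kernel of \<open>C\<close>
    and changes \<open>ht\<close> by a null term.\<close>
  define h' where "h' \<xi> = ht \<xi> - E *v (C *v ht \<xi>)" for \<xi>
  have Ch': "C *v h' \<xi> = 0" for \<xi>
    using E by (simp add: h'_def matrix_vector_mult_diff_distrib matrix_vector_mul_assoc matrix_mul_assoc)
  have "((\<lambda>\<xi>. h' \<xi> - ht \<xi>) \<longlongrightarrow> 0) F"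
    using tendsto_minus [OF bounded_linear.tendsto_zero [OF matrix_vector_mul_bounded_linear Cht, of E]]
    by (simp add: h'_def)
  from Q_diff [OF ht_r this] have Q_h': "((\<lambda>\<xi>. Q (z \<xi> + \<Gamma> *v h' \<xi>) - Q (z \<xi> + \<Gamma> *v ht \<xi>)) \<longlongrightarrow> 0) F" .

  obtain hs where hs: "\<And>z. C *v hs z = 0" "\<And>z. norm (hs z) \<le> L * norm z" "\<And>z. Q (z + \<Gamma> *v hs z) = m z"
    using attained unfolding Q_def R_def by metis
  obtain \<sigma> where \<sigma>: "\<And>e. e > 0 \<Longrightarrow> \<exists>d>0. \<forall>\<eta>. norm \<eta> < d \<longrightarrow> C *v \<eta> = 0 \<longrightarrow>
     c (\<theta>\<^sub>0 + \<eta> + \<sigma> \<eta>) = 0 \<and> norm (\<sigma> \<eta>) \<le> e * norm \<eta>"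
    using constraint_correction [OF c(1,2,3) \<rho> c(4)] by blast
  \<comment> \<open>The constrained minimizer brought back to the scale of the parameter; being
    small and tangent, it can be moved onto the constraint surface by \<open>\<sigma>\<close> with
    an error of smaller order than \<open>1 / sqrt n\<close>.\<close>
  define \<eta> where "\<eta> \<xi> = (1 / s \<xi>) *\<^sub>R hs (z \<xi>)" for \<xi>
  define \<theta>s where "\<theta>s \<xi> = \<theta>\<^sub>0 + \<eta> \<xi> + \<sigma> (\<eta> \<xi>)" for \<xi>
  define k where "k \<xi> = s \<xi> *\<^sub>R (\<theta>s \<xi> - \<theta>\<^sub>0)" for \<xi>
  have hsK: "\<forall>\<^sub>F \<xi> in F. norm (hs (z \<xi>)) \<le> \<bar>L\<bar> * \<bar>K\<bar>"
    using zK
  proof eventually_elim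
    case (elim \<xi>)
    have "norm (hs (z \<xi>)) \<le> \<bar>L\<bar> * norm (z \<xi>)"
      using hs(2) [of "z \<xi>"] by (rule order.trans) (simp add: mult_right_mono)
    also have "\<dots> \<le> \<bar>L\<bar> * \<bar>K\<bar>" using elim by (intro mult_left_mono) auto
    finally show ?case .
  qed
  have "\<forall>\<^sub>F \<xi> in F. norm (\<eta> \<xi>) \<le> 1 / s \<xi> * (\<bar>L\<bar> * \<bar>K\<bar>)"
    using hsK s_pos by eventually_elim (simp add: \<eta>_def divide_right_mono)
  then have \<eta>0: "(\<eta> \<longlongrightarrow> 0) F" by (rule tendsto_zero_bound_mult [OF inv0])
  have C\<eta>: "C *v \<eta> \<xi> = 0" for \<xi> using hs(1) by (simp add: \<eta>_def matrix_vector_mult_scaleR)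
  have \<sigma>_ev: "\<forall>\<^sub>F \<xi> in F. c (\<theta>s \<xi>) = 0 \<and> norm (\<sigma> (\<eta> \<xi>)) \<le> e * norm (\<eta> \<xi>)" if "e > 0" for e
  proof -
    obtain d where d: "d > 0" "\<And>\<eta>. norm \<eta> < d \<Longrightarrow> C *v \<eta> = 0 \<Longrightarrow>
       c (\<theta>\<^sub>0 + \<eta> + \<sigma> \<eta>) = 0 \<and> norm (\<sigma> \<eta>) \<le> e * norm \<eta>" using \<sigma> [OF \<open>e > 0\<close>] by blast
    have "\<forall>\<^sub>F \<xi> in F. norm (\<eta> \<xi>) < d" using tendstoD [OF \<eta>0 d(1)] by simp
    then show ?thesis using d(2) C\<eta> by (auto simp: \<theta>s_def elim!: eventually_mono)
  qed
  have k_hs: "((\<lambda>\<xi>. k \<xi> - hs (z \<xi>)) \<longlongrightarrow> 0) F"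
  proof (rule tendstoI)
    fix e :: real assume e: "e > 0"
    define e' where "e' = e / (\<bar>L\<bar> * \<bar>K\<bar> + 1)"
    have e': "e' > 0" using e by (simp add: e'_def add_nonneg_pos)
    show "\<forall>\<^sub>F \<xi> in F. dist (k \<xi> - hs (z \<xi>)) 0 < e"
      using \<sigma>_ev [OF e'] s_pos hsK
    proof eventually_elim
      case (elim \<xi>)
      have "k \<xi> - hs (z \<xi>) = s \<xi> *\<^sub>R \<sigma> (\<eta> \<xi>)"
        using elim by (simp add: k_def \<theta>s_def \<eta>_def scaleR_add_right)
      then have "norm (k \<xi> - hs (z \<xi>)) \<le> s \<xi> * (e' * norm (\<eta> \<xi>))"
        using elim by (simp add: mult_left_mono)
      also have "\<dots> = e' * norm (hs (z \<xi>))" using elim by (simp add: \<eta>_def)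
      also have "\<dots> \<le> e' * (\<bar>L\<bar> * \<bar>K\<bar>)" using elim e' by (intro mult_left_mono) auto
      also have "\<dots> < e' * (\<bar>L\<bar> * \<bar>K\<bar> + 1)" using e' by simp
      also have "\<dots> = e" unfolding e'_def
        using add_nonneg_pos [of "\<bar>L\<bar> * \<bar>K\<bar>" 1] by simp
      finally show ?case by simp
    qed
  qed
  have Q_k: "((\<lambda>\<xi>. Q (z \<xi> + \<Gamma> *v k \<xi>) - m (z \<xi>)) \<longlongrightarrow> 0) F"
    using Q_diff [OF hsK k_hs] by (simp add: hs(3))
  have k_b: "\<forall>\<^sub>F \<xi> in F. norm (k \<xi>) \<le> \<bar>L\<bar> * \<bar>K\<bar> + 1"
    using eventually_bdd_of_tendsto [OF k_hs] hsK
  proof eventually_elim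
    case (elim \<xi>)
    then show ?case using norm_triangle_ineq [of "hs (z \<xi>)" "k \<xi> - hs (z \<xi>)"] by simp
  qed
  then have k_b': "\<forall>\<^sub>F \<xi> in F. norm (sqrt (n \<xi>) *\<^sub>R (\<theta>s \<xi> - \<theta>\<^sub>0)) \<le> \<bar>L\<bar> * \<bar>K\<bar> + 1"
    by (simp add: k_def s_def)
  have ls_lim: "((\<lambda>\<xi>. - 2 * l \<xi> (\<theta>s \<xi>) - Q (z \<xi> + \<Gamma> *v k \<xi>)) \<longlongrightarrow> 0) F"
    using el_loglik_lim [OF k_b'] by (simp add: Q_def R_def z_def k_def s_def l_def)
  \<comment> \<open>The point \<open>\<theta>s\<close> counts as a competitor once it lies in
    \<open>\<Theta>\<close>, satisfies the constraint and is feasible; each of these holds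
    eventually.\<close>
  have opt: "\<forall>\<^sub>F \<xi> in F. - 2 * l \<xi> (\<theta>t \<xi>) \<le> - 2 * l \<xi> (\<theta>s \<xi>)"
    using \<theta>t \<sigma>_ev [OF zero_less_one] eventually_ball [OF k_b'] eventually_feasible [OF k_b']
  proof eventually_elim
    case (elim \<xi>)
    then have "\<theta>s \<xi> \<in> \<Theta>" using \<Theta> by blast
    then show ?case using elim by (auto simp: el_maximizer_def is_arg_max_def not_less l_def)
  qed

  let ?T = "\<lambda>\<xi>. phi_statistic \<phi> g (n \<xi>) (x \<xi>) (\<theta>h \<xi>) (\<theta>t \<xi>)"
  \<comment> \<open>After cancellation the lower sequence is
    \<open>?T - Q (z + \<Gamma> h')\<close>, and the upper one below is \<open>?T - m z\<close> plus
    twice the gain in log-likelihood of \<open>\<theta>t\<close> over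
    \<open>\<theta>s\<close>.\<close>
  have lower: "((\<lambda>\<xi>. (?T \<xi> - Q (z \<xi> + \<Gamma> *v ht \<xi>)) - (Q (z \<xi> + \<Gamma> *v h' \<xi>) - Q (z \<xi> + \<Gamma> *v ht \<xi>))) \<longlongrightarrow> 0) F"
    using tendsto_diff [OF T_lim Q_h'] by simp
  have upper: "((\<lambda>\<xi>. (?T \<xi> - Q (z \<xi> + \<Gamma> *v ht \<xi>)) - (- 2 * l \<xi> (\<theta>t \<xi>) - Q (z \<xi> + \<Gamma> *v ht \<xi>))
     + ((- 2 * l \<xi> (\<theta>s \<xi>) - Q (z \<xi> + \<Gamma> *v k \<xi>)) + (Q (z \<xi> + \<Gamma> *v k \<xi>) - m (z \<xi>)))) \<longlongrightarrow> 0) F"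
    using tendsto_add [OF tendsto_diff [OF T_lim lt_lim] tendsto_add [OF ls_lim Q_k]] by simp
  have "((\<lambda>\<xi>. ?T \<xi> - m (z \<xi>)) \<longlongrightarrow> 0) F"
  proof (rule tendsto_sandwich [OF _ _ lower upper])
    show "\<forall>\<^sub>F \<xi> in F. (?T \<xi> - Q (z \<xi> + \<Gamma> *v ht \<xi>)) - (Q (z \<xi> + \<Gamma> *v h' \<xi>) - Q (z \<xi> + \<Gamma> *v ht \<xi>)) \<le> ?T \<xi> - m (z \<xi>)"
      using low [OF Ch'] by (intro always_eventually) (simp add: Q_def R_def)
    show "\<forall>\<^sub>F \<xi> in F. ?T \<xi> - m (z \<xi>) \<le> (?T \<xi> - Q (z \<xi> + \<Gamma> *v ht \<xi>)) - (- 2 * l \<xi> (\<theta>t \<xi>) - Q (z \<xi> + \<Gamma> *v ht \<xi>))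
     + ((- 2 * l \<xi> (\<theta>s \<xi>) - Q (z \<xi> + \<Gamma> *v k \<xi>)) + (Q (z \<xi> + \<Gamma> *v k \<xi>) - m (z \<xi>)))"
      using opt by eventually_elim simp
  qed
  then show ?thesis by (simp add: z_def)
qed

end

section \<open>Convergence in probability as a filter\<close>

text \<open>Along this filter, \<open>o\<^sub>P(1)\<close> means convergence to \<open>0\<close>. Variables that are only bounded in
  probability become bounded after intersecting the filter with an event \<open>{W \<le> K}\<close>.\<close>

definition wp1 :: "'w measure \<Rightarrow> (nat \<times> 'w) filter" where
  "wp1 M = Abs_filter (\<lambda>P. with_prob_tending_to_one M (\<lambda>n \<omega>. P (n, \<omega>)))"

lemma (in prob_space) with_prob_tending_to_oneI:
  assumes "\<And>n. A n \<in> events" "\<And>n. 1 - e n \<le> prob (A n)" "e \<longlonglongrightarrow> 0" "\<And>n \<omega>. \<omega> \<in> A n \<Longrightarrow> R n \<omega>"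
  shows "with_prob_tending_to_one M R"
proof -
  have "(\<lambda>n. prob (A n)) \<longlonglongrightarrow> 1"
  proof (rule tendsto_sandwich [OF _ _ _ tendsto_const])
    show "(\<lambda>n. 1 - e n) \<longlonglongrightarrow> 1" using tendsto_diff [OF tendsto_const assms(3), of 1] by simp
  qed (use assms(2) prob_le_1 in auto)
  then show ?thesis using assms by (auto simp: with_prob_tending_to_one_def intro!: exI [of _ A])
qed

text \<open>Closure under conjunction is the substantial filter law: intersect the inner events,
  whose defects \<open>1 - prob\<close> add up and still tend to zero.\<close>

lemma (in prob_space) eventually_wp1:
  "eventually P (wp1 M) \<longleftrightarrow> with_prob_tending_to_one M (\<lambda>n \<omega>. P (n, \<omega>))"
  unfolding wp1_def
proof (rule eventually_Abs_filter, rule is_filter.intro)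
  show "with_prob_tending_to_one M (\<lambda>n \<omega>. True)"
    by (auto simp: with_prob_tending_to_one_def prob_space intro!: exI [of _ "\<lambda>_. space M"])
next
  fix P Q :: "nat \<times> 'a \<Rightarrow> bool"
  assume "with_prob_tending_to_one M (\<lambda>n \<omega>. P (n, \<omega>))" "with_prob_tending_to_one M (\<lambda>n \<omega>. Q (n, \<omega>))"
  then obtain A B where A: "\<And>n. A n \<in> events" "\<And>n \<omega>. \<omega> \<in> A n \<Longrightarrow> P (n, \<omega>)" "(\<lambda>n. prob (A n)) \<longlonglongrightarrow> 1"
    and B: "\<And>n. B n \<in> events" "\<And>n \<omega>. \<omega> \<in> B n \<Longrightarrow> Q (n, \<omega>)" "(\<lambda>n. prob (B n)) \<longlonglongrightarrow> 1"
    unfolding with_prob_tending_to_one_def by metis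
  show "with_prob_tending_to_one M (\<lambda>n \<omega>. P (n, \<omega>) \<and> Q (n, \<omega>))"
  proof (rule with_prob_tending_to_oneI [where A = "\<lambda>n. A n \<inter> B n"])
    show "1 - ((1 - prob (A n)) + (1 - prob (B n))) \<le> prob (A n \<inter> B n)" for n
      using measure_Un3 [of "A n" M "B n"] A(1) B(1) prob_le_1 [of "A n \<union> B n"]
      by (simp add: fmeasurable_eq_sets)
    show "(\<lambda>n. (1 - prob (A n)) + (1 - prob (B n))) \<longlonglongrightarrow> 0"
      using tendsto_add [OF tendsto_diff [OF tendsto_const A(3), of 1] tendsto_diff [OF tendsto_const B(3), of 1]]
      by simp
  qed (use A B in auto)
next
  fix P Q :: "nat \<times> 'a \<Rightarrow> bool"
  assume "\<forall>x. P x \<longrightarrow> Q x" "with_prob_tending_to_one M (\<lambda>n \<omega>. P (n, \<omega>))"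
  then show "with_prob_tending_to_one M (\<lambda>n \<omega>. Q (n, \<omega>))"
    unfolding with_prob_tending_to_one_def by blast
qed

lemma (in prob_space) eventually_wp1_sequentially:
  assumes "eventually P sequentially"
  shows "\<forall>\<^sub>F \<xi> in wp1 M. P (fst \<xi>)"
  unfolding eventually_wp1
proof (rule with_prob_tending_to_oneI [where A = "\<lambda>n. if P n then space M else {}" and e = "\<lambda>n. if P n then 0 else 1"])
  show "(\<lambda>n. if P n then 0 else 1 :: real) \<longlonglongrightarrow> 0"
    using assms by (intro tendsto_eventually) (auto elim: eventually_mono)
qed (auto simp: prob_space split: if_splits)

lemma (in prob_space) fst_wp1: "filterlim fst at_top (wp1 M)"
  by (auto simp: filterlim_iff intro: eventually_wp1_sequentially)

text \<open>Markov's inequality; the measurable sets where the absolute value is below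
  \<open>e\<close> serve as inner events.\<close>

lemma (in prob_space) tendsto_wp1_zeroI:
  fixes f :: "nat \<Rightarrow> 'a \<Rightarrow> real"
  assumes f: "\<And>n. integrable M (f n)" and lim: "(\<lambda>n. expectation (\<lambda>\<omega>. \<bar>f n \<omega>\<bar>)) \<longlonglongrightarrow> 0"
  shows "((\<lambda>\<xi>. f (fst \<xi>) (snd \<xi>)) \<longlongrightarrow> 0) (wp1 M)"
proof (rule tendstoI)
  fix e :: real assume e: "e > 0"
  have [measurable]: "f n \<in> borel_measurable M" for n using f by auto
  show "\<forall>\<^sub>F \<xi> in wp1 M. dist (f (fst \<xi>) (snd \<xi>)) 0 < e"
    unfolding eventually_wp1
  proof (rule with_prob_tending_to_oneI [where A = "\<lambda>n. {\<omega> \<in> space M. \<bar>f n \<omega>\<bar> < e}"])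
    fix n
    have "prob {\<omega> \<in> space M. e \<le> \<bar>f n \<omega>\<bar>} \<le> expectation (\<lambda>\<omega>. \<bar>f n \<omega>\<bar>) / e"
      using f e by (intro integral_Markov_inequality_measure [where A = "{}"]) auto
    moreover have "{\<omega> \<in> space M. \<bar>f n \<omega>\<bar> < e} = space M - {\<omega> \<in> space M. e \<le> \<bar>f n \<omega>\<bar>}" by auto
    ultimately show "1 - expectation (\<lambda>\<omega>. \<bar>f n \<omega>\<bar>) / e \<le> prob {\<omega> \<in> space M. \<bar>f n \<omega>\<bar> < e}"
      by (simp add: prob_compl)
    show "(\<lambda>n. expectation (\<lambda>\<omega>. \<bar>f n \<omega>\<bar>) / e) \<longlonglongrightarrow> 0"
      using tendsto_divide [OF lim tendsto_const, of e] e by simp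
  qed auto
qed

section \<open>Laws of large numbers\<close>

context prob_space
begin

lemma expectation_abs_le_sqrt:
  fixes Y :: "'a \<Rightarrow> real"
  assumes [measurable]: "Y \<in> borel_measurable M" and Y2: "integrable M (\<lambda>\<omega>. (Y \<omega>)\<^sup>2)"
  shows "expectation (\<lambda>\<omega>. \<bar>Y \<omega>\<bar>) \<le> sqrt (expectation (\<lambda>\<omega>. (Y \<omega>)\<^sup>2))"
proof -
  have Y: "integrable M Y" by (rule square_integrable_imp_integrable [OF _ Y2]) simp
  have "(expectation (\<lambda>\<omega>. \<bar>Y \<omega>\<bar>))\<^sup>2 \<le> expectation (\<lambda>\<omega>. (Y \<omega>)\<^sup>2)"
    using variance_positive [of "\<lambda>\<omega>. \<bar>Y \<omega>\<bar>"] variance_eq [of "\<lambda>\<omega>. \<bar>Y \<omega>\<bar>"] Y Y2 by simp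
  then show ?thesis by (rule real_le_rsqrt)
qed

lemma second_moment_sum:
  fixes Z :: "nat \<Rightarrow> 'a \<Rightarrow> real"
  assumes indep: "indep_vars (\<lambda>_. borel) Z UNIV"
    and Z2: "\<And>i. integrable M (\<lambda>\<omega>. (Z i \<omega>)\<^sup>2)" and mean: "\<And>i. expectation (Z i) = 0"
    and v: "\<And>i. expectation (\<lambda>\<omega>. (Z i \<omega>)\<^sup>2) = v"
  shows "integrable M (\<lambda>\<omega>. (\<Sum>i<n. Z i \<omega>)\<^sup>2) \<and> expectation (\<lambda>\<omega>. (\<Sum>i<n. Z i \<omega>)\<^sup>2) = n * v"
proof (induction n)
  case 0
  then show ?case by simp
next
  case (Suc n)
  have [measurable]: "Z i \<in> borel_measurable M" for i using indep by (simp add: indep_vars_def2)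
  have Z: "integrable M (Z i)" for i by (rule square_integrable_imp_integrable [OF _ Z2]) simp
  have "indep_var borel (Z n) borel (\<lambda>\<omega>. \<Sum>i<n. Z i \<omega>)"
    by (intro indep_vars_sum indep_vars_subset [OF indep]) auto
  from indep_var_integrable [OF this] indep_var_lebesgue_integral [OF this]
  have ZS: "integrable M (\<lambda>\<omega>. Z n \<omega> * (\<Sum>i<n. Z i \<omega>))" "expectation (\<lambda>\<omega>. Z n \<omega> * (\<Sum>i<n. Z i \<omega>)) = 0"
    using Z mean by auto
  have "(\<lambda>\<omega>. (\<Sum>i<Suc n. Z i \<omega>)\<^sup>2) = (\<lambda>\<omega>. (\<Sum>i<n. Z i \<omega>)\<^sup>2 + 2 * (Z n \<omega> * (\<Sum>i<n. Z i \<omega>)) + (Z n \<omega>)\<^sup>2)"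
    by (auto simp: power2_eq_square algebra_simps)
  then show ?case using Suc ZS Z2 v by (simp add: algebra_simps)
qed

context
  fixes X :: "nat \<Rightarrow> 'a \<Rightarrow> 'b" and N F :: "'b measure"
  assumes indep: "indep_vars (\<lambda>_. N) X UNIV" and distr: "\<And>i. distr M N (X i) = F"
begin

lemma X_meas: "X i \<in> measurable M N"
  using indep by (simp add: indep_vars_def2)

lemma sets_F: "sets F = sets N" using distr [of 0] by (metis sets_distr)

lemma prob_space_F: "prob_space F" using prob_space_distr [OF X_meas] distr by metis

lemma integral_X:
  fixes f :: "'b \<Rightarrow> 'c::{banach,second_countable_topology}"
  assumes f: "f \<in> borel_measurable N"
  shows "expectation (\<lambda>\<omega>. f (X i \<omega>)) = integral\<^sup>L F f"
    and "integrable M (\<lambda>\<omega>. f (X i \<omega>)) \<longleftrightarrow> integrable F f"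
  unfolding distr [of i, symmetric] using f X_meas by (simp_all add: integral_distr integrable_distr_eq)

lemma mean_square_average:
  fixes f :: "'b \<Rightarrow> real"
  assumes f: "f \<in> borel_measurable N" and f2: "integrable F (\<lambda>x. (f x)\<^sup>2)" and mean: "integral\<^sup>L F f = 0"
  shows "integrable M (\<lambda>\<omega>. (\<Sum>i<n. f (X i \<omega>))\<^sup>2)"
    and "expectation (\<lambda>\<omega>. (\<Sum>i<n. f (X i \<omega>))\<^sup>2) = n * (\<integral>x. (f x)\<^sup>2 \<partial>F)"
proof -
  have "indep_vars (\<lambda>_. borel) (\<lambda>i \<omega>. f (X i \<omega>)) UNIV"
    by (rule indep_vars_compose2 [OF indep]) (use f in auto)
  moreover have "integrable M (\<lambda>\<omega>. (f (X i \<omega>))\<^sup>2)" "expectation (\<lambda>\<omega>. f (X i \<omega>)) = 0"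
    "expectation (\<lambda>\<omega>. (f (X i \<omega>))\<^sup>2) = (\<integral>x. (f x)\<^sup>2 \<partial>F)" for i
    using integral_X [of "\<lambda>x. (f x)\<^sup>2" i] integral_X [of f i] f f2 mean by simp_all
  ultimately have "integrable M (\<lambda>\<omega>. (\<Sum>i<n. f (X i \<omega>))\<^sup>2) \<and>
      expectation (\<lambda>\<omega>. (\<Sum>i<n. f (X i \<omega>))\<^sup>2) = n * (\<integral>x. (f x)\<^sup>2 \<partial>F)"
    by (rule second_moment_sum)
  then show "integrable M (\<lambda>\<omega>. (\<Sum>i<n. f (X i \<omega>))\<^sup>2)" 
    "expectation (\<lambda>\<omega>. (\<Sum>i<n. f (X i \<omega>))\<^sup>2) = n * (\<integral>x. (f x)\<^sup>2 \<partial>F)"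
    by simp_all
qed

lemma L1_average_square_integrable:
  fixes f :: "'b \<Rightarrow> real"
  assumes f: "f \<in> borel_measurable N" and f2: "integrable F (\<lambda>x. (f x)\<^sup>2)"
  shows "(\<lambda>n. expectation (\<lambda>\<omega>. \<bar>(1 / real n) * (\<Sum>i<n. f (X i \<omega>)) - integral\<^sup>L F f\<bar>)) \<longlonglongrightarrow> 0"
proof -
  interpret F: prob_space F by (rule prob_space_F)
  have fF: "f \<in> borel_measurable F" using f measurable_cong_sets [OF sets_F refl] by blast
  have f1: "integrable F f" by (rule F.square_integrable_imp_integrable [OF fF f2])
  define \<mu> where "\<mu> = integral\<^sup>L F f"
  define h where "h x = f x - \<mu>" for x
  have h: "h \<in> borel_measurable N" unfolding h_def by (intro borel_measurable_diff f borel_measurable_const)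
  have h2: "integrable F (\<lambda>x. (h x)\<^sup>2)" unfolding h_def power2_diff using f1 f2 by auto
  have mean: "integral\<^sup>L F h = 0" unfolding h_def using f1 by (simp add: \<mu>_def F.prob_space)
  define v where "v = (\<integral>x. (h x)\<^sup>2 \<partial>F)"
  have hX: "(\<lambda>\<omega>. \<Sum>i<n. h (X i \<omega>)) \<in> borel_measurable M" for n
    by (intro borel_measurable_sum measurable_compose [OF X_meas h])
  have le: "expectation (\<lambda>\<omega>. \<bar>(1 / real n) * (\<Sum>i<n. f (X i \<omega>)) - \<mu>\<bar>) \<le> sqrt v * (1 / sqrt n)" if n: "n > 0" for n
  proof -
    have "(1 / real n) * (\<Sum>i<n. f (X i \<omega>)) - \<mu> = (1 / real n) * (\<Sum>i<n. h (X i \<omega>))" for \<omega>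
      using n by (simp add: h_def sum_subtractf field_simps)
    then have "expectation (\<lambda>\<omega>. \<bar>(1 / real n) * (\<Sum>i<n. f (X i \<omega>)) - \<mu>\<bar>)
       = (1 / real n) * expectation (\<lambda>\<omega>. \<bar>\<Sum>i<n. h (X i \<omega>)\<bar>)"
      by (simp add: abs_mult)
    also have "\<dots> \<le> (1 / real n) * sqrt (n * v)"
      using expectation_abs_le_sqrt [OF hX mean_square_average(1) [OF h h2 mean, of n]]
        mean_square_average(2) [OF h h2 mean, of n] by (intro mult_left_mono) (auto simp: v_def)
    also have "\<dots> = sqrt v * (1 / sqrt n)" using n by (simp add: real_sqrt_mult field_simps)
    finally show ?thesis .
  qed
  have "(\<lambda>n. sqrt v * (1 / sqrt (real n))) \<longlonglongrightarrow> sqrt v * 0"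
    by (intro tendsto_intros tendsto_divide_0 [OF tendsto_const] filterlim_at_top_imp_at_infinity
        filterlim_compose [OF sqrt_at_top filterlim_real_sequentially])
  then have lim: "(\<lambda>n. sqrt v * (1 / sqrt (real n))) \<longlonglongrightarrow> 0" by simp
  show ?thesis
    unfolding \<mu>_def [symmetric]
  proof (rule tendsto_sandwich [OF _ _ tendsto_const lim])
    show "\<forall>\<^sub>F n in sequentially. expectation (\<lambda>\<omega>. \<bar>(1 / real n) * (\<Sum>i<n. f (X i \<omega>)) - \<mu>\<bar>) \<le> sqrt v * (1 / sqrt n)"
      using eventually_gt_at_top [of 0] by eventually_elim (rule le)
  qed simp
qed

text \<open>Truncation at level \<open>k\<close> makes the variable square integrable, so the
  variance bound applies to the truncated part. The truncated-off part has an \<open>L1\<close> norm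
  that does not depend on the index and tends to zero with \<open>k\<close>. A first moment thus
  suffices, as required for the entries of the derivative and of the outer products.\<close>

lemma L1_weak_law:
  fixes f :: "'b \<Rightarrow> real"
  assumes f: "f \<in> borel_measurable N" and f1: "integrable F f"
  shows "(\<lambda>n. expectation (\<lambda>\<omega>. \<bar>(1 / real n) * (\<Sum>i<n. f (X i \<omega>)) - integral\<^sup>L F f\<bar>)) \<longlonglongrightarrow> 0"
proof -
  interpret F: prob_space F by (rule prob_space_F)
  have fF: "f \<in> borel_measurable F" using f measurable_cong_sets [OF sets_F refl] by blast
  define t where "t k x = max (- real k) (min (real k) (f x))" for k x
  have t: "t k \<in> borel_measurable N" for k unfolding t_def by (intro borel_measurable_max borel_measurable_min f borel_measurable_const)
  have tF: "t k \<in> borel_measurable F" for k using t measurable_cong_sets [OF sets_F refl] by blast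
  have t_le: "\<bar>t k x\<bar> \<le> k" "\<bar>f x - t k x\<bar> \<le> \<bar>f x\<bar>" for k x by (auto simp: t_def)
  have t2: "integrable F (\<lambda>x. (t k x)\<^sup>2)" for k
    by (rule F.integrable_const_bound [where B = "(real k)\<^sup>2"])
      (use t_le(1) borel_measurable_power [OF tF] in \<open>auto intro!: always_eventually simp: abs_le_square_iff [symmetric]\<close>)
  have t1: "integrable F (t k)" for k
    by (rule F.integrable_const_bound [where B = "real k"]) (use t_le(1) tF in auto)
  define \<delta> where "\<delta> k = (\<integral>x. \<bar>f x - t k x\<bar> \<partial>F)" for k
  have "(\<lambda>k. \<integral>x. \<bar>f x - t k x\<bar> \<partial>F) \<longlonglongrightarrow> (\<integral>x. 0 \<partial>F)"
  proof (rule integral_dominated_convergence [where w = "\<lambda>x. \<bar>f x\<bar>"])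
    show "AE x in F. (\<lambda>k. \<bar>f x - t k x\<bar>) \<longlonglongrightarrow> 0"
    proof (intro always_eventually allI)
      fix x
      have "\<forall>\<^sub>F k in sequentially. \<bar>f x - t k x\<bar> = 0"
        by (rule eventually_sequentiallyI [of "nat \<lceil>\<bar>f x\<bar>\<rceil>"]) (auto simp: t_def nat_le_iff ceiling_le_iff)
      then show "(\<lambda>k. \<bar>f x - t k x\<bar>) \<longlonglongrightarrow> 0" by (rule tendsto_eventually)
    qed
  qed (use f1 t_le(2) fF tF in auto)
  then have \<delta>: "\<delta> \<longlonglongrightarrow> 0" by (simp add: \<delta>_def [abs_def])
  show ?thesis
  proof (rule LIMSEQ_I)
    fix e :: real assume e: "e > 0"
    obtain k where k: "\<delta> k < e / 4"
      using order_tendstoD(2) [OF \<delta>, of "e / 4"] e by (auto simp: eventually_sequentially)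
    obtain n0 where n0: "\<And>n. n \<ge> n0 \<Longrightarrow>
        expectation (\<lambda>\<omega>. \<bar>(1 / real n) * (\<Sum>i<n. t k (X i \<omega>)) - integral\<^sup>L F (t k)\<bar>) < e / 4"
      using order_tendstoD(2) [OF L1_average_square_integrable [OF t t2], of "e / 4"] e
      by (auto simp: eventually_sequentially)
    have "expectation (\<lambda>\<omega>. \<bar>(1 / real n) * (\<Sum>i<n. f (X i \<omega>)) - integral\<^sup>L F f\<bar>) < e" if n: "n \<ge> max n0 1" for n
    proof -
      have int: "integrable M (\<lambda>\<omega>. f (X i \<omega>))" "integrable M (\<lambda>\<omega>. t k (X i \<omega>))" for i
        using f1 t1 integral_X(2) [OF f] integral_X(2) [OF t] by auto
      have \<delta>_eq: "expectation (\<lambda>\<omega>. \<bar>f (X i \<omega>) - t k (X i \<omega>)\<bar>) = \<delta> k" for i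
        unfolding \<delta>_def by (rule integral_X(1)) (intro borel_measurable_abs borel_measurable_diff f t)
      have "expectation (\<lambda>\<omega>. \<bar>(1 / real n) * (\<Sum>i<n. f (X i \<omega>)) - integral\<^sup>L F f\<bar>)
        \<le> expectation (\<lambda>\<omega>. (1 / real n) * (\<Sum>i<n. \<bar>f (X i \<omega>) - t k (X i \<omega>)\<bar>)
            + \<bar>(1 / real n) * (\<Sum>i<n. t k (X i \<omega>)) - integral\<^sup>L F (t k)\<bar> + \<bar>integral\<^sup>L F (t k) - integral\<^sup>L F f\<bar>)"
      proof (rule integral_mono)
        fix \<omega>
        have "\<bar>(1 / real n) * (\<Sum>i<n. f (X i \<omega>) - t k (X i \<omega>))\<bar> \<le> (1 / real n) * (\<Sum>i<n. \<bar>f (X i \<omega>) - t k (X i \<omega>)\<bar>)"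
          by (auto simp: abs_mult intro!: divide_right_mono)
        moreover have "(1 / real n) * (\<Sum>i<n. f (X i \<omega>)) - integral\<^sup>L F f
           = (1 / real n) * (\<Sum>i<n. f (X i \<omega>) - t k (X i \<omega>)) +
             ((1 / real n) * (\<Sum>i<n. t k (X i \<omega>)) - integral\<^sup>L F (t k)) + (integral\<^sup>L F (t k) - integral\<^sup>L F f)"
          by (simp add: sum_subtractf right_diff_distrib)
        ultimately show "\<bar>(1 / real n) * (\<Sum>i<n. f (X i \<omega>)) - integral\<^sup>L F f\<bar>
          \<le> (1 / real n) * (\<Sum>i<n. \<bar>f (X i \<omega>) - t k (X i \<omega>)\<bar>)
            + \<bar>(1 / real n) * (\<Sum>i<n. t k (X i \<omega>)) - integral\<^sup>L F (t k)\<bar> + \<bar>integral\<^sup>L F (t k) - integral\<^sup>L F f\<bar>"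
          by linarith
      qed (use int in auto)
      also have "\<dots> = (1 / real n) * (\<Sum>i<n. \<delta> k)
          + expectation (\<lambda>\<omega>. \<bar>(1 / real n) * (\<Sum>i<n. t k (X i \<omega>)) - integral\<^sup>L F (t k)\<bar>)
          + \<bar>integral\<^sup>L F (t k) - integral\<^sup>L F f\<bar>"
        using int by (simp add: \<delta>_eq prob_space)
      also have "(1 / real n) * (\<Sum>i<n. \<delta> k) = \<delta> k" using n by simp
      also have "\<bar>integral\<^sup>L F (t k) - integral\<^sup>L F f\<bar> \<le> \<delta> k"
      proof -
        have "\<bar>integral\<^sup>L F (t k) - integral\<^sup>L F f\<bar> = \<bar>integral\<^sup>L F (\<lambda>x. f x - t k x)\<bar>"
          using f1 t1 by (simp add: abs_minus_commute)
        also have "\<dots> \<le> \<delta> k" unfolding \<delta>_def by (rule integral_abs_bound)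
        finally show ?thesis .
      qed
      finally show ?thesis using k n0 [of n] n e by simp
    qed
    then show "\<exists>no. \<forall>n\<ge>no. norm (expectation (\<lambda>\<omega>. \<bar>(1 / real n) * (\<Sum>i<n. f (X i \<omega>)) - integral\<^sup>L F f\<bar>) - 0) < e"
      by (intro exI [of _ "max n0 1"]) auto
  qed
qed

lemma weak_law_wp1:
  fixes f :: "'b \<Rightarrow> real"
  assumes f: "f \<in> borel_measurable N" and f1: "integrable F f"
  shows "((\<lambda>\<xi>. (1 / real (fst \<xi>)) * (\<Sum>i<fst \<xi>. f (X i (snd \<xi>)))) \<longlongrightarrow> integral\<^sup>L F f) (wp1 M)"
proof -
  have "integrable M (\<lambda>\<omega>. (1 / real n) * (\<Sum>i<n. f (X i \<omega>)) - integral\<^sup>L F f)" for n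
    using f f1 by (auto simp: integral_X)
  from tendsto_wp1_zeroI [OF this L1_weak_law [OF f f1]] show ?thesis
    by (subst Lim_null)
qed

lemma weak_law_matrix_wp1:
  fixes f :: "'b \<Rightarrow> real ^ 'n ^ 'm"
  assumes f: "f \<in> borel_measurable N" and f1: "integrable F f"
  shows "((\<lambda>\<xi>. (1 / real (fst \<xi>)) *\<^sub>R (\<Sum>i<fst \<xi>. f (X i (snd \<xi>)))) \<longlongrightarrow> integral\<^sup>L F f) (wp1 M)"
proof (intro vec_tendstoI)
  fix i j
  have bl: "bounded_linear (\<lambda>A :: real ^ 'n ^ 'm. A $ i $ j)"
    using bounded_linear_compose [OF bounded_linear_vec_nth bounded_linear_vec_nth] .
  have m: "(\<lambda>x. f x $ i $ j) \<in> borel_measurable N"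
    using borel_measurable_continuous_on [OF linear_continuous_on [OF bl] f] .
  have "integrable F (\<lambda>x. f x $ i $ j)" using integrable_bounded_linear [OF bl f1] .
  from weak_law_wp1 [OF m this]
  show "((\<lambda>\<xi>. ((1 / real (fst \<xi>)) *\<^sub>R (\<Sum>i<fst \<xi>. f (X i (snd \<xi>)))) $ i $ j) \<longlongrightarrow> integral\<^sup>L F f $ i $ j) (wp1 M)"
    using integral_bounded_linear [OF bl f1] by simp
qed

end

end

section \<open>Limit laws from Laplace transforms\<close>

lemma continuous_cts_step: "a < b \<Longrightarrow> continuous_on S (cts_step a b)"
  using uniformly_continuous_imp_continuous [OF cts_step_uniformly_continuous] continuous_on_subset by blast

lemma cts_step_bounds: "a < b \<Longrightarrow> 0 \<le> cts_step a b x \<and> cts_step a b x \<le> 1"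
  by (auto simp: cts_step_def)

lemma cts_step_measurable: "a < b \<Longrightarrow> cts_step a b \<in> borel_measurable borel"
  by (rule borel_measurable_continuous_onI [OF continuous_cts_step])

text \<open>After the substitution \<open>u = exp (- t)\<close> a step function of compact support becomes a
  continuous function on the unit interval, so Weierstrass approximation applies.\<close>

lemma cts_step_polynomial_approx:
  assumes ab: "a < b" and e: "0 < e"
  shows "\<exists>m p. \<forall>t\<ge>0. \<bar>cts_step a b t - (\<Sum>k\<le>(m::nat). p k * exp (- real k * t))\<bar> < e"
proof -
  \<comment> \<open>The cut-off at \<open>exp (- b)\<close> keeps the logarithm away from zero and
    costs nothing, since the step function vanishes from \<open>b\<close> on.\<close>
  define h where "h u = cts_step a b (- ln (max u (exp (- b))))" for u
  have "continuous_on {0..1} h"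
    unfolding h_def
    by (intro continuous_on_compose2 [OF continuous_cts_step [OF ab, of UNIV]] continuous_intros)
      (auto simp: max_def)
  from Stone_Weierstrass_real_polynomial_function [OF compact_Icc this e]
  obtain g where g: "real_polynomial_function g" "\<And>u. u \<in> {0..1} \<Longrightarrow> \<bar>h u - g u\<bar> < e" by auto
  obtain p m where gp: "g = (\<lambda>u. \<Sum>k\<le>m. p k * u ^ k)" using g(1) real_polynomial_function_iff_sum by metis
  have "\<bar>cts_step a b t - (\<Sum>k\<le>m. p k * exp (- real k * t))\<bar> < e" if "t \<ge> 0" for t
  proof -
    have "max (exp (- t)) (exp (- b)) = exp (- min t b)" by (auto simp: max_def min_def)
    then have "h (exp (- t)) = cts_step a b t" using ab by (auto simp: h_def cts_step_def min_def)
    moreover have "g (exp (- t)) = (\<Sum>k\<le>m. p k * exp (- real k * t))"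
      by (simp add: gp exp_of_nat_mult [symmetric])
    ultimately show ?thesis using g(2) [of "exp (- t)"] that by simp
  qed
  then show ?thesis by blast
qed

text \<open>The exponential approximation is uniform on the whole half line, so the convergence
  passes to step functions without a separate tightness argument. The term with \<open>k = 0\<close>
  is the total mass, equal to one on both sides.\<close>

lemma cts_step_conv_of_laplace:
  fixes Y :: "nat \<Rightarrow> 'a \<Rightarrow> real" and Z :: "'b \<Rightarrow> real"
  assumes "prob_space M" "prob_space N"
    and Y: "\<And>n. Y n \<in> borel_measurable M" "\<And>n \<omega>. 0 \<le> Y n \<omega>"
    and Z: "Z \<in> borel_measurable N" "\<And>z. 0 \<le> Z z"
    and lap: "\<And>k::nat. k > 0 \<Longrightarrow> (\<lambda>n. \<integral>\<omega>. exp (- real k * Y n \<omega>) \<partial>M) \<longlonglongrightarrow> (\<integral>z. exp (- real k * Z z) \<partial>N)"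
    and ab: "a < b"
  shows "(\<lambda>n. \<integral>\<omega>. cts_step a b (Y n \<omega>) \<partial>M) \<longlonglongrightarrow> (\<integral>z. cts_step a b (Z z) \<partial>N)"
proof -
  interpret M: prob_space M by fact
  interpret N: prob_space N by fact
  have iM: "integrable M (\<lambda>\<omega>. exp (- real k * Y n \<omega>))" for k n
    using Y by (intro M.integrable_const_bound [where B = 1]) auto
  have iN: "integrable N (\<lambda>z. exp (- real k * Z z))" for k
    using Z by (intro N.integrable_const_bound [where B = 1]) auto
  have cM: "integrable M (\<lambda>\<omega>. cts_step a b (Y n \<omega>))" for n
    using measurable_compose [OF Y(1) cts_step_measurable [OF ab]] cts_step_bounds [OF ab]
    by (intro M.integrable_const_bound [where B = 1]) auto
  have cN: "integrable N (\<lambda>z. cts_step a b (Z z))"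
    using measurable_compose [OF Z(1) cts_step_measurable [OF ab]] cts_step_bounds [OF ab]
    by (intro N.integrable_const_bound [where B = 1]) auto
  show ?thesis
  proof (rule LIMSEQ_I)
    fix e :: real assume e: "0 < e"
    obtain m p where p: "\<And>t. t \<ge> 0 \<Longrightarrow> \<bar>cts_step a b t - (\<Sum>k\<le>(m::nat). p k * exp (- real k * t))\<bar> < e / 3"
      using cts_step_polynomial_approx [OF ab, of "e / 3"] e by auto
    have "(\<lambda>n. \<Sum>k\<le>m. p k * (\<integral>\<omega>. exp (- real k * Y n \<omega>) \<partial>M)) \<longlonglongrightarrow> (\<Sum>k\<le>m. p k * (\<integral>z. exp (- real k * Z z) \<partial>N))"
    proof (intro tendsto_intros)
      fix k :: nat
      show "(\<lambda>n. \<integral>\<omega>. exp (- real k * Y n \<omega>) \<partial>M) \<longlonglongrightarrow> (\<integral>z. exp (- real k * Z z) \<partial>N)"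
        using lap [of k] by (cases "k = 0") (auto simp: M.prob_space N.prob_space)
    qed
    from LIMSEQ_D [OF this, of "e / 3"] e obtain n0 where n0: "\<And>n. n \<ge> n0 \<Longrightarrow>
       \<bar>(\<Sum>k\<le>m. p k * (\<integral>\<omega>. exp (- real k * Y n \<omega>) \<partial>M)) - (\<Sum>k\<le>m. p k * (\<integral>z. exp (- real k * Z z) \<partial>N))\<bar> < e / 3"
      by auto
    have 1: "\<bar>(\<integral>\<omega>. cts_step a b (Y n \<omega>) \<partial>M) - (\<Sum>k\<le>m. p k * (\<integral>\<omega>. exp (- real k * Y n \<omega>) \<partial>M))\<bar> \<le> e / 3" for n
    proof -
      have "(\<integral>\<omega>. cts_step a b (Y n \<omega>) \<partial>M) - (\<Sum>k\<le>m. p k * (\<integral>\<omega>. exp (- real k * Y n \<omega>) \<partial>M))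
         = (\<integral>\<omega>. cts_step a b (Y n \<omega>) - (\<Sum>k\<le>m. p k * exp (- real k * Y n \<omega>)) \<partial>M)"
        using iM cM by simp
      also have "\<bar>\<dots>\<bar> \<le> (\<integral>\<omega>. \<bar>cts_step a b (Y n \<omega>) - (\<Sum>k\<le>m. p k * exp (- real k * Y n \<omega>))\<bar> \<partial>M)"
        by (rule integral_abs_bound)
      also have "\<dots> \<le> (\<integral>\<omega>. e / 3 \<partial>M)"
        using iM cM p Y(2) by (intro integral_mono) (auto intro: less_imp_le)
      finally show ?thesis by (simp add: M.prob_space)
    qed
    have 2: "\<bar>(\<integral>z. cts_step a b (Z z) \<partial>N) - (\<Sum>k\<le>m. p k * (\<integral>z. exp (- real k * Z z) \<partial>N))\<bar> \<le> e / 3"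
    proof -
      have "(\<integral>z. cts_step a b (Z z) \<partial>N) - (\<Sum>k\<le>m. p k * (\<integral>z. exp (- real k * Z z) \<partial>N))
         = (\<integral>z. cts_step a b (Z z) - (\<Sum>k\<le>m. p k * exp (- real k * Z z)) \<partial>N)"
        using iN cN by simp
      also have "\<bar>\<dots>\<bar> \<le> (\<integral>z. \<bar>cts_step a b (Z z) - (\<Sum>k\<le>m. p k * exp (- real k * Z z))\<bar> \<partial>N)"
        by (rule integral_abs_bound)
      also have "\<dots> \<le> (\<integral>z. e / 3 \<partial>N)"
        using iN cN p Z(2) by (intro integral_mono) (auto intro: less_imp_le)
      finally show ?thesis by (simp add: N.prob_space)
    qed
    have "norm ((\<integral>\<omega>. cts_step a b (Y n \<omega>) \<partial>M) - (\<integral>z. cts_step a b (Z z) \<partial>N)) < e" if "n \<ge> n0" for n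
      using 1 [of n] 2 n0 [OF that] unfolding real_norm_def by linarith
    then show "\<exists>no. \<forall>n\<ge>no. norm ((\<integral>\<omega>. cts_step a b (Y n \<omega>) \<partial>M) - (\<integral>z. cts_step a b (Z z) \<partial>N)) < e"
      by blast
  qed
qed

section \<open>Sums of squares of normalized sums\<close>

abbreviation std_normal_prod :: "nat \<Rightarrow> (nat \<Rightarrow> real) measure" where
  "std_normal_prod q \<equiv> (\<Pi>\<^sub>M i\<in>{..<q}. std_normal_distribution)"

lemma product_prob_space_std_normal: "product_prob_space (\<lambda>_::nat. std_normal_distribution)"
  by (intro product_prob_spaceI prob_space_normal_density) simp

lemma prob_space_std_normal_prod: "prob_space (std_normal_prod q)"
  by (intro prob_space_PiM prob_space_normal_density) simp

lemma borel_measurable_iexp: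
  assumes "g \<in> borel_measurable M"
  shows "(\<lambda>x. iexp (g x)) \<in> borel_measurable M"
  by (rule measurable_compose [OF assms borel_measurable_continuous_onI]) (intro continuous_intros)

text \<open>The Gaussian is its own Fourier transform, which linearizes the exponent.\<close>

lemma exp_sum_squares_eq_integral:
  fixes y :: "nat \<Rightarrow> real"
  assumes s: "s \<ge> 0"
  shows "complex_of_real (exp (- s * (\<Sum>i<q. (y i)\<^sup>2))) =
     (\<integral>w. iexp (sqrt (2 * s) * (\<Sum>i<q. w i * y i)) \<partial>std_normal_prod q)"
proof -
  interpret SN: prob_space std_normal_distribution by (intro prob_space_normal_density) simp
  interpret product_prob_space "\<lambda>_::nat. std_normal_distribution" by (rule product_prob_space_std_normal)
  have "(\<integral>w. iexp (sqrt (2 * s) * (\<Sum>i<q. w i * y i)) \<partial>std_normal_prod q)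
     = (\<integral>w. (\<Prod>i<q. iexp (sqrt (2 * s) * y i * w i)) \<partial>std_normal_prod q)"
    by (intro Bochner_Integration.integral_cong refl)
      (simp add: exp_sum [symmetric] sum_distrib_left mult_ac)
  also have "\<dots> = (\<Prod>i<q. \<integral>w. iexp (sqrt (2 * s) * y i * w) \<partial>std_normal_distribution)"
    by (rule product_integral_prod) (auto intro!: SN.integrable_const_bound [where B = 1])
  also have "\<dots> = (\<Prod>i<q. complex_of_real (exp (- s * (y i)\<^sup>2)))"
  proof (intro prod.cong refl)
    fix i
    \<comment> \<open>The factor \<open>sqrt (2 * s)\<close> cancels the \<open>1 / 2\<close> in the
      exponent of the Gaussian characteristic function.\<close>
    have "(\<integral>w. iexp (sqrt (2 * s) * y i * w) \<partial>std_normal_distribution) = char std_normal_distribution (sqrt (2 * s) * y i)"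
      by (simp add: char_def)
    also have "\<dots> = complex_of_real (exp (- s * (y i)\<^sup>2))"
      using s by (simp add: char_std_normal_distribution power_mult_distrib)
    finally show "(\<integral>w. iexp (sqrt (2 * s) * y i * w) \<partial>std_normal_distribution) = complex_of_real (exp (- s * (y i)\<^sup>2))" .
  qed
  also have "\<dots> = complex_of_real (exp (- s * (\<Sum>i<q. (y i)\<^sup>2)))"
    by (simp add: exp_sum [symmetric] of_real_prod [symmetric] sum_distrib_left sum_negf del: of_real_prod)
  finally show ?thesis by simp
qed

context prob_space
begin

context
  fixes X :: "nat \<Rightarrow> 'a \<Rightarrow> 'b" and N F :: "'b measure"
  assumes indep: "indep_vars (\<lambda>_. N) X UNIV" and distr: "\<And>i. distr M N (X i) = F"
begin

text \<open>If the variance vanishes, the central limit theorem does not apply; the sums are then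
  almost surely zero and both sides equal one. This case does occur below, for the zero direction in
  the Gaussian average over all directions \<open>w\<close>.\<close>

lemma char_normalized_sum_conv:
  fixes h :: "'b \<Rightarrow> real"
  assumes h: "h \<in> borel_measurable N" and h2: "integrable F (\<lambda>x. (h x)\<^sup>2)" and mean: "integral\<^sup>L F h = 0"
  shows "(\<lambda>n. expectation (\<lambda>\<omega>. iexp (u * ((1 / sqrt (real n)) * (\<Sum>k<n. h (X k \<omega>))))))
     \<longlonglongrightarrow> complex_of_real (exp (- u\<^sup>2 * (\<integral>x. (h x)\<^sup>2 \<partial>F) / 2))"
proof -
  define v where "v = (\<integral>x. (h x)\<^sup>2 \<partial>F)"
  have hX: "(\<lambda>\<omega>. h (X k \<omega>)) \<in> borel_measurable M" for k
    by (rule measurable_compose [OF X_meas [OF indep distr] h])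
  have hS: "(\<lambda>\<omega>. \<Sum>k<n. h (X k \<omega>)) \<in> borel_measurable M" for n by (intro borel_measurable_sum hX)
  show ?thesis
  proof (cases "v = 0")
    case True
    have "expectation (\<lambda>\<omega>. iexp (u * ((1 / sqrt (real n)) * (\<Sum>k<n. h (X k \<omega>))))) = 1" for n
    proof -
      have "AE \<omega> in M. (\<Sum>k<n. h (X k \<omega>))\<^sup>2 = 0"
        using mean_square_average [OF indep distr h h2 mean, of n] True
        by (subst integral_nonneg_eq_0_iff_AE [symmetric]) (auto simp: v_def)
      have "expectation (\<lambda>\<omega>. iexp (u * ((1 / sqrt (real n)) * (\<Sum>k<n. h (X k \<omega>))))) = expectation (\<lambda>\<omega>. 1)"
      proof (intro integral_cong_AE borel_measurable_iexp borel_measurable_times borel_measurable_const hS)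
        show "AE \<omega> in M. iexp (u * ((1 / sqrt (real n)) * (\<Sum>k<n. h (X k \<omega>)))) = 1"
          using \<open>AE \<omega> in M. (\<Sum>k<n. h (X k \<omega>))\<^sup>2 = 0\<close>
        proof eventually_elim
          case (elim \<omega>)
          then have "(\<Sum>k<n. h (X k \<omega>)) = 0" by simp
          then show ?case by (simp only: mult_zero_right of_real_0 exp_zero)
        qed
      qed
      then show ?thesis by (simp add: prob_space)
    qed
    then show ?thesis using True by (simp add: v_def)
  next
    case False
    then have v: "v > 0" by (simp add: v_def less_le)
    define \<sigma> where "\<sigma> = sqrt v"
    have \<sigma>: "\<sigma> > 0" "\<sigma>\<^sup>2 = v" using v by (auto simp: \<sigma>_def)
    have E: "expectation (\<lambda>\<omega>. h (X k \<omega>)) = 0" for k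
      using integral_X(1) [OF indep distr h] mean by simp
    have h2N: "(\<lambda>x. (h x)\<^sup>2) \<in> borel_measurable N" using h by simp
    have "weak_conv_m (\<lambda>n. distr M borel (\<lambda>\<omega>. (\<Sum>k<n. h (X k \<omega>)) / sqrt (real n * \<sigma>\<^sup>2))) std_normal_distribution"
    proof (rule central_limit_theorem_zero_mean [where \<mu> = "distr F borel h"])
      show "indep_vars (\<lambda>_. borel) (\<lambda>i \<omega>. h (X i \<omega>)) UNIV"
        by (rule indep_vars_compose2 [OF indep]) (use h in auto)
      show "distr M borel (\<lambda>\<omega>. h (X n \<omega>)) = distr F borel h" for n
        unfolding distr [of n, symmetric] using h X_meas [OF indep distr]
        by (subst distr_distr) (auto simp: comp_def)
      show "variance (\<lambda>\<omega>. h (X n \<omega>)) = \<sigma>\<^sup>2" for n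
        using integral_X(1) [OF indep distr h2N, of n] by (simp add: E \<sigma> v_def)
      show "integrable M (\<lambda>\<omega>. (h (X n \<omega>))\<^sup>2)" for n
        using integral_X(2) [OF indep distr h2N, of n] h2 by simp
    qed (use E \<sigma> in auto)
    \<comment> \<open>Evaluation at \<open>u * \<sigma>\<close> undoes the standardization by
      \<open>\<sigma>\<close>.\<close>
    then have "(\<lambda>n. char (distr M borel (\<lambda>\<omega>. (\<Sum>k<n. h (X k \<omega>)) / sqrt (real n * \<sigma>\<^sup>2))) (u * \<sigma>))
       \<longlonglongrightarrow> char std_normal_distribution (u * \<sigma>)"
      using hS by (intro levy_continuity1 real_distribution_distr real_dist_normal_dist) auto
    moreover have "char std_normal_distribution (u * \<sigma>) = complex_of_real (exp (- u\<^sup>2 * v / 2))"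
      using \<sigma> by (simp add: char_std_normal_distribution power_mult_distrib)
    moreover have "char (distr M borel (\<lambda>\<omega>. (\<Sum>k<n. h (X k \<omega>)) / sqrt (real n * \<sigma>\<^sup>2))) (u * \<sigma>)
        = expectation (\<lambda>\<omega>. iexp (u * ((1 / sqrt (real n)) * (\<Sum>k<n. h (X k \<omega>)))))" for n
    proof -
      have "char (distr M borel (\<lambda>\<omega>. (\<Sum>k<n. h (X k \<omega>)) / sqrt (real n * \<sigma>\<^sup>2))) (u * \<sigma>)
        = expectation (\<lambda>\<omega>. iexp (u * \<sigma> * ((\<Sum>k<n. h (X k \<omega>)) / sqrt (real n * \<sigma>\<^sup>2))))"
        unfolding char_def using hS by (subst integral_distr) auto
      also have "\<dots> = expectation (\<lambda>\<omega>. iexp (u * ((1 / sqrt (real n)) * (\<Sum>k<n. h (X k \<omega>)))))"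
      proof -
        have "u * \<sigma> * (S / sqrt (real n * \<sigma>\<^sup>2)) = u * ((1 / sqrt (real n)) * S)" for S
          using \<sigma>(1) by (simp add: real_sqrt_mult)
        then show ?thesis by (simp only:)
      qed
      finally show ?thesis .
    qed
    ultimately show ?thesis by (simp add: v_def)
  qed
qed

context
  fixes f :: "nat \<Rightarrow> 'b \<Rightarrow> real" and q :: nat
  assumes f: "\<And>i. f i \<in> borel_measurable N" and f2: "\<And>i. integrable F (\<lambda>x. (f i x)\<^sup>2)"
    and mean: "\<And>i. integral\<^sup>L F (f i) = 0"
    and cov: "\<And>i j. i < q \<Longrightarrow> j < q \<Longrightarrow> (\<integral>x. f i x * f j x \<partial>F) = (if i = j then 1 else 0)"
begin

text \<open>Fubini moves the Gaussian average outside. For a fixed direction \<open>w\<close> the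
  inner expectation is a characteristic function of a one-dimensional normalized sum, whose variance
  is \<open>\<Sum>i<q. (w i)\<^sup>2\<close> by orthonormality, and dominated convergence with bound
  one finishes. The Gaussian plays a double role: its average of the limits is already the Laplace
  transform of the chi-square law.\<close>

lemma laplace_sum_squares_conv:
  assumes s: "s \<ge> 0"
  defines "Y n \<omega> \<equiv> (\<Sum>i<q. ((1 / sqrt (real n)) * (\<Sum>k<n. f i (X k \<omega>)))\<^sup>2)"
  shows "(\<lambda>n. expectation (\<lambda>\<omega>. exp (- s * Y n \<omega>))) \<longlonglongrightarrow> (\<integral>w. exp (- s * (\<Sum>i<q. (w i)\<^sup>2)) \<partial>std_normal_prod q)"
proof -
  define P where "P = std_normal_prod q"
  interpret P: prob_space P unfolding P_def by (rule prob_space_std_normal_prod)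
  interpret PM: pair_sigma_finite M P ..
  interpret F: prob_space F by (rule prob_space_F [OF indep distr])
  have fF: "f i \<in> borel_measurable F" for i
    using f measurable_cong_sets [OF sets_F [OF indep distr] refl] by blast
  have f1: "integrable F (f i)" for i by (rule F.square_integrable_imp_integrable [OF fF f2])
  have ff: "integrable F (\<lambda>x. f i x * f j x)" for i j
  proof (rule Bochner_Integration.integrable_bound [OF Bochner_Integration.integrable_add [OF f2 [of i] f2 [of j]]])
    show "AE x in F. norm (f i x * f j x) \<le> norm ((f i x)\<^sup>2 + (f j x)\<^sup>2)"
    proof (intro always_eventually allI)
      fix x
      have "2 * \<bar>f i x * f j x\<bar> \<le> (f i x)\<^sup>2 + (f j x)\<^sup>2"
        using sum_squares_bound [of "\<bar>f i x\<bar>" "\<bar>f j x\<bar>"] by (simp add: abs_mult)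
      then show "norm (f i x * f j x) \<le> norm ((f i x)\<^sup>2 + (f j x)\<^sup>2)" by simp
    qed
  qed (use fF in simp)
  define y where "y n i \<omega> = (1 / sqrt (real n)) * (\<Sum>k<n. f i (X k \<omega>))" for n i \<omega>
  have y: "y n i \<in> borel_measurable M" for n i
    unfolding y_def using measurable_compose [OF X_meas [OF indep distr] f] by (intro borel_measurable_times borel_measurable_sum borel_measurable_const)
  have w: "(\<lambda>w. w i) \<in> borel_measurable P" if "i < q" for i
    unfolding P_def using measurable_component_singleton [of i "{..<q}" "\<lambda>_. std_normal_distribution"] that by simp
  define u where "u = sqrt (2 * s)"
  define J where "J n w = expectation (\<lambda>\<omega>. iexp (u * (\<Sum>i<q. w i * y n i \<omega>)))" for n w
  have meas: "(\<lambda>(\<omega>, w). iexp (u * (\<Sum>i<q. w i * y n i \<omega>))) \<in> borel_measurable (M \<Otimes>\<^sub>M P)" for n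
  proof -
    have "(\<lambda>z. y n i (fst z)) \<in> borel_measurable (M \<Otimes>\<^sub>M P)" for i
      by (rule measurable_compose [OF measurable_fst y])
    moreover have "(\<lambda>z. snd z i) \<in> borel_measurable (M \<Otimes>\<^sub>M P)" if "i < q" for i
      by (rule measurable_compose [OF measurable_snd w [OF that]])
    ultimately have "(\<lambda>z. \<Sum>i<q. snd z i * y n i (fst z)) \<in> borel_measurable (M \<Otimes>\<^sub>M P)"
      by (intro borel_measurable_sum borel_measurable_times) auto
    then show ?thesis unfolding case_prod_beta
      by (intro borel_measurable_iexp borel_measurable_times borel_measurable_const)
  qed
  have int: "integrable (M \<Otimes>\<^sub>M P) (\<lambda>(\<omega>, w). iexp (u * (\<Sum>i<q. w i * y n i \<omega>)))" for n
  proof -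
    interpret MP: prob_space "M \<Otimes>\<^sub>M P"
      by (rule prob_space_pair) unfold_locales
    show ?thesis by (rule MP.integrable_const_bound [where B = 1, OF _ meas]) (auto simp: split_beta)
  qed
  have eq: "complex_of_real (expectation (\<lambda>\<omega>. exp (- s * Y n \<omega>))) = (\<integral>w. J n w \<partial>P)" for n
  proof -
    have "complex_of_real (expectation (\<lambda>\<omega>. exp (- s * Y n \<omega>))) = expectation (\<lambda>\<omega>. complex_of_real (exp (- s * Y n \<omega>)))"
      by simp
    also have "\<dots> = expectation (\<lambda>\<omega>. \<integral>w. iexp (u * (\<Sum>i<q. w i * y n i \<omega>)) \<partial>P)"
      unfolding Y_def y_def [symmetric] exp_sum_squares_eq_integral [OF s] u_def P_def ..
    also have "\<dots> = (\<integral>w. J n w \<partial>P)"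
      unfolding J_def by (rule PM.Fubini_integral [OF int, symmetric])
    finally show ?thesis .
  qed
  have Jlim: "(\<lambda>n. J n w) \<longlonglongrightarrow> complex_of_real (exp (- s * (\<Sum>i<q. (w i)\<^sup>2)))" for w
  proof -
    define h where "h x = (\<Sum>i<q. w i * f i x)" for x
    have h: "h \<in> borel_measurable N" unfolding h_def using f by simp
    have hh: "(h x)\<^sup>2 = (\<Sum>i<q. \<Sum>j<q. w i * w j * (f i x * f j x))" for x
      by (simp add: h_def power2_eq_square sum_product mult_ac)
    have h2: "integrable F (\<lambda>x. (h x)\<^sup>2)" unfolding hh using ff by auto
    have "(\<integral>x. (h x)\<^sup>2 \<partial>F) = (\<Sum>i<q. \<Sum>j<q. w i * w j * (\<integral>x. f i x * f j x \<partial>F))"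
      unfolding hh using ff by simp
    also have "\<dots> = (\<Sum>i<q. \<Sum>j<q. if i = j then w i * w j else 0)"
      using cov by (intro sum.cong refl) auto
    also have "\<dots> = (\<Sum>i<q. (w i)\<^sup>2)" by (simp add: power2_eq_square)
    finally have v: "(\<integral>x. (h x)\<^sup>2 \<partial>F) = (\<Sum>i<q. (w i)\<^sup>2)" .
    have "integral\<^sup>L F h = 0" unfolding h_def using f1 mean by simp
    from char_normalized_sum_conv [OF h h2 this, of u]
    have "(\<lambda>n. expectation (\<lambda>\<omega>. iexp (u * ((1 / sqrt (real n)) * (\<Sum>k<n. h (X k \<omega>))))))
        \<longlonglongrightarrow> complex_of_real (exp (- s * (\<Sum>i<q. (w i)\<^sup>2)))"
      using s by (simp add: v u_def)
    moreover have "(1 / sqrt (real n)) * (\<Sum>k<n. h (X k \<omega>)) = (\<Sum>i<q. w i * y n i \<omega>)" for n \<omega>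
      unfolding h_def y_def by (subst sum.swap) (simp add: sum_distrib_left sum_divide_distrib mult_ac)
    ultimately show ?thesis by (simp only: J_def)
  qed
  have "(\<lambda>n. \<integral>w. J n w \<partial>P) \<longlonglongrightarrow> (\<integral>w. complex_of_real (exp (- s * (\<Sum>i<q. (w i)\<^sup>2))) \<partial>P)"
  proof (rule integral_dominated_convergence [where w = "\<lambda>_. 1"])
    show "J n \<in> borel_measurable P" for n
      unfolding J_def using measurable_pair_swap [OF meas [of n]]
      by (intro borel_measurable_lebesgue_integral) (simp only: case_prod_beta fst_conv snd_conv)
    show "(\<lambda>w. complex_of_real (exp (- s * (\<Sum>i<q. (w i)\<^sup>2)))) \<in> borel_measurable P"
    proof (intro measurable_compose [OF _ borel_measurable_of_real]
        measurable_compose [OF _ borel_measurable_exp])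
      show "(\<lambda>w. - s * (\<Sum>i<q. (w i)\<^sup>2)) \<in> borel_measurable P"
        using w by (intro borel_measurable_times borel_measurable_const borel_measurable_sum borel_measurable_power) auto
    qed
    show "AE w in P. norm (J n w) \<le> 1" for n
    proof (intro always_eventually allI)
      fix w
      have "norm (J n w) \<le> expectation (\<lambda>\<omega>. norm (iexp (u * (\<Sum>i<q. w i * y n i \<omega>))))"
        unfolding J_def by (rule integral_norm_bound)
      then show "norm (J n w) \<le> 1" by (simp add: prob_space)
    qed
  qed (use Jlim in auto)
  then have "(\<lambda>n. complex_of_real (expectation (\<lambda>\<omega>. exp (- s * Y n \<omega>))))
      \<longlonglongrightarrow> complex_of_real (\<integral>w. exp (- s * (\<Sum>i<q. (w i)\<^sup>2)) \<partial>P)"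
    by (simp only: eq integral_complex_of_real)
  then show ?thesis unfolding P_def tendsto_of_real_iff .
qed

end

end

end

section \<open>Boundedness in probability\<close>

lemma prod_Basis_cart: "(\<Prod>b\<in>(Basis :: (real ^ 'n) set). f (z \<bullet> b)) = (\<Prod>i\<in>UNIV. f (z $ i))"
proof -
  have B: "(Basis :: (real ^ 'n) set) = range (\<lambda>i. axis i 1)" by (auto simp: Basis_vec_def)
  have "inj (\<lambda>i::'n. axis i (1::real))" by (auto simp: inj_on_def axis_eq_axis)
  then show ?thesis unfolding B by (subst prod.reindex) (auto simp: inner_axis)
qed

lemma prob_space_std_normal_vec: "prob_space (std_normal_vec :: (real ^ 'n) measure)"
proof
  have m: "(\<lambda>z :: real ^ 'n. ennreal (\<Prod>i\<in>UNIV. std_normal_density (z $ i))) \<in> borel_measurable lborel"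
    by (intro measurable_compose [OF _ measurable_ennreal] borel_measurable_prod
        measurable_compose [OF _ borel_measurable_normal_density])
      (simp add: borel_measurable_continuous_onI continuous_on_component)
  have "emeasure std_normal_vec (space (std_normal_vec :: (real ^ 'n) measure))
      = (\<integral>\<^sup>+z. ennreal (\<Prod>i\<in>UNIV. std_normal_density ((z :: real ^ 'n) $ i)) \<partial>lborel)"
    unfolding std_normal_vec_def using m by (simp add: emeasure_density)
  also have "\<dots> = (\<integral>\<^sup>+z. (\<Prod>b\<in>(Basis :: (real ^ 'n) set). ennreal (std_normal_density (z \<bullet> b))) \<partial>lborel)"
    by (simp add: prod_Basis_cart prod_ennreal)
  also have "\<dots> = (\<Prod>b\<in>(Basis :: (real ^ 'n) set). \<integral>\<^sup>+y. ennreal (std_normal_density y) \<partial>lborel)"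
    by (rule nn_integral_lborel_prod) auto
  also have "(\<integral>\<^sup>+y. ennreal (std_normal_density y) \<partial>lborel) = 1"
    using prob_space.emeasure_space_1 [OF prob_space_normal_density [of 1 0]]
    by (simp add: emeasure_density)
  finally show "emeasure std_normal_vec (space (std_normal_vec :: (real ^ 'n) measure)) = 1" by simp
qed

text \<open>Whichever matrix \<open>SOME\<close> returns, the law is the image of a probability
  measure under an affine map, so positive semidefiniteness of \<open>\<Sigma>\<close> does not have
  to be established first.\<close>

lemma prob_space_normal_vec: "prob_space (normal_vec m \<Sigma>)"
  unfolding normal_vec_def
proof (rule prob_space.prob_space_distr [OF prob_space_std_normal_vec])
  have "(\<lambda>z. m + (SOME A. A ** transpose A = \<Sigma>) *v z) \<in> borel_measurable borel"
    by (intro borel_measurable_continuous_onI continuous_intros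
        linear_continuous_on_compose [OF continuous_on_id matrix_vector_mul_linear])
  then show "(\<lambda>z. m + (SOME A. A ** transpose A = \<Sigma>) *v z) \<in> borel_measurable std_normal_vec"
    by (simp add: std_normal_vec_def)
qed

text \<open>Tightness from above, meant for nonnegative variables. Asking for it eventually in
  \<open>n\<close> lets it follow directly from a weak limit.\<close>

definition bounded_in_prob :: "'w measure \<Rightarrow> (nat \<Rightarrow> 'w \<Rightarrow> real) \<Rightarrow> bool" where
  "bounded_in_prob M f \<longleftrightarrow>
     (\<forall>\<eta>>0. \<exists>K. \<forall>\<^sub>F n in sequentially. measure M {\<omega> \<in> space M. K < f n \<omega>} \<le> \<eta>)"

context prob_space
begin

lemma bounded_in_prob_add:
  assumes f: "bounded_in_prob M f" "\<And>n. f n \<in> borel_measurable M"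
    and g: "bounded_in_prob M g" "\<And>n. g n \<in> borel_measurable M"
  shows "bounded_in_prob M (\<lambda>n \<omega>. f n \<omega> + g n \<omega>)"
  unfolding bounded_in_prob_def
proof (intro allI impI)
  fix \<eta> :: real assume \<eta>: "\<eta> > 0"
  note [measurable] = f(2) g(2)
  obtain K where K: "\<forall>\<^sub>F n in sequentially. prob {\<omega> \<in> space M. K < f n \<omega>} \<le> \<eta> / 2"
    using f(1) \<eta> unfolding bounded_in_prob_def by (meson half_gt_zero)
  obtain L where L: "\<forall>\<^sub>F n in sequentially. prob {\<omega> \<in> space M. L < g n \<omega>} \<le> \<eta> / 2"
    using g(1) \<eta> unfolding bounded_in_prob_def by (meson half_gt_zero)
  have "\<forall>\<^sub>F n in sequentially. prob {\<omega> \<in> space M. K + L < f n \<omega> + g n \<omega>} \<le> \<eta>"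
    using K L
  proof eventually_elim
    case (elim n)
    have "prob {\<omega> \<in> space M. K + L < f n \<omega> + g n \<omega>} \<le> prob ({\<omega> \<in> space M. K < f n \<omega>} \<union> {\<omega> \<in> space M. L < g n \<omega>})"
      by (intro finite_measure_mono) auto
    also have "\<dots> \<le> prob {\<omega> \<in> space M. K < f n \<omega>} + prob {\<omega> \<in> space M. L < g n \<omega>}"
      by (intro measure_Un_le) auto
    finally show ?case using elim by simp
  qed
  then show "\<exists>K. \<forall>\<^sub>F n in sequentially. prob {\<omega> \<in> space M. K < f n \<omega> + g n \<omega>} \<le> \<eta>" ..
qed

lemma bounded_in_prob_expectation:
  assumes f: "\<And>n. integrable M (f n)" "\<And>n \<omega>. 0 \<le> f n \<omega>" and c: "\<And>n. expectation (f n) \<le> c"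
  shows "bounded_in_prob M f"
  unfolding bounded_in_prob_def
proof (intro allI impI)
  fix \<eta> :: real assume \<eta>: "\<eta> > 0"
  define K where "K = (\<bar>c\<bar> + 1) / \<eta>"
  have K: "K > 0" using \<eta> by (simp add: K_def add_nonneg_pos)
  have "prob {\<omega> \<in> space M. K < f n \<omega>} \<le> \<eta>" for n
  proof -
    have [measurable]: "f n \<in> borel_measurable M" using f(1) by auto
    have "prob {\<omega> \<in> space M. K < f n \<omega>} \<le> prob {\<omega> \<in> space M. K \<le> f n \<omega>}"
      by (intro finite_measure_mono) auto
    also have "\<dots> \<le> expectation (f n) / K"
      using f K by (intro integral_Markov_inequality_measure [where A = "{}"]) auto
    also have "\<dots> \<le> (\<bar>c\<bar> + 1) / K" using c [of n] K by (intro divide_right_mono) auto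
    also have "\<dots> = \<eta>" using \<eta> by (simp add: K_def add_nonneg_pos)
    finally show ?thesis .
  qed
  then show "\<exists>K. \<forall>\<^sub>F n in sequentially. prob {\<omega> \<in> space M. K < f n \<omega>} \<le> \<eta>"
    by (intro exI [of _ K] always_eventually allI)
qed

text \<open>Half of the portmanteau argument: the continuous function \<open>f k\<close> dominates
  the indicator of \<open>norm z > k + 1\<close>, and its integral under the limit law tends to zero
  with \<open>k\<close>.\<close>

lemma bounded_in_prob_weak_conv_top:
  fixes h :: "nat \<Rightarrow> 'a \<Rightarrow> 'b::euclidean_space"
  assumes h: "\<And>n. h n \<in> borel_measurable M" and N: "prob_space N" "sets N = sets borel"
    and conv: "weak_conv_top (\<lambda>n. distr M borel (h n)) N"
  shows "bounded_in_prob M (\<lambda>n \<omega>. norm (h n \<omega>))"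
  unfolding bounded_in_prob_def
proof (intro allI impI)
  fix \<eta> :: real assume \<eta>: "\<eta> > 0"
  interpret N: prob_space N by fact
  define f :: "nat \<Rightarrow> 'b \<Rightarrow> real" where "f k z = 1 - cts_step k (real k + 1) (norm z)" for k z
  have f_cont: "continuous_on UNIV (f k)" for k
    unfolding f_def
    by (intro continuous_intros continuous_on_compose2 [OF continuous_cts_step [of _ _ UNIV]]) auto
  have f_bd: "0 \<le> f k z" "f k z \<le> 1" for k z
    using cts_step_bounds [of "real k" "real k + 1" "norm z"] by (auto simp: f_def)
  have f_m: "f k \<in> borel_measurable borel" for k
    by (rule borel_measurable_continuous_onI [OF f_cont])
  have f_N: "f k \<in> borel_measurable N" for k using f_m N(2) measurable_cong_sets by blast
  have "(\<lambda>k. \<integral>z. f k z \<partial>N) \<longlonglongrightarrow> (\<integral>z. 0 \<partial>N)"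
  proof (rule integral_dominated_convergence [where w = "\<lambda>_. 1"])
    show "AE z in N. (\<lambda>k. f k z) \<longlonglongrightarrow> 0"
    proof (intro always_eventually allI)
      fix z
      have "\<forall>\<^sub>F k in sequentially. f k z = 0"
        by (rule eventually_sequentiallyI [of "nat \<lceil>norm z\<rceil>"]) (auto simp: f_def cts_step_def nat_le_iff ceiling_le_iff)
      then show "(\<lambda>k. f k z) \<longlonglongrightarrow> 0" by (rule tendsto_eventually)
    qed
  qed (use f_N f_bd in auto)
  then obtain k where k: "(\<integral>z. f k z \<partial>N) < \<eta>"
    using order_tendstoD(2) [of _ "0::real" sequentially \<eta>] \<eta> by (auto simp: eventually_sequentially)
  have "bounded (range (f k))" using f_bd by (auto intro!: boundedI [of _ 1])
  then have "(\<lambda>n. \<integral>z. f k z \<partial>distr M borel (h n)) \<longlonglongrightarrow> (\<integral>z. f k z \<partial>N)"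
    using conv f_cont unfolding weak_conv_top_def by blast
  from order_tendstoD(2) [OF this k]
  have "\<forall>\<^sub>F n in sequentially. prob {\<omega> \<in> space M. real k + 1 < norm (h n \<omega>)} \<le> \<eta>"
  proof eventually_elim
    case (elim n)
    note [measurable] = h
    have hf: "(\<lambda>\<omega>. f k (h n \<omega>)) \<in> borel_measurable M" by (rule measurable_compose [OF h f_m])
    have "prob {\<omega> \<in> space M. real k + 1 < norm (h n \<omega>)} = expectation (indicator {\<omega> \<in> space M. real k + 1 < norm (h n \<omega>)})"
      by simp
    also have "\<dots> \<le> expectation (\<lambda>\<omega>. f k (h n \<omega>))"
      using f_bd hf
      by (intro integral_mono integrable_const_bound [where B = 1])
        (auto simp: f_def cts_step_def split: split_indicator)
    also have "\<dots> = (\<integral>z. f k z \<partial>distr M borel (h n))" using h f_m by (simp add: integral_distr)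
    finally show ?case using elim by simp
  qed
  then show "\<exists>K. \<forall>\<^sub>F n in sequentially. prob {\<omega> \<in> space M. K < norm (h n \<omega>)} \<le> \<eta>" ..
qed

text \<open>Removes the restriction to \<open>W \<le> K\<close>: where \<open>D\<close> is large,
  either \<open>W\<close> exceeds the level, which has probability at most
  \<open>\<eta> / 2\<close>, or the outcome lies outside an inner event of probability tending to
  one.\<close>

lemma conv_in_prob_of_bounded:
  fixes D :: "nat \<Rightarrow> 'a \<Rightarrow> real"
  assumes W: "bounded_in_prob M W" "\<And>n. W n \<in> borel_measurable M"
    and D: "\<And>n. D n \<in> borel_measurable M"
    and lim: "\<And>K. K > 0 \<Longrightarrow> ((\<lambda>\<xi>. D (fst \<xi>) (snd \<xi>)) \<longlongrightarrow> 0) (inf (wp1 M) (principal {\<xi>. W (fst \<xi>) (snd \<xi>) \<le> K}))"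
    and e: "e > 0" and \<eta>: "\<eta> > 0"
  shows "\<forall>\<^sub>F n in sequentially. prob {\<omega> \<in> space M. e \<le> \<bar>D n \<omega>\<bar>} \<le> \<eta>"
proof -
  note [measurable] = W(2) D
  obtain K0 where K0: "\<forall>\<^sub>F n in sequentially. prob {\<omega> \<in> space M. K0 < W n \<omega>} \<le> \<eta> / 2"
    using W(1) \<eta> unfolding bounded_in_prob_def by (meson half_gt_zero)
  \<comment> \<open>The limit is available for positive levels only, hence the maximum with
    one.\<close>
  define K where "K = max K0 1"
  have "\<forall>\<^sub>F \<xi> in wp1 M. W (fst \<xi>) (snd \<xi>) \<le> K \<longrightarrow> \<bar>D (fst \<xi>) (snd \<xi>)\<bar> < e"
    using tendstoD [OF lim e, of K] by (simp add: eventually_inf_principal K_def)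
  then obtain A where A: "\<And>n. A n \<in> events" "\<And>n \<omega>. \<omega> \<in> A n \<Longrightarrow> W n \<omega> \<le> K \<longrightarrow> \<bar>D n \<omega>\<bar> < e" "(\<lambda>n. prob (A n)) \<longlonglongrightarrow> 1"
    unfolding eventually_wp1 with_prob_tending_to_one_def by auto
  from order_tendstoD(1) [OF A(3), of "1 - \<eta> / 2"] \<eta>
  have "\<forall>\<^sub>F n in sequentially. 1 - \<eta> / 2 < prob (A n)" by simp
  with K0 show ?thesis
  proof eventually_elim
    case (elim n)
    have "prob {\<omega> \<in> space M. e \<le> \<bar>D n \<omega>\<bar>} \<le> prob ((space M - A n) \<union> {\<omega> \<in> space M. K0 < W n \<omega>})"
    proof (intro finite_measure_mono subsetI)
      fix \<omega> assume "\<omega> \<in> {\<omega> \<in> space M. e \<le> \<bar>D n \<omega>\<bar>}"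
      then show "\<omega> \<in> (space M - A n) \<union> {\<omega> \<in> space M. K0 < W n \<omega>}"
        using A(2) [of \<omega> n] by (auto simp: K_def)
    qed (use A(1) in auto)
    also have "\<dots> \<le> prob (space M - A n) + prob {\<omega> \<in> space M. K0 < W n \<omega>}"
      using A(1) by (intro measure_Un_le) auto
    also have "prob (space M - A n) = 1 - prob (A n)" using A(1) by (rule prob_compl)
    finally show ?case using elim by simp
  qed
qed

text \<open>Slutsky's argument for uniformly continuous functions with values between zero and one:
  where the variables are \<open>d\<close>-close the difference is below \<open>e / 3\<close>, and
  elsewhere it is at most one on a set of small probability.\<close>

lemma cts_step_slutsky:
  fixes T Y :: "nat \<Rightarrow> 'a \<Rightarrow> real"
  assumes T: "\<And>n. T n \<in> borel_measurable M" and Y: "\<And>n. Y n \<in> borel_measurable M" and ab: "a < b"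
    and diff: "\<And>e \<eta>. e > 0 \<Longrightarrow> \<eta> > 0 \<Longrightarrow> \<forall>\<^sub>F n in sequentially. prob {\<omega> \<in> space M. e \<le> \<bar>T n \<omega> - Y n \<omega>\<bar>} \<le> \<eta>"
    and lim: "(\<lambda>n. expectation (\<lambda>\<omega>. cts_step a b (Y n \<omega>))) \<longlonglongrightarrow> l"
  shows "(\<lambda>n. expectation (\<lambda>\<omega>. cts_step a b (T n \<omega>))) \<longlonglongrightarrow> l"
proof -
  note [measurable] = T Y
  have int: "integrable M (\<lambda>\<omega>. cts_step a b (f \<omega>))" if "f \<in> borel_measurable M" for f
    using measurable_compose [OF that cts_step_measurable [OF ab]] cts_step_bounds [OF ab]
    by (intro integrable_const_bound [where B = 1]) auto
  have "(\<lambda>n. expectation (\<lambda>\<omega>. cts_step a b (T n \<omega>)) - expectation (\<lambda>\<omega>. cts_step a b (Y n \<omega>))) \<longlonglongrightarrow> 0"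
  proof (rule tendstoI)
    fix e :: real assume e: "e > 0"
    then have "e / 3 > 0" by simp
    then obtain d where d: "d > 0" "\<And>x y. \<bar>x - y\<bar> < d \<Longrightarrow> \<bar>cts_step a b x - cts_step a b y\<bar> < e / 3"
      using cts_step_uniformly_continuous [OF ab] unfolding uniformly_continuous_on_def dist_real_def
      by (metis UNIV_I)
    show "\<forall>\<^sub>F n in sequentially. dist (expectation (\<lambda>\<omega>. cts_step a b (T n \<omega>)) - expectation (\<lambda>\<omega>. cts_step a b (Y n \<omega>))) 0 < e"
      using diff [OF d(1) \<open>e / 3 > 0\<close>]
    proof eventually_elim
      case (elim n)
      define E where "E = {\<omega> \<in> space M. d \<le> \<bar>T n \<omega> - Y n \<omega>\<bar>}"
      have E: "E \<in> events" unfolding E_def by measurable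
      have "\<bar>expectation (\<lambda>\<omega>. cts_step a b (T n \<omega>)) - expectation (\<lambda>\<omega>. cts_step a b (Y n \<omega>))\<bar>
          = \<bar>expectation (\<lambda>\<omega>. cts_step a b (T n \<omega>) - cts_step a b (Y n \<omega>))\<bar>"
        using int [OF T] int [OF Y] by simp
      also have "\<dots> \<le> expectation (\<lambda>\<omega>. \<bar>cts_step a b (T n \<omega>) - cts_step a b (Y n \<omega>)\<bar>)"
        by (rule integral_abs_bound)
      also have "\<dots> \<le> expectation (\<lambda>\<omega>. e / 3 + indicator E \<omega>)"
      proof (rule integral_mono)
        fix \<omega> assume "\<omega> \<in> space M"
        show "\<bar>cts_step a b (T n \<omega>) - cts_step a b (Y n \<omega>)\<bar> \<le> e / 3 + indicator E \<omega>"
        proof (cases "\<omega> \<in> E")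
          case True
          then show ?thesis using cts_step_bounds [OF ab, of "T n \<omega>"] cts_step_bounds [OF ab, of "Y n \<omega>"] e by auto
        next
          case False
          then show ?thesis using d(2) [of "T n \<omega>" "Y n \<omega>"] \<open>\<omega> \<in> space M\<close> by (auto simp: E_def)
        qed
      next
        show "integrable M (\<lambda>\<omega>. e / 3 + indicator E \<omega> :: real)"
          using E by (intro Bochner_Integration.integrable_add integrable_const integrable_real_indicator) (auto simp: emeasure_eq_measure)
      qed (use int [OF T] int [OF Y] in auto)
      also have "\<dots> = e / 3 + prob E"
      proof -
        have "integrable M (indicator E :: 'a \<Rightarrow> real)"
          using E by (intro integrable_real_indicator) (auto simp: emeasure_eq_measure)
        then show ?thesis using E by (subst Bochner_Integration.integral_add) (auto simp: prob_space)
      qed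
      finally show ?case using elim e by (simp add: E_def dist_real_def)
    qed
  qed
  from tendsto_add [OF this lim] show ?thesis by simp
qed

end

lemma (in prob_space) bounded_in_prob_average:
  fixes b :: "'b \<Rightarrow> real"
  assumes indep: "indep_vars (\<lambda>_. N) X UNIV" and distr: "\<And>i. distr M N (X i) = F"
    and b: "b \<in> borel_measurable N" "integrable F b" "\<And>x. 0 \<le> b x"
  shows "bounded_in_prob M (\<lambda>n \<omega>. (1 / real n) * (\<Sum>i<n. b (X i \<omega>)))"
proof (rule bounded_in_prob_expectation)
  have int: "integrable M (\<lambda>\<omega>. b (X i \<omega>))" for i
    using integral_X(2) [OF indep distr b(1)] b(2) by blast
  show "integrable M (\<lambda>\<omega>. (1 / real n) * (\<Sum>i<n. b (X i \<omega>)))" for n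
    using int by auto
  show "expectation (\<lambda>\<omega>. (1 / real n) * (\<Sum>i<n. b (X i \<omega>))) \<le> integral\<^sup>L F b" for n
    using int integral_X(1) [OF indep distr b(1)] b(3) by (cases "n = 0") (auto intro: integral_nonneg_AE)
qed (use b(3) in \<open>auto intro!: divide_nonneg_nonneg sum_nonneg\<close>)

lemma (in prob_space) bounded_in_prob_normalized_sum:
  fixes f :: "'b \<Rightarrow> real ^ 'n"
  assumes indep: "indep_vars (\<lambda>_. N) X UNIV" and distr: "\<And>i. distr M N (X i) = F"
    and f: "f \<in> borel_measurable N" and f1: "integrable F f" "integral\<^sup>L F f = 0"
    and f2: "\<And>i. integrable F (\<lambda>x. (f x $ i)\<^sup>2)"
  shows "bounded_in_prob M (\<lambda>n \<omega>. (norm ((1 / sqrt (real n)) *\<^sub>R (\<Sum>i<n. f (X i \<omega>))))\<^sup>2)"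
proof (rule bounded_in_prob_expectation)
  have fj: "(\<lambda>x. f x $ j) \<in> borel_measurable N" for j
    using borel_measurable_continuous_on [OF continuous_on_component [OF continuous_on_id] f] .
  have mean: "(\<integral>x. f x $ j \<partial>F) = 0" for j
    using integral_bounded_linear [OF bounded_linear_vec_nth f1(1), of j] f1(2) by simp
  have eq: "(norm ((1 / sqrt (real n)) *\<^sub>R (\<Sum>i<n. f (X i \<omega>))))\<^sup>2 = (1 / real n) * (\<Sum>j\<in>UNIV. (\<Sum>i<n. f (X i \<omega>) $ j)\<^sup>2)" for n \<omega>
  proof -
    have "(norm (\<Sum>i<n. f (X i \<omega>)))\<^sup>2 = (\<Sum>j\<in>UNIV. (\<Sum>i<n. f (X i \<omega>) $ j)\<^sup>2)"
      unfolding power2_norm_eq_inner inner_vec_def by (simp add: power2_eq_square)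
    then show ?thesis by (simp add: power_mult_distrib power_divide)
  qed
  note ms = mean_square_average [OF indep distr fj f2 mean]
  show "integrable M (\<lambda>\<omega>. (norm ((1 / sqrt (real n)) *\<^sub>R (\<Sum>i<n. f (X i \<omega>))))\<^sup>2)" for n
    unfolding eq using ms(1) by (intro integrable_mult_right Bochner_Integration.integrable_sum)
  show "expectation (\<lambda>\<omega>. (norm ((1 / sqrt (real n)) *\<^sub>R (\<Sum>i<n. f (X i \<omega>))))\<^sup>2) \<le> (\<Sum>j\<in>UNIV. \<integral>x. (f x $ j)\<^sup>2 \<partial>F)" for n
    unfolding eq using ms
    by (cases "n = 0") (auto simp: sum_distrib_left [symmetric] intro!: sum_nonneg)
qed auto

section \<open>Convergence to the chi-square law\<close>

lemma sum_squares_measurable: "(\<lambda>z. \<Sum>i<q. (z i)\<^sup>2) \<in> borel_measurable (std_normal_prod q)"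
proof (intro borel_measurable_sum borel_measurable_power)
  fix i assume "i \<in> {..<q}"
  then show "(\<lambda>z. z i) \<in> borel_measurable (std_normal_prod q)"
    using measurable_component_singleton [of i "{..<q}" "\<lambda>_. std_normal_distribution"] by simp
qed

lemma real_distribution_chi_square: "real_distribution (chi_square q)"
  unfolding chi_square_def
  by (rule prob_space.real_distribution_distr [OF prob_space_std_normal_prod sum_squares_measurable])

theorem theorem13:
  fixes M :: "'w measure"
    and X :: "nat \<Rightarrow> 'w \<Rightarrow> real ^ 'k"
    and F :: "(real ^ 'k) measure"
    and \<Theta> :: "(real ^ 'p) set" and \<theta>\<^sub>0 :: "real ^ 'p"
    and g :: "real ^ 'k \<Rightarrow> real ^ 'p \<Rightarrow> real ^ 'p"
    and G :: "real ^ 'k \<Rightarrow> real ^ 'p \<Rightarrow> real ^ 'p ^ 'p"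
    and H :: "real ^ 'k \<Rightarrow> real ^ 'p \<Rightarrow> (real ^ 'p) \<Rightarrow>\<^sub>L (real ^ 'p ^ 'p)"
    and c :: "real ^ 'p \<Rightarrow> real ^ 'q"
    and C :: "real ^ 'p \<Rightarrow> real ^ 'p ^ 'q"
    and D :: "real ^ 'p \<Rightarrow> (real ^ 'p) \<Rightarrow>\<^sub>L (real ^ 'p ^ 'q)"
    and \<theta>hat \<theta>tilde :: "nat \<Rightarrow> 'w \<Rightarrow> real ^ 'p"
    and \<phi> :: "real \<Rightarrow> real"
  defines "S\<^sub>1\<^sub>1 \<equiv> (\<integral>x. outer (g x \<theta>\<^sub>0) (g x \<theta>\<^sub>0) \<partial>F)"
    and "S\<^sub>1\<^sub>2 \<equiv> (\<integral>x. G x \<theta>\<^sub>0 \<partial>F)"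
  defines "V \<equiv> matrix_inv (transpose S\<^sub>1\<^sub>2 ** matrix_inv S\<^sub>1\<^sub>1 ** S\<^sub>1\<^sub>2)"
  defines "Q \<equiv> matrix_inv (C \<theta>\<^sub>0 ** V ** transpose (C \<theta>\<^sub>0))"
  defines "P \<equiv> V - V ** transpose (C \<theta>\<^sub>0) ** Q ** C \<theta>\<^sub>0 ** V"
  defines "T \<equiv> (\<lambda>n \<omega>. phi_statistic \<phi> g n (\<lambda>i. X i \<omega>) (\<theta>hat n \<omega>) (\<theta>tilde n \<omega>))"
  assumes "prob_space M"
    and iid: "prob_space.indep_vars M (\<lambda>_. borel) X UNIV" "\<And>i. distr M borel (X i) = F"
    and \<theta>\<^sub>0: "\<theta>\<^sub>0 \<in> \<Theta>"
    and g_meas: "\<And>\<theta>. \<theta> \<in> \<Theta> \<Longrightarrow> (\<lambda>x. g x \<theta>) \<in> borel_measurable borel"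
    and unbiased: "integrable F (\<lambda>x. g x \<theta>\<^sub>0)" "(\<integral>x. g x \<theta>\<^sub>0 \<partial>F) = 0"
    and i: "pos_def S\<^sub>1\<^sub>1" "rank S\<^sub>1\<^sub>2 = CARD('p)"
    and ii: "\<exists>U b. open U \<and> \<theta>\<^sub>0 \<in> U \<and> U \<subseteq> \<Theta> \<and> integrable F b \<and>
               (\<forall>x. \<forall>\<theta>\<in>U. norm (g x \<theta>) ^ 3 \<le> b x)"
    and iii: "\<exists>U b. open U \<and> \<theta>\<^sub>0 \<in> U \<and> U \<subseteq> \<Theta> \<and> integrable F b \<and>
               (\<forall>x. (\<forall>\<theta>\<in>U. (g x has_derivative (\<lambda>h. G x \<theta> *v h)) (at \<theta>) \<and> norm (G x \<theta>) \<le> b x) \<and>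
                    continuous_on U (G x))"
    and iv: "\<exists>U b. open U \<and> \<theta>\<^sub>0 \<in> U \<and> U \<subseteq> \<Theta> \<and> integrable F b \<and>
               (\<forall>x. (\<forall>\<theta>\<in>U. (G x has_derivative blinfun_apply (H x \<theta>)) (at \<theta>) \<and> norm (H x \<theta>) \<le> b x) \<and>
                    continuous_on U (H x))"
    and v: "CARD('q) \<le> CARD('p)"
           "\<And>\<theta>. \<theta> \<in> \<Theta> \<Longrightarrow> (c has_derivative (\<lambda>h. C \<theta> *v h)) (at \<theta>)"
           "continuous_on \<Theta> C"
           "\<And>\<theta>. \<theta> \<in> \<Theta> \<Longrightarrow> rank (C \<theta>) = CARD('q)"
           "\<exists>U K. open U \<and> \<theta>\<^sub>0 \<in> U \<and> U \<subseteq> \<Theta> \<and>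
               (\<forall>\<theta>\<in>U. (C has_derivative blinfun_apply (D \<theta>)) (at \<theta>) \<and> norm (D \<theta>) \<le> K)"
    and estimators_meas: "\<And>n. \<theta>hat n \<in> borel_measurable M" "\<And>n. \<theta>tilde n \<in> borel_measurable M"
    and \<theta>hat: "with_prob_tending_to_one M
                 (\<lambda>n \<omega>. el_maximizer g n (\<lambda>i. X i \<omega>) \<Theta> (\<theta>hat n \<omega>))"
    and \<theta>tilde: "with_prob_tending_to_one M
                 (\<lambda>n \<omega>. el_maximizer g n (\<lambda>i. X i \<omega>) {\<theta> \<in> \<Theta>. c \<theta> = 0} (\<theta>tilde n \<omega>))"
    and \<theta>hat_law: "weak_conv_top
                 (\<lambda>n. distr M borel (\<lambda>\<omega>. sqrt (real n) *\<^sub>R (\<theta>hat n \<omega> - \<theta>\<^sub>0))) (normal_vec 0 V)"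
    and \<theta>tilde_law: "weak_conv_top
                 (\<lambda>n. distr M borel (\<lambda>\<omega>. sqrt (real n) *\<^sub>R (\<theta>tilde n \<omega> - \<theta>\<^sub>0))) (normal_vec 0 P)"
    and H\<^sub>0: "c \<theta>\<^sub>0 = 0"
    and \<phi>: "\<phi> \<in> phi_class"
    and T_meas: "\<And>n. T n \<in> borel_measurable M"
  shows "weak_conv_m (\<lambda>n. distr M borel (T n)) (chi_square CARD('q))"
proof -
  interpret prob_space M by fact
  note indep = iid(1) and distr = iid(2)
  let ?q = "CARD('q)"
  have sets_F: "sets F = sets borel" using distr [of 0] by (metis sets_distr)

  obtain U2 b2 where 2: "open U2" "\<theta>\<^sub>0 \<in> U2" "U2 \<subseteq> \<Theta>" "integrable F b2"
    "\<And>x \<theta>. \<theta> \<in> U2 \<Longrightarrow> norm (g x \<theta>) ^ 3 \<le> b2 x" using ii by blast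
  obtain U3 b3 where 3: "open U3" "\<theta>\<^sub>0 \<in> U3" "integrable F b3"
    "\<And>x \<theta>. \<theta> \<in> U3 \<Longrightarrow> (g x has_derivative (\<lambda>h. G x \<theta> *v h)) (at \<theta>)"
    "\<And>x \<theta>. \<theta> \<in> U3 \<Longrightarrow> norm (G x \<theta>) \<le> b3 x" using iii by blast
  obtain U4 b4 where 4: "open U4" "\<theta>\<^sub>0 \<in> U4" "integrable F b4"
    "\<And>x \<theta>. \<theta> \<in> U4 \<Longrightarrow> (G x has_derivative blinfun_apply (H x \<theta>)) (at \<theta>)"
    "\<And>x \<theta>. \<theta> \<in> U4 \<Longrightarrow> norm (H x \<theta>) \<le> b4 x" using iv by blast
  have "open (U2 \<inter> U3 \<inter> U4)" "\<theta>\<^sub>0 \<in> U2 \<inter> U3 \<inter> U4" using 2 3 4 by auto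
  then obtain \<rho> where \<rho>_ball: "\<rho> > 0" "ball \<theta>\<^sub>0 \<rho> \<subseteq> U2 \<inter> U3 \<inter> U4"
    using open_contains_ball by blast
  \<comment> \<open>The three envelopes are merged into a single nonnegative one, valid on a common
    ball, as the pathwise model requires.\<close>
  define b where "b x = \<bar>b2 x\<bar> + \<bar>b3 x\<bar> + \<bar>b4 x\<bar>" for x
  have b_int: "integrable F b" unfolding b_def using 2(4) 3(3) 4(3) by auto
  have b_meas: "b \<in> borel_measurable borel"
    using borel_measurable_integrable [OF b_int] measurable_cong_sets [OF sets_F refl] by blast
  have b_le: "b2 x \<le> b x" "b3 x \<le> b x" "b4 x \<le> b x" "0 \<le> b x" for x by (auto simp: b_def)

  define g0 where "g0 x = g x \<theta>\<^sub>0" for x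
  have g0: "g0 \<in> borel_measurable borel" unfolding g0_def by (rule g_meas [OF \<theta>\<^sub>0])
  \<comment> \<open>A non-integrable function has integral zero by convention, which would
    contradict positive definiteness here, and full rank for the derivative below. Measurability of
    both integrands is then obtained from their integrability.\<close>
  have S11_int: "integrable F (\<lambda>x. outer (g0 x) (g0 x))"
  proof (rule ccontr)
    assume "\<not> ?thesis"
    then have "S\<^sub>1\<^sub>1 = 0" by (simp add: S\<^sub>1\<^sub>1_def g0_def not_integrable_integral_eq)
    moreover have "axis undefined 1 \<noteq> (0 :: real ^ 'p)" by (simp add: axis_eq_0_iff)
    ultimately show False using i(1) by (metis inner_zero_right less_irrefl matrix_vector_mult_0 pos_def_def)
  qed
  have S12_int: "integrable F (\<lambda>x. G x \<theta>\<^sub>0)"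
  proof (rule ccontr)
    assume "\<not> ?thesis"
    then have "S\<^sub>1\<^sub>2 = 0" by (simp add: S\<^sub>1\<^sub>2_def not_integrable_integral_eq)
    then show False using i(2) by simp
  qed
  have S11_meas: "(\<lambda>x. outer (g0 x) (g0 x)) \<in> borel_measurable borel"
    using borel_measurable_integrable [OF S11_int] measurable_cong_sets [OF sets_F refl] by blast
  have S12_meas: "(\<lambda>x. G x \<theta>\<^sub>0) \<in> borel_measurable borel"
    using borel_measurable_integrable [OF S12_int] measurable_cong_sets [OF sets_F refl] by blast
  have form: "integrable F (\<lambda>x. (u \<bullet> g0 x) * (w \<bullet> g0 x))" "(\<integral>x. (u \<bullet> g0 x) * (w \<bullet> g0 x) \<partial>F) = u \<bullet> (S\<^sub>1\<^sub>1 *v w)" for u w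
  proof -
    have bl: "bounded_linear (\<lambda>A :: real ^ 'p ^ 'p. u \<bullet> (A *v w))"
      using bounded_linear_compose [OF bounded_linear_inner_right
          bounded_bilinear.bounded_linear_left [OF bounded_bilinear_matrix_vector_mult]] .
    have eq: "u \<bullet> (outer (g0 x) (g0 x) *v w) = (u \<bullet> g0 x) * (w \<bullet> g0 x)" for x
      by (simp add: outer_mult_vec inner_commute)
    show "integrable F (\<lambda>x. (u \<bullet> g0 x) * (w \<bullet> g0 x))"
      using integrable_bounded_linear [OF bl S11_int] by (simp add: eq)
    show "(\<integral>x. (u \<bullet> g0 x) * (w \<bullet> g0 x) \<partial>F) = u \<bullet> (S\<^sub>1\<^sub>1 *v w)"
      using integral_bounded_linear [OF bl S11_int] unfolding eq by (simp only: S\<^sub>1\<^sub>1_def g0_def)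
  qed

  obtain a L where a: "\<forall>i<?q. \<forall>j<?q. a i \<bullet> (S\<^sub>1\<^sub>1 *v a j) = (if i = j then 1 else 0)"
    and low: "\<forall>z h. C \<theta>\<^sub>0 *v h = 0 \<longrightarrow> (\<Sum>i<?q. (a i \<bullet> z)\<^sup>2) \<le> (z + S\<^sub>1\<^sub>2 *v h) \<bullet> (matrix_inv S\<^sub>1\<^sub>1 *v (z + S\<^sub>1\<^sub>2 *v h))"
    and attained: "\<forall>z. \<exists>h. C \<theta>\<^sub>0 *v h = 0 \<and> norm h \<le> L * norm z \<and>
       (z + S\<^sub>1\<^sub>2 *v h) \<bullet> (matrix_inv S\<^sub>1\<^sub>1 *v (z + S\<^sub>1\<^sub>2 *v h)) = (\<Sum>i<?q. (a i \<bullet> z)\<^sup>2)"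
    using constrained_minimum [OF i v(4) [OF \<theta>\<^sub>0]] by blast
  define Z where "Z n \<omega> = (1 / sqrt (real n)) *\<^sub>R (\<Sum>k<n. g0 (X k \<omega>))" for n \<omega>
  define h where "h n \<omega> = sqrt (real n) *\<^sub>R (\<theta>tilde n \<omega> - \<theta>\<^sub>0)" for n \<omega>
  define avg where "avg n \<omega> = (1 / real n) * (\<Sum>i<n. b (X i \<omega>))" for n \<omega>
  define Y where "Y n \<omega> = (\<Sum>i<?q. (a i \<bullet> Z n \<omega>)\<^sup>2)" for n \<omega>
  have X: "X k \<in> borel_measurable M" for k using X_meas [OF indep distr] .
  have Z_meas: "Z n \<in> borel_measurable M" for n
    unfolding Z_def using measurable_compose [OF X g0] by (intro borel_measurable_scaleR borel_measurable_sum borel_measurable_const)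
  have h_meas: "h n \<in> borel_measurable M" for n
    unfolding h_def using estimators_meas(2) by (intro borel_measurable_scaleR borel_measurable_diff borel_measurable_const)
  have avg_meas: "avg n \<in> borel_measurable M" for n
    unfolding avg_def using measurable_compose [OF X b_meas] by (intro borel_measurable_times borel_measurable_sum borel_measurable_const)
  have Y_meas: "Y n \<in> borel_measurable M" for n
    unfolding Y_def using Z_meas by (intro borel_measurable_sum borel_measurable_power borel_measurable_inner borel_measurable_const)

  \<comment> \<open>One variable that dominates all random quantities needed to be bounded, so that
    the single event \<open>W \<le> K\<close> supplies every constant of the pathwise model. The
    square on \<open>Z\<close> allows a direct second moment bound.\<close>
  define W where "W n \<omega> = (norm (Z n \<omega>))\<^sup>2 + norm (h n \<omega>) + avg n \<omega>" for n \<omega>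
  have Zn_meas: "(\<lambda>\<omega>. (norm (Z n \<omega>))\<^sup>2) \<in> borel_measurable M" for n
    by (intro borel_measurable_power measurable_compose [OF Z_meas borel_measurable_norm])
  have hn_meas: "(\<lambda>\<omega>. norm (h n \<omega>)) \<in> borel_measurable M" for n
    by (rule measurable_compose [OF h_meas borel_measurable_norm])
  have W_meas: "W n \<in> borel_measurable M" for n
    unfolding W_def by (intro borel_measurable_add Zn_meas hn_meas avg_meas)
  have W: "bounded_in_prob M W"
    unfolding W_def
  proof (intro bounded_in_prob_add borel_measurable_add Zn_meas hn_meas avg_meas)
    have "integrable F (\<lambda>x. (g0 x $ j)\<^sup>2)" for j
      using form(1) [of "axis j 1" "axis j 1"] by (simp add: inner_axis' power2_eq_square)
    then show "bounded_in_prob M (\<lambda>n \<omega>. (norm (Z n \<omega>))\<^sup>2)"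
      unfolding Z_def using unbiased g_meas [OF \<theta>\<^sub>0]
      by (intro bounded_in_prob_normalized_sum [OF indep distr]) (auto simp: g0_def)
    show "bounded_in_prob M (\<lambda>n \<omega>. norm (h n \<omega>))"
    proof (rule bounded_in_prob_weak_conv_top [OF h_meas prob_space_normal_vec])
      show "sets (normal_vec 0 P) = sets borel" by (simp add: normal_vec_def)
      show "weak_conv_top (\<lambda>n. distr M borel (h n)) (normal_vec 0 P)"
        using \<theta>tilde_law by (simp add: h_def [abs_def])
    qed
    show "bounded_in_prob M avg"
      unfolding avg_def by (rule bounded_in_prob_average [OF indep distr b_meas b_int b_le(4)])
  qed

  have diff: "((\<lambda>\<xi>. T (fst \<xi>) (snd \<xi>) - Y (fst \<xi>) (snd \<xi>)) \<longlongrightarrow> 0)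
      (inf (wp1 M) (principal {\<xi>. W (fst \<xi>) (snd \<xi>) \<le> K}))" if K: "K > 0" for K
  proof -
    define FK where "FK = inf (wp1 M) (principal {\<xi>. W (fst \<xi>) (snd \<xi>) \<le> K})"
    define x where "x \<xi> i = X i (snd \<xi>)" for \<xi> :: "nat \<times> 'w" and i
    have le: "FK \<le> wp1 M" by (simp add: FK_def)
    have WK: "\<forall>\<^sub>F \<xi> in FK. W (fst \<xi>) (snd \<xi>) \<le> K" by (simp add: FK_def eventually_inf_principal)
    have W_split: "(norm (Z n \<omega>))\<^sup>2 \<le> W n \<omega>" "norm (h n \<omega>) \<le> W n \<omega>" "avg n \<omega> \<le> W n \<omega>" for n \<omega>
      using b_le(4) by (auto simp: W_def avg_def intro!: add_nonneg_nonneg divide_nonneg_nonneg sum_nonneg)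
    \<comment> \<open>The bound on the normalized sum is \<open>sqrt K\<close>, because
      \<open>W\<close> contains the square of its norm.\<close>
    interpret estimating_data FK fst x g G H \<theta>\<^sub>0 \<rho> b K "sqrt K" S\<^sub>1\<^sub>1 S\<^sub>1\<^sub>2
    proof
      show "filterlim fst at_top FK" by (rule filterlim_mono [OF fst_wp1 order_refl le])
      show "norm (g x \<theta>) ^ 3 \<le> b x" if "\<theta> \<in> ball \<theta>\<^sub>0 \<rho>" for x \<theta>
        using 2(5) [of \<theta> x] that \<rho>_ball(2) b_le(1) [of x] by fastforce
      show "(g x has_derivative (\<lambda>h. G x \<theta> *v h)) (at \<theta>)" if "\<theta> \<in> ball \<theta>\<^sub>0 \<rho>" for x \<theta>
        using 3(4) that \<rho>_ball(2) by blast
      show "norm (G x \<theta>) \<le> b x" if "\<theta> \<in> ball \<theta>\<^sub>0 \<rho>" for x \<theta>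
        using 3(5) [of \<theta> x] that \<rho>_ball(2) b_le(2) [of x] by fastforce
      show "(G x has_derivative blinfun_apply (H x \<theta>)) (at \<theta>)" if "\<theta> \<in> ball \<theta>\<^sub>0 \<rho>" for x \<theta>
        using 4(4) that \<rho>_ball(2) by blast
      show "norm (H x \<theta>) \<le> b x" if "\<theta> \<in> ball \<theta>\<^sub>0 \<rho>" for x \<theta>
        using 4(5) [of \<theta> x] that \<rho>_ball(2) b_le(3) [of x] by fastforce
      show "\<forall>\<^sub>F \<xi> in FK. (\<Sum>i<fst \<xi>. b (x \<xi> i)) \<le> K * real (fst \<xi>)"
        using WK
      proof eventually_elim
        case (elim \<xi>)
        then have "avg (fst \<xi>) (snd \<xi>) \<le> K" using W_split(3) order.trans by blast
        then show ?case by (cases "fst \<xi> = 0") (auto simp: avg_def x_def field_simps)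
      qed
      show "\<forall>\<^sub>F \<xi> in FK. norm ((1 / sqrt (real (fst \<xi>))) *\<^sub>R (\<Sum>i<fst \<xi>. g (x \<xi> i) \<theta>\<^sub>0)) \<le> sqrt K"
        using WK
      proof eventually_elim
        case (elim \<xi>)
        then have "(norm (Z (fst \<xi>) (snd \<xi>)))\<^sup>2 \<le> K" using W_split(1) order.trans by blast
        then have "norm (Z (fst \<xi>) (snd \<xi>)) \<le> sqrt K" by (rule real_le_rsqrt)
        then show ?case by (simp add: Z_def g0_def x_def)
      qed
      show "((\<lambda>\<xi>. (1 / real (fst \<xi>)) *\<^sub>R (\<Sum>i<fst \<xi>. outer (g (x \<xi> i) \<theta>\<^sub>0) (g (x \<xi> i) \<theta>\<^sub>0))) \<longlongrightarrow> S\<^sub>1\<^sub>1) FK"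
        using tendsto_mono [OF le weak_law_matrix_wp1 [OF indep distr S11_meas S11_int]]
        by (simp add: S\<^sub>1\<^sub>1_def g0_def x_def)
      show "((\<lambda>\<xi>. (1 / real (fst \<xi>)) *\<^sub>R (\<Sum>i<fst \<xi>. G (x \<xi> i) \<theta>\<^sub>0)) \<longlongrightarrow> S\<^sub>1\<^sub>2) FK"
        using tendsto_mono [OF le weak_law_matrix_wp1 [OF indep distr S12_meas S12_int]]
        by (simp add: S\<^sub>1\<^sub>2_def x_def)
    qed (use \<rho>_ball K i in auto)
    have "((\<lambda>\<xi>. phi_statistic \<phi> g (fst \<xi>) (x \<xi>) (\<theta>hat (fst \<xi>) (snd \<xi>)) (\<theta>tilde (fst \<xi>) (snd \<xi>))
        - (\<Sum>i<?q. (a i \<bullet> zn \<theta>\<^sub>0 \<xi>)\<^sup>2)) \<longlongrightarrow> 0) FK"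
    proof (rule phi_statistic_lim [where \<Theta> = \<Theta> and c = c and C = "C \<theta>\<^sub>0" and r = K and m = "\<lambda>z. \<Sum>i<?q. (a i \<bullet> z)\<^sup>2" and L = L])
      show \<Theta>: "ball \<theta>\<^sub>0 \<rho> \<subseteq> \<Theta>" using \<rho>_ball(2) 2(3) by blast
      show "continuous_on (ball \<theta>\<^sub>0 \<rho>) c"
        using \<Theta> v(2) by (auto intro!: continuous_at_imp_continuous_on has_derivative_continuous)
      show "\<forall>\<^sub>F \<xi> in FK. el_maximizer g (fst \<xi>) (x \<xi>) \<Theta> (\<theta>hat (fst \<xi>) (snd \<xi>))"
        using \<theta>hat by (intro filter_leD [OF le]) (simp add: eventually_wp1 x_def [abs_def])
      show "\<forall>\<^sub>F \<xi> in FK. el_maximizer g (fst \<xi>) (x \<xi>) {\<theta> \<in> \<Theta>. c \<theta> = 0} (\<theta>tilde (fst \<xi>) (snd \<xi>))"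
        using \<theta>tilde by (intro filter_leD [OF le]) (simp add: eventually_wp1 x_def [abs_def])
      show "\<forall>\<^sub>F \<xi> in FK. norm (sqrt (real (fst \<xi>)) *\<^sub>R (\<theta>tilde (fst \<xi>) (snd \<xi>) - \<theta>\<^sub>0)) \<le> K"
        using WK
      proof eventually_elim
        case (elim \<xi>)
        then have "norm (h (fst \<xi>) (snd \<xi>)) \<le> K" using W_split(2) order.trans by blast
        then show ?case by (simp only: h_def)
      qed
    qed (use v(2,4) \<theta>\<^sub>0 H\<^sub>0 \<phi> low attained in auto)
    moreover have "zn \<theta>\<^sub>0 \<xi> = Z (fst \<xi>) (snd \<xi>)" for \<xi>
      by (simp add: zn_def \<gamma>_def Z_def g0_def x_def scaleR_sum_right)
    ultimately show ?thesis by (simp add: T_def Y_def FK_def x_def [abs_def])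
  qed
  have diff_prob: "\<forall>\<^sub>F n in sequentially. prob {\<omega> \<in> space M. e \<le> \<bar>T n \<omega> - Y n \<omega>\<bar>} \<le> \<eta>"
    if "e > 0" "\<eta> > 0" for e \<eta>
    by (rule conv_in_prob_of_bounded [OF W W_meas _ diff that]) (intro borel_measurable_diff T_meas Y_meas)

  \<comment> \<open>The covariance of \<open>f i\<close> and \<open>f j\<close> is the form of
    \<open>S\<^sub>1\<^sub>1\<close> at \<open>a i\<close> and \<open>a j\<close>, so the
    orthonormality of the \<open>a i\<close> is exactly the unit covariance asked for by the Laplace
    transform lemma.\<close>
  define f where "f i x = a i \<bullet> g0 x" for i x
  have Y_f: "Y n \<omega> = (\<Sum>i<?q. ((1 / sqrt (real n)) * (\<Sum>k<n. f i (X k \<omega>)))\<^sup>2)" for n \<omega>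
    by (simp add: Y_def Z_def f_def inner_sum_right)
  have lap: "(\<lambda>n. expectation (\<lambda>\<omega>. exp (- s * Y n \<omega>)))
      \<longlonglongrightarrow> (\<integral>w. exp (- s * (\<Sum>i<?q. (w i)\<^sup>2)) \<partial>std_normal_prod ?q)" if "s \<ge> 0" for s
    unfolding Y_f
  proof (rule laplace_sum_squares_conv [OF indep distr _ _ _ _ that])
    show "f i \<in> borel_measurable borel" for i
      unfolding f_def using g0 by (intro borel_measurable_inner borel_measurable_const)
    show "integrable F (\<lambda>x. (f i x)\<^sup>2)" for i
      using form(1) [of "a i" "a i"] by (simp add: f_def power2_eq_square)
    show "integral\<^sup>L F (f i) = 0" for i
      using integral_bounded_linear [OF bounded_linear_inner_right unbiased(1), of "a i"] unbiased(2)
      by (simp add: f_def [abs_def] g0_def)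
    show "(\<integral>x. f i x * f j x \<partial>F) = (if i = j then 1 else 0)" if "i < ?q" "j < ?q" for i j
      using form(2) [of "a i" "a j"] a that by (simp add: f_def)
  qed
  show ?thesis
  proof (rule integral_cts_step_conv_imp_weak_conv)
    show "real_distribution (distr M borel (T n))" for n
      by (rule real_distribution_distr [OF T_meas])
    show "real_distribution (chi_square ?q)" by (rule real_distribution_chi_square)
    fix \<alpha> \<beta> :: real assume ab: "\<alpha> < \<beta>"
    have "(\<lambda>n. expectation (\<lambda>\<omega>. cts_step \<alpha> \<beta> (Y n \<omega>)))
       \<longlonglongrightarrow> (\<integral>z. cts_step \<alpha> \<beta> (\<Sum>i<?q. (z i)\<^sup>2) \<partial>std_normal_prod ?q)"
      using lap by (intro cts_step_conv_of_laplace [OF \<open>prob_space M\<close> prob_space_std_normal_prod Y_meas _ sum_squares_measurable _ _ ab])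
        (auto simp: Y_def intro!: sum_nonneg)
    from cts_step_slutsky [OF T_meas Y_meas ab diff_prob this]
    have "(\<lambda>n. expectation (\<lambda>\<omega>. cts_step \<alpha> \<beta> (T n \<omega>)))
       \<longlonglongrightarrow> (\<integral>z. cts_step \<alpha> \<beta> (\<Sum>i<?q. (z i)\<^sup>2) \<partial>std_normal_prod ?q)"
      by blast
    then show "(\<lambda>n. \<integral>y. cts_step \<alpha> \<beta> y \<partial>distr M borel (T n)) \<longlonglongrightarrow> (\<integral>y. cts_step \<alpha> \<beta> y \<partial>chi_square ?q)"
      unfolding chi_square_def
      using T_meas sum_squares_measurable cts_step_measurable [OF ab] by (simp add: integral_distr)
  qed
qed

end
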